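(* The following decision problem is NP-complete: given a bipartite graph $G=(S,T;E)$ with an ordering $S=\{s_1,\dots,s_n\}$ and a positive integer $d$, decide whether $G$ has a perfect $d$-distance matching. It remains NP-complete even when restricted to instances in which the maximum degree of $G$ is at most $4$.
   Context: $G=(S,T;E)$ is a finite bipartite graph without loops or parallel edges, and the nodes of $S$ are given in a fixed linear order $s_1,\dots,s_n$. For $d\in\mathbb Z_+$, a $d$-distance matching is a subset $M\subseteq E$ such that (i) every node of $S$ is incident to at most one edge of $M$, and (ii) whenever $s_it,s_jt\in M$ with $i\neq j$ and $t\in T$, we have $|j-i|\ge d$. It is perfect if every node of $S$ is incident to exactly one edge of $M$. *)

theory Defs
  imports "HOL-Computational_Algebra.Polynomial"
begin

section \<open>Deterministic multi-tape Turing machines\<close>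

text \<open>
  Live states are the numbers below \<open>states M\<close>, the start state is 0 and the single halting
  state is \<open>states M\<close>. Tape symbols are the numbers below \<open>symbols M\<close>, with 0 the blank.
  Tapes are infinite in both directions.
\<close>

datatype move = MoveLeft | Stay | MoveRight

record tm =
  tapes :: nat
  symbols :: nat
  states :: nat
  delta :: "nat \<Rightarrow> nat list \<Rightarrow> nat \<times> (nat \<times> move) list"

definition wf_tm :: "tm \<Rightarrow> bool" where
  "wf_tm M \<longleftrightarrow> 1 \<le> tapes M \<and> 3 \<le> symbols M \<and>
     (\<forall>q rs q' as. q < states M \<and> length rs = tapes M \<and> (\<forall>r\<in>set rs. r < symbols M) \<and>
        delta M q rs = (q', as) \<longrightarrow>
        q' \<le> states M \<and> length as = tapes M \<and> (\<forall>(r, mv)\<in>set as. r < symbols M))"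

text \<open>A tape is its contents together with the head position.\<close>

type_synonym tape = "(int \<Rightarrow> nat) \<times> int"
type_synonym config = "nat \<times> tape list"

definition read :: "tape \<Rightarrow> nat" where
  "read t = fst t (snd t)"

fun shift :: "move \<Rightarrow> int" where
  "shift MoveLeft = - 1"
| "shift Stay = 0"
| "shift MoveRight = 1"

fun act :: "nat \<times> move \<Rightarrow> tape \<Rightarrow> tape" where
  "act (r, mv) (f, p) = (f(p := r), p + shift mv)"

fun step :: "tm \<Rightarrow> config \<Rightarrow> config" where
  "step M (q, ts) =
     (if q < states M then
        (let (q', as) = delta M q (map read ts) in (q', map2 act as ts))
      else (q, ts))"

fun bit_symbol :: "bool \<Rightarrow> nat" where
  "bit_symbol False = 1"
| "bit_symbol True = 2"

definition input_tape :: "bool list \<Rightarrow> tape" where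
  "input_tape x =
     (\<lambda>i. if 0 \<le> i \<and> i < int (length x) then bit_symbol (x ! nat i) else 0, 0)"

definition initial :: "tm \<Rightarrow> bool list \<Rightarrow> config" where
  "initial M x = (0, input_tape x # replicate (tapes M - 1) (input_tape []))"

text \<open>
  The output is written on the last tape, from cell 0 up to the first blank; the head
  positions and the remaining cells are irrelevant. A one-tape machine reads its input from
  and writes its output to the same tape.
\<close>

definition tape_holds :: "tape \<Rightarrow> bool list \<Rightarrow> bool" where
  "tape_holds t y \<longleftrightarrow>
     (\<forall>i<length y. fst t (int i) = bit_symbol (y ! i)) \<and> fst t (int (length y)) = 0"

definition computes_within :: "tm \<Rightarrow> bool list \<Rightarrow> bool list \<Rightarrow> nat \<Rightarrow> bool" where
  "computes_within M x y T \<longleftrightarrow>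
     (\<exists>t\<le>T. \<exists>ts. (step M ^^ t) (initial M x) = (states M, ts) \<and> tape_holds (last ts) y)"


section \<open>Polynomial time, NP and NP-completeness\<close>

definition poly_time :: "(bool list \<Rightarrow> bool list) \<Rightarrow> bool" where
  "poly_time f \<longleftrightarrow>
     (\<exists>M (p :: nat poly). wf_tm M \<and> (\<forall>x. computes_within M x (f x) (poly p (length x))))"

type_synonym language = "bool list set"

definition class_P :: "language set" where
  "class_P = {L. poly_time (\<lambda>x. [x \<in> L])}"

text \<open>Pairing: every bit of \<open>x\<close> is preceded by a 1, and a 0 announces the second component.\<close>

definition pair_code :: "bool list \<Rightarrow> bool list \<Rightarrow> bool list" where
  "pair_code x u = concat (map (\<lambda>b. [True, b]) x) @ [False] @ u"

definition class_NP :: "language set" where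
  "class_NP =
     {L. \<exists>B\<in>class_P. \<exists>p :: nat poly.
           \<forall>x. x \<in> L \<longleftrightarrow> (\<exists>u. length u \<le> poly p (length x) \<and> pair_code x u \<in> B)}"

definition poly_reducible :: "language \<Rightarrow> language \<Rightarrow> bool" where
  "poly_reducible A B \<longleftrightarrow> (\<exists>f. poly_time f \<and> (\<forall>x. x \<in> A \<longleftrightarrow> f x \<in> B))"

definition NP_hard :: "language \<Rightarrow> bool" where
  "NP_hard L \<longleftrightarrow> (\<forall>A\<in>class_NP. poly_reducible A L)"

definition NP_complete :: "language \<Rightarrow> bool" where
  "NP_complete L \<longleftrightarrow> L \<in> class_NP \<and> NP_hard L"


section \<open>Distance matchings\<close>

text \<open>
  The node classes are \<open>S = {0..<nS}\<close>, in the order of the numbers, and \<open>T = {0..<nT}\<close>;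
  an edge is a pair whose first component is the node in \<open>S\<close> and whose second component is
  the node in \<open>T\<close>. The two node classes are thus kept apart by position.
\<close>

record dm_instance =
  nS :: nat
  nT :: nat
  edges :: "(nat \<times> nat) set"
  min_dist :: nat

definition valid_instance :: "dm_instance \<Rightarrow> bool" where
  "valid_instance I \<longleftrightarrow> edges I \<subseteq> {0..<nS I} \<times> {0..<nT I} \<and> 0 < min_dist I"

definition distance_matching :: "dm_instance \<Rightarrow> (nat \<times> nat) set \<Rightarrow> bool" where
  "distance_matching I M \<longleftrightarrow>
     M \<subseteq> edges I \<and>
     (\<forall>i t t'. (i, t) \<in> M \<and> (i, t') \<in> M \<longrightarrow> t = t') \<and>
     (\<forall>i j t. (i, t) \<in> M \<and> (j, t) \<in> M \<and> i \<noteq> j \<longrightarrow> \<bar>int j - int i\<bar> \<ge> int (min_dist I))"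

definition perfect_distance_matching :: "dm_instance \<Rightarrow> (nat \<times> nat) set \<Rightarrow> bool" where
  "perfect_distance_matching I M \<longleftrightarrow>
     distance_matching I M \<and> (\<forall>i\<in>{0..<nS I}. \<exists>!t. (i, t) \<in> M)"

definition degree_S :: "dm_instance \<Rightarrow> nat \<Rightarrow> nat" where
  "degree_S I i = card {t. (i, t) \<in> edges I}"

definition degree_T :: "dm_instance \<Rightarrow> nat \<Rightarrow> nat" where
  "degree_T I t = card {i. (i, t) \<in> edges I}"

text \<open>The maximum degree of the graph without nodes is 0.\<close>

definition max_degree :: "dm_instance \<Rightarrow> nat" where
  "max_degree I = Max ({0} \<union> degree_S I ` {0..<nS I} \<union> degree_T I ` {0..<nT I})"

text \<open>Binary representation, least significant bit first.\<close>

fun binary :: "nat \<Rightarrow> bool list" where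
  "binary n = (if n = 0 then [] else odd n # binary (n div 2))"

declare binary.simps [simp del]

text \<open>
  An instance is given by the two numbers of nodes in unary, the adjacency matrix row by row,
  and the distance in binary.
\<close>

definition encode :: "dm_instance \<Rightarrow> bool list" where
  "encode I =
     replicate (nS I) True @ [False] @ replicate (nT I) True @ [False] @
     map (\<lambda>e. e \<in> edges I) (List.product [0..<nS I] [0..<nT I]) @ binary (min_dist I)"

definition PERFECT_DISTANCE_MATCHING :: language where
  "PERFECT_DISTANCE_MATCHING =
     {encode I | I. valid_instance I \<and> (\<exists>M. perfect_distance_matching I M)}"

definition PERFECT_DISTANCE_MATCHING_max_degree :: "nat \<Rightarrow> language" where
  "PERFECT_DISTANCE_MATCHING_max_degree k =
     {encode I | I. valid_instance I \<and> max_degree I \<le> k \<and> (\<exists>M. perfect_distance_matching I M)}"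


section \<open>The encodings are injective\<close>

lemma pair_code_inject: "pair_code x u = pair_code y v \<longleftrightarrow> x = y \<and> u = v"
proof (induction x arbitrary: y)
  case Nil
  then show ?case by (cases y) (auto simp: pair_code_def)
next
  case (Cons b x)
  then show ?case by (cases y) (auto simp: pair_code_def)
qed

lemma binary_0: "binary 0 = []"
  by (subst binary.simps) simp

lemma binary_pos: "n \<noteq> 0 \<Longrightarrow> binary n = odd n # binary (n div 2)"
  by (subst binary.simps) simp

lemma binary_inject: "binary m = binary n \<longleftrightarrow> m = n"
proof (induction m arbitrary: n rule: less_induct)
  case (less m)
  consider "m = 0" "n = 0" | "m = 0" "n \<noteq> 0" | "m \<noteq> 0" "n = 0" | "m \<noteq> 0" "n \<noteq> 0"
    by blast
  then show ?case
  proof cases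
    case 4
    then have "binary m = binary n \<longleftrightarrow> odd m = odd n \<and> m div 2 = n div 2"
      using less.IH[of "m div 2" "n div 2"] by (simp add: binary_pos[of m] binary_pos[of n])
    also have "\<dots> \<longleftrightarrow> m = n"
      by (metis even_two_times_div_two odd_two_times_div_two_succ)
    finally show ?thesis .
  qed (simp_all add: binary_0 binary_pos[of m] binary_pos[of n])
qed

lemma unary_inject:
  "replicate m True @ False # xs = replicate n True @ False # ys \<longleftrightarrow> m = n \<and> xs = ys"
proof (induction m arbitrary: n)
  case 0
  then show ?case by (cases n) auto
next
  case (Suc m)
  then show ?case by (cases n) auto
qed

lemma encode_inject:
  assumes "valid_instance I" "valid_instance J" "encode I = encode J"
  shows "I = J"
proof -
  have n: "nS I = nS J" "nT I = nT J"
    using assms(3) by (simp_all add: encode_def unary_inject)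
  have *: "map (\<lambda>e. e \<in> edges I) (List.product [0..<nS I] [0..<nT I]) =
           map (\<lambda>e. e \<in> edges J) (List.product [0..<nS I] [0..<nT I])"
    and d: "min_dist I = min_dist J"
    using assms(3) n by (simp_all add: encode_def unary_inject binary_inject)
  have "\<forall>e\<in>{0..<nS I} \<times> {0..<nT I}. e \<in> edges I \<longleftrightarrow> e \<in> edges J"
    using * by (simp del: mem_Sigma_iff)
  then have "edges I = edges J"
    using assms(1,2) n unfolding valid_instance_def by (metis subset_antisym subsetD subsetI)
  with n d show ?thesis by (intro dm_instance.equality) simp_all
qed

end

(*
  Hardness combines the Cook-Levin argument with a gadget reduction. The computation of the
  verifier is described by clauses with at most four literals; apart from the clauses that guess the
  witness they are Horn clauses, so every satisfying assignment contains the true computation. A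
  distance matching then transports literals along the order of S: block k has one node per
  literal, which either keeps its token or pushes it on to block k + 1. As the distance is the block length plus
  one, pushing propagates through all later blocks, while a clause node, placed at the start of its
  block, conflicts with the literal node of its own block but not with that of the next one. A
  clause node thus needs a literal that is not pushed, and the variable nodes force
  one literal of each variable to be pushed. All degrees are at most four.

  Polynomial-time computability is obtained from a class of arithmetic functions with bounded sums,
  quantifiers and polynomially bounded recursion, computed by counters whose values are head positions.
*)
theory Submission
  imports Defs "HOL-Library.Countable"
begin

section \<open>Structured programs for Turing machines\<close>

text \<open>The clauses nowhere say that a cell holds only one symbol or that the machine is in only
  one state. An assignment may therefore make further atoms true, and a clause demanding the
  accepting symbol could be met by such an atom. For this reason acceptance is expressed by denial:
  cell 0 of the output tape must not hold 1, the symbol of the answer False. A clause node has an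
  edge for each literal, so the degree bound allows four literals; a transition of a machine with
  many tapes fits into such clauses only because the symbols under the heads are collected one tape
  at a time. A token can have four neighbours as well: its literal node, the same literal one block
  earlier, one clause node and one variable node. All counters are unary, so programs can afford
  only numbers that are polynomial in the input length. The distance of an input instance is written
  in binary and may be exponential; the verifier never computes it but only compares it with
  differences of positions.\<close>

datatype com =
    Op nat "nat \<Rightarrow> nat \<times> move"
  | Seq com com
  | Cond nat "nat \<Rightarrow> bool" com com
  | Loop nat "nat \<Rightarrow> bool" com

text \<open>A program is run with a stack of commands that are still to be executed; the finitely many
  stacks that can occur are the states of the Turing machine.\<close>

fun cont_step :: "com list \<Rightarrow> nat list \<Rightarrow> com list" where
  "cont_step [] rs = []"
| "cont_step (Op i g # K) rs = K"
| "cont_step (Seq a b # K) rs = a # b # K"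
| "cont_step (Cond i P a b # K) rs = (if P (rs ! i) then a else b) # K"
| "cont_step (Loop i P a # K) rs = (if P (rs ! i) then a # Loop i P a # K else K)"

fun cont_acts :: "com list \<Rightarrow> nat list \<Rightarrow> (nat \<times> move) list" where
  "cont_acts (Op i g # K) rs = (map (\<lambda>a. (a, Stay)) rs)[i := g (rs ! i)]"
| "cont_acts K rs = map (\<lambda>a. (a, Stay)) rs"

fun com_step :: "com list \<times> tape list \<Rightarrow> com list \<times> tape list" where
  "com_step (K, ts) = (cont_step K (map read ts), map2 act (cont_acts K (map read ts)) ts)"

fun ok_com :: "nat \<Rightarrow> com \<Rightarrow> bool" where
  "ok_com n (Op i g) \<longleftrightarrow> i < n \<and> (\<forall>a<3. fst (g a) < 3)"
| "ok_com n (Seq a b) \<longleftrightarrow> ok_com n a \<and> ok_com n b"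
| "ok_com n (Cond i P a b) \<longleftrightarrow> i < n \<and> ok_com n a \<and> ok_com n b"
| "ok_com n (Loop i P a) \<longleftrightarrow> i < n \<and> ok_com n a"

lemma ok_com_mono: "ok_com m c \<Longrightarrow> m \<le> n \<Longrightarrow> ok_com n c"
  by (induction c) auto

text \<open>The stacks that may occur while \<open>c\<close> is executed on top of \<open>K\<close>.
  The rest \<open>K\<close> itself is left out, so that the sets of the subcommands can be glued
  together.\<close>

fun conts :: "com \<Rightarrow> com list \<Rightarrow> com list set" where
  "conts (Op i g) K = {Op i g # K}"
| "conts (Seq a b) K = insert (Seq a b # K) (conts a (b # K) \<union> conts b K)"
| "conts (Cond i P a b) K = insert (Cond i P a b # K) (conts a K \<union> conts b K)"
| "conts (Loop i P a) K = insert (Loop i P a # K) (conts a (Loop i P a # K))"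

lemma finite_conts: "finite (conts c K)"
  by (induction c arbitrary: K) auto

lemma conts_start: "c # K \<in> conts c K"
  by (cases c) auto

lemma conts_step: "X \<in> conts c K \<Longrightarrow> cont_step X rs \<in> insert K (conts c K)"
proof (induction c arbitrary: K)
  case (Seq a b)
  then show ?case using conts_start[of a "b # K"] conts_start[of b K] by fastforce
next
  case (Cond i P a b)
  then show ?case using conts_start[of a K] conts_start[of b K] by (cases "P (rs ! i)") auto
next
  case (Loop i P a)
  then show ?case using conts_start[of a "Loop i P a # K"] by fastforce
qed auto

lemma conts_ok: "X \<in> conts c K \<Longrightarrow> ok_com n c \<Longrightarrow> X \<noteq> [] \<and> ok_com n (hd X)"
  by (induction c arbitrary: K) auto

lemma act_Stay: "act (read t, Stay) t = t"
  by (cases t) (simp add: read_def)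

lemma map2_act_Stay: "map2 act (map (\<lambda>a. (a, Stay)) (map read ts)) ts = ts"
  by (induction ts) (auto simp: act_Stay)

lemma com_step_Op: "i < length ts \<Longrightarrow>
    com_step (Op i g # K, ts) = (K, ts[i := act (g (read (ts ! i))) (ts ! i)])"
  by (auto intro!: nth_equalityI simp: nth_list_update act_Stay)

lemma com_step_Seq: "com_step (Seq a b # K, ts) = (a # b # K, ts)"
  using map2_act_Stay[of ts] by simp

lemma com_step_Cond: "i < length ts \<Longrightarrow>
    com_step (Cond i P a b # K, ts) = ((if P (read (ts ! i)) then a else b) # K, ts)"
  using map2_act_Stay[of ts] by simp

lemma com_step_Loop: "i < length ts \<Longrightarrow>
    com_step (Loop i P a # K, ts) =
      (if P (read (ts ! i)) then a # Loop i P a # K else K, ts)"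
  using map2_act_Stay[of ts] by simp

text \<open>The number of steps is chosen before \<open>K\<close>: the run is the same under every
  rest of the program, so runs can be composed without looking at the context.\<close>

definition runs :: "com \<Rightarrow> tape list \<Rightarrow> nat \<Rightarrow> tape list \<Rightarrow> bool" where
  "runs c ts n ts' \<longleftrightarrow> (\<exists>t\<le>n. \<forall>K. (com_step ^^ t) (c # K, ts) = (K, ts'))"

lemma runs_mono: "runs c ts m ts' \<Longrightarrow> m \<le> n \<Longrightarrow> runs c ts n ts'"
  unfolding runs_def using le_trans by blast

lemma funpow_add_apply: "(f ^^ m) x = y \<Longrightarrow> (f ^^ n) y = z \<Longrightarrow> (f ^^ (n + m)) x = z"
  by (simp add: funpow_add)

lemma runs_Op: "i < length ts \<Longrightarrow> ts' = ts[i := act (g (read (ts ! i))) (ts ! i)] \<Longrightarrow>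
    runs (Op i g) ts 1 ts'"
  unfolding runs_def by (rule exI[of _ 1]) (simp add: com_step_Op del: com_step.simps)

lemma runs_Seq:
  assumes "runs a ts m ts'" "runs b ts' n ts''"
  shows "runs (Seq a b) ts (Suc (m + n)) ts''"
proof -
  obtain s t where st: "s \<le> m" "t \<le> n" "\<And>K. (com_step ^^ s) (a # K, ts) = (K, ts')"
    "\<And>K. (com_step ^^ t) (b # K, ts') = (K, ts'')"
    using assms unfolding runs_def by blast
  have "(com_step ^^ (t + s)) (a # b # K, ts) = (K, ts'')" for K
    using st by (intro funpow_add_apply)
  then have "(com_step ^^ Suc (t + s)) (Seq a b # K, ts) = (K, ts'')" for K
    by (simp add: funpow_Suc_right com_step_Seq del: com_step.simps funpow.simps)
  then show ?thesis
    unfolding runs_def using st(1,2) by (intro exI[of _ "Suc (t + s)"]) auto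
qed

lemma runs_Cond:
  assumes "i < length ts" "runs (if P (read (ts ! i)) then a else b) ts n ts'"
  shows "runs (Cond i P a b) ts (Suc n) ts'"
proof -
  obtain t where t: "t \<le> n"
    "\<And>K. (com_step ^^ t) ((if P (read (ts ! i)) then a else b) # K, ts) = (K, ts')"
    using assms unfolding runs_def by blast
  have "(com_step ^^ Suc t) (Cond i P a b # K, ts) = (K, ts')" for K
    using t(2)[of K] assms(1)
    by (simp add: funpow_Suc_right com_step_Cond del: com_step.simps funpow.simps)
  then show ?thesis
    unfolding runs_def using t(1) by (intro exI[of _ "Suc t"]) auto
qed

lemma runs_Loop_exit:
  assumes "i < length ts" "\<not> P (read (ts ! i))"
  shows "runs (Loop i P a) ts 1 ts"
  unfolding runs_def using assms
  by (intro exI[of _ 1]) (simp add: com_step_Loop del: com_step.simps)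

lemma runs_Loop_iter:
  assumes "i < length ts" "P (read (ts ! i))" "runs a ts m ts'" "runs (Loop i P a) ts' n ts''"
  shows "runs (Loop i P a) ts (Suc (m + n)) ts''"
proof -
  obtain s t where st: "s \<le> m" "t \<le> n" "\<And>K. (com_step ^^ s) (a # K, ts) = (K, ts')"
    "\<And>K. (com_step ^^ t) (Loop i P a # K, ts') = (K, ts'')"
    using assms unfolding runs_def by blast
  have "(com_step ^^ (t + s)) (a # Loop i P a # K, ts) = (K, ts'')" for K
    using st by (intro funpow_add_apply)
  then have "(com_step ^^ Suc (t + s)) (Loop i P a # K, ts) = (K, ts'')" for K
    using assms by (simp add: funpow_Suc_right com_step_Loop del: com_step.simps funpow.simps)
  then show ?thesis
    unfolding runs_def using st(1,2) by (intro exI[of _ "Suc (t + s)"]) auto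
qed

text \<open>The caller supplies the whole trace \<open>S\<close> of the loop. Each pass costs at
  most \<open>m\<close> steps and one test, and the final test adds 1.\<close>

lemma runs_Loop:
  assumes "\<And>j. j \<le> n \<Longrightarrow> i < length (S j)"
    and "\<And>j. j < n \<Longrightarrow> P (read (S j ! i))"
    and "\<not> P (read (S n ! i))"
    and "\<And>j. j < n \<Longrightarrow> runs a (S j) m (S (Suc j))"
  shows "runs (Loop i P a) (S 0) (n * Suc m + 1) (S n)"
  using assms
proof (induction n arbitrary: S)
  case 0
  then show ?case using runs_Loop_exit by simp
next
  case (Suc n)
  have "runs (Loop i P a) (S (Suc 0)) (n * Suc m + 1) (S (Suc n))"
    using Suc.IH[of "\<lambda>j. S (Suc j)"] Suc.prems by simp
  from runs_Loop_iter[OF _ _ _ this, of "S 0" m] show ?case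
    using Suc.prems by (simp add: algebra_simps)
qed

section \<open>Compiling programs into Turing machines\<close>

definition prog_tm :: "nat \<Rightarrow> com list list \<Rightarrow> tm" where
  "prog_tm n Xs = \<lparr>tapes = n, symbols = 3, states = length Xs - 1,
     delta = (\<lambda>q rs. ((SOME j. j < length Xs \<and> Xs ! j = cont_step (Xs ! q) rs),
                       cont_acts (Xs ! q) rs))\<rparr>"

lemma cont_acts_ok:
  assumes "K \<noteq> []" "ok_com n (hd K)" "length rs = n" "\<forall>r\<in>set rs. r < 3"
  shows "length (cont_acts K rs) = n \<and> (\<forall>(r, mv)\<in>set (cont_acts K rs). r < 3)"
proof (cases "\<exists>i g L. K = Op i g # L")
  case True
  then obtain i g L where K: "K = Op i g # L" by blast
  have "fst y < 3" if "y \<in> set ((map (\<lambda>a. (a, Stay)) rs)[i := g (rs ! i)])" for y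
  proof -
    have "y \<in> insert (g (rs ! i)) ((\<lambda>a. (a, Stay)) ` set rs)"
      using subsetD[OF set_update_subset_insert that] by simp
    moreover have "fst (g (rs ! i)) < 3" using K assms by auto
    ultimately show ?thesis using assms(4) by auto
  qed
  then show ?thesis using K assms(3) by (simp add: case_prod_beta)
next
  case False
  then show ?thesis using assms by (cases "(K, rs)" rule: cont_acts.cases) auto
qed

text \<open>The machine starts in state 0 and halts in state \<open>states M\<close>, hence the
  enumeration has to begin with the stack \<open>[c]\<close> and to end with the empty one. Without
  repetitions, a stack determines its state.\<close>

lemma conts_enumeration:
  "\<exists>Xs. set Xs = insert [] (conts c []) \<and> distinct Xs \<and> 2 \<le> length Xs \<and> Xs ! 0 = [c] \<and> last Xs = []"
proof -
  obtain ys where ys: "set ys = conts c [] - {[c], []}" "distinct ys"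
    using finite_distinct_list[OF finite_Diff[OF finite_conts]] by metis
  show ?thesis
    using ys conts_start[of c "[]"] by (intro exI[of _ "[c] # ys @ [[]]"]) auto
qed

lemma poly_time_com:
  assumes ok: "ok_com n c" and n: "1 \<le> n"
    and run: "\<And>x. \<exists>ts. runs c (input_tape x # replicate (n - 1) (input_tape [])) (poly p (length x)) ts
               \<and> tape_holds (last ts) (f x)"
  shows "poly_time f"
proof -
  obtain Xs where Xs: "set Xs = insert [] (conts c [])" "distinct Xs" "2 \<le> length Xs"
    "Xs ! 0 = [c]" "last Xs = []"
    using conts_enumeration by blast
  define M where "M = prog_tm n Xs"
  have some: "(SOME i. i < length Xs \<and> Xs ! i = Xs ! j) = j" if "j < length Xs" for j
    using that Xs(2) by (intro some_equality) (auto simp: nth_eq_iff_index_eq)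
  have ex: "\<exists>j<length Xs. Xs ! j = K" if "K \<in> set Xs" for K
    using that by (auto simp: in_set_conv_nth)
  have closed: "cont_step K rs \<in> set Xs" if "K \<in> set Xs" for K rs
  proof (cases "K = []")
    case False
    then have "K \<in> conts c []" using that Xs(1) by blast
    from conts_step[OF this, of rs] show ?thesis using Xs(1) by blast
  qed (simp add: Xs(1))
  have last: "Xs ! (length Xs - 1) = []" using Xs(3,5) by (subst (asm) last_conv_nth) auto
  have ne: "Xs ! j \<noteq> []" if "j < length Xs - 1" for j
    using that Xs(2,3) last nth_eq_iff_index_eq[of Xs j "length Xs - 1"] by auto
  have ok': "Xs ! j \<noteq> [] \<and> ok_com n (hd (Xs ! j))" if "j < length Xs - 1" for j
  proof -
    have "Xs ! j \<in> set Xs" using that by (intro nth_mem) simp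
    then show ?thesis using ne[OF that] conts_ok[OF _ ok] Xs(1) by blast
  qed
  have wf: "wf_tm M"
    unfolding wf_tm_def
  proof (intro conjI allI impI)
    fix q rs q' as
    assume A: "q < states M \<and> length rs = tapes M \<and> (\<forall>r\<in>set rs. r < symbols M) \<and> delta M q rs = (q', as)"
    then have q: "q < length Xs - 1" by (simp add: M_def prog_tm_def)
    obtain j where j: "j < length Xs" "Xs ! j = cont_step (Xs ! q) rs"
      using ex[OF closed[OF nth_mem[of q Xs]]] q by force
    have "q' = j" using A some[OF j(1)] j by (auto simp: M_def prog_tm_def)
    then show "q' \<le> states M" using j by (auto simp: M_def prog_tm_def)
    have "length as = n \<and> (\<forall>(r, mv)\<in>set as. r < 3)"
      using A cont_acts_ok[of "Xs ! q" n rs] ok'[OF q] by (auto simp: M_def prog_tm_def)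
    then show "length as = tapes M" "\<forall>(r, mv)\<in>set as. r < symbols M"
      by (auto simp: M_def prog_tm_def)
  qed (use n in \<open>auto simp: M_def prog_tm_def\<close>)
  \<comment> \<open>Machine and program run in lockstep. At the last index both idle, the machine
    because it has halted and the program because its stack is empty.\<close>
  have sim1: "\<exists>j'<length Xs. com_step (Xs ! j, ts) = (Xs ! j', snd (step M (j, ts))) \<and> fst (step M (j, ts)) = j'"
    if j: "j < length Xs" for j ts
  proof (cases "j < length Xs - 1")
    case True
    obtain j' where j': "j' < length Xs" "Xs ! j' = cont_step (Xs ! j) (map read ts)"
      using ex[OF closed[OF nth_mem[OF j]]] by blast
    show ?thesis
      using True some[OF j'(1)] j' by (intro exI[of _ j']) (auto simp: M_def prog_tm_def)
  next
    case False
    then have "j = length Xs - 1" using j by simp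
    then show ?thesis
      using j last map2_act_Stay[of ts] by (intro exI[of _ j]) (auto simp: M_def prog_tm_def)
  qed
  have sim: "\<exists>j<length Xs. (com_step ^^ t) ([c], ts) = (Xs ! j, snd ((step M ^^ t) (0, ts)))
      \<and> fst ((step M ^^ t) (0, ts)) = j" for t ts
  proof (induction t)
    case 0
    then show ?case using Xs(3,4) by (intro exI[of _ 0]) auto
  next
    case (Suc t)
    define C where "C = (step M ^^ t) (0, ts)"
    obtain j where j: "j < length Xs" "(com_step ^^ t) ([c], ts) = (Xs ! j, snd C)" "fst C = j"
      using Suc unfolding C_def by blast
    then obtain us where C: "C = (j, us)" by (metis prod.collapse)
    obtain j' where "j' < length Xs" "com_step (Xs ! j, us) = (Xs ! j', snd (step M (j, us)))"
      "fst (step M (j, us)) = j'"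
      using sim1[OF j(1), of us] by blast
    then show ?case
      using j(2) C by (auto simp flip: C_def simp del: com_step.simps step.simps)
  qed
  have "computes_within M x (f x) (poly p (length x))" for x
  proof -
    let ?i = "input_tape x # replicate (n - 1) (input_tape [])"
    obtain ts t where t: "t \<le> poly p (length x)" "(com_step ^^ t) ([c], ?i) = ([], ts)"
      "tape_holds (last ts) (f x)"
      using run[of x] unfolding runs_def by blast
    obtain j where j: "j < length Xs" "Xs ! j = []" "ts = snd ((step M ^^ t) (0, ?i))"
      "fst ((step M ^^ t) (0, ?i)) = j"
      using sim[of t ?i] t(2) by auto
    have "j = length Xs - 1" using ne[of j] j(1,2) by fastforce
    then have "fst ((step M ^^ t) (0, ?i)) = states M" using j(4) by (simp add: M_def prog_tm_def)
    moreover have "initial M x = (0, ?i)" by (simp add: initial_def M_def prog_tm_def)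
    ultimately have "(step M ^^ t) (initial M x) = (states M, ts)"
      using j(3) by (metis prod.collapse)
    then show ?thesis
      unfolding computes_within_def using t by blast
  qed
  with wf show ?thesis unfolding poly_time_def by blast
qed

section \<open>Counters on tapes\<close>

lemma poly_nat_mono: "a \<le> b \<Longrightarrow> poly (p :: nat poly) a \<le> poly p b"
  by (induction p) (auto intro!: add_mono mult_mono)

text \<open>Besides the input tape and the output tape there are \<open>k\<close> counters: the value of a counter
  is the head position on a tape whose only nonblank cell is cell 0.\<close>

definition mark :: "int \<Rightarrow> nat" where
  "mark i = (if i = 0 then 1 else 0)"

definition sym :: "bool list \<Rightarrow> nat \<Rightarrow> nat" where
  "sym x i = (if i < length x then bit_symbol (x ! i) else 0)"

definition conf :: "nat \<Rightarrow> bool list \<Rightarrow> nat \<Rightarrow> (nat \<Rightarrow> nat) \<Rightarrow> bool list \<Rightarrow> tape list" where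
  "conf k x h \<sigma> out = (fst (input_tape x), int h) # map (\<lambda>i. (mark, int (\<sigma> i))) [0..<k] @
     [(fst (input_tape out), int (length out))]"

lemma length_conf [simp]: "length (conf k x h \<sigma> out) = k + 2"
  by (simp add: conf_def)

lemma conf_input [simp]: "conf k x h \<sigma> out ! 0 = (fst (input_tape x), int h)"
  by (simp add: conf_def)

lemma conf_reg [simp]: "i < k \<Longrightarrow> conf k x h \<sigma> out ! Suc i = (mark, int (\<sigma> i))"
  by (simp add: conf_def nth_append)

lemma conf_output [simp]: "conf k x h \<sigma> out ! Suc k = (fst (input_tape out), int (length out))"
  by (simp add: conf_def nth_append)

lemma read_input: "read (fst (input_tape x), int h) = sym x h"
  by (simp add: read_def input_tape_def sym_def)

lemma read_reg: "read (mark, int v) = (if v = 0 then 1 else 0)"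
  by (simp add: read_def mark_def)

lemma read_mark_0 [simp]: "read (mark, 0) = 1"
  by (simp add: read_def mark_def)

lemma conf_update_reg: "i < k \<Longrightarrow>
    (conf k x h \<sigma> out)[Suc i := (mark, int v)] = conf k x h (\<sigma>(i := v)) out"
  by (auto simp: conf_def list_update_append intro!: nth_equalityI simp: nth_list_update)

lemma conf_update_input: "(conf k x h \<sigma> out)[0 := (fst (input_tape x), int h')] = conf k x h' \<sigma> out"
  by (simp add: conf_def)

lemma input_tape_snoc: "(fst (input_tape out))(int (length out) := bit_symbol b) = fst (input_tape (out @ [b]))"
  by (rule ext) (auto simp: input_tape_def nth_append nat_less_iff nat_eq_iff)

lemma conf_update_output: "(conf k x h \<sigma> out)[Suc k := (fst (input_tape (out @ [b])), int (Suc (length out)))] =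
    conf k x h \<sigma> (out @ [b])"
  by (simp add: conf_def list_update_append)

section \<open>Basic commands on counters\<close>

definition "inc i = Op (Suc i) (\<lambda>a. (a, MoveRight))"
definition "dec i = Op (Suc i) (\<lambda>a. (a, MoveLeft))"
definition "inR = Op 0 (\<lambda>a. (a, MoveRight))"
definition "inL = Op 0 (\<lambda>a. (a, MoveLeft))"
definition "skip = Op 0 (\<lambda>a. (a, Stay))"
definition "emit k b = Op (Suc k) (\<lambda>_. (bit_symbol b, MoveRight))"
definition "while_nz i c = Loop (Suc i) (\<lambda>a. a = 0) c"
definition "if_nz i a b = Cond (Suc i) (\<lambda>a. a = 0) a b"

lemma ok_basic [simp]:
  "ok_com n (inc i) \<longleftrightarrow> Suc i < n" "ok_com n (dec i) \<longleftrightarrow> Suc i < n"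
  "ok_com n inR \<longleftrightarrow> 0 < n" "ok_com n inL \<longleftrightarrow> 0 < n" "ok_com n skip \<longleftrightarrow> 0 < n"
  "ok_com n (emit k b) \<longleftrightarrow> Suc k < n"
  "ok_com n (while_nz i c) \<longleftrightarrow> Suc i < n \<and> ok_com n c"
  "ok_com n (if_nz i c d) \<longleftrightarrow> Suc i < n \<and> ok_com n c \<and> ok_com n d"
  by (cases b; auto simp: inc_def dec_def inR_def inL_def skip_def emit_def while_nz_def if_nz_def)+

lemma runs_inc: "i < k \<Longrightarrow> \<sigma>' = \<sigma>(i := Suc (\<sigma> i)) \<Longrightarrow>
    runs (inc i) (conf k x h \<sigma> out) 1 (conf k x h \<sigma>' out)"
  unfolding inc_def using conf_update_reg[of i k x h \<sigma> out "Suc (\<sigma> i)"]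
  by (intro runs_Op) (auto simp: read_def add.commute)

lemma runs_dec: "i < k \<Longrightarrow> \<sigma> i \<noteq> 0 \<Longrightarrow> \<sigma>' = \<sigma>(i := \<sigma> i - 1) \<Longrightarrow>
    runs (dec i) (conf k x h \<sigma> out) 1 (conf k x h \<sigma>' out)"
  unfolding dec_def using conf_update_reg[of i k x h \<sigma> out "\<sigma> i - 1"]
  by (intro runs_Op) (auto simp: read_def of_nat_diff)

lemma runs_inR: "runs inR (conf k x h \<sigma> out) 1 (conf k x (Suc h) \<sigma> out)"
  unfolding inR_def using conf_update_input[of k x h \<sigma> out "Suc h"]
  by (intro runs_Op) (auto simp: read_def add.commute)

lemma runs_inL: "h \<noteq> 0 \<Longrightarrow> runs inL (conf k x h \<sigma> out) 1 (conf k x (h - 1) \<sigma> out)"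
  unfolding inL_def using conf_update_input[of k x h \<sigma> out "h - 1"]
  by (intro runs_Op) (auto simp: read_def of_nat_diff)

lemma runs_skip: "runs skip (conf k x h \<sigma> out) 1 (conf k x h \<sigma> out)"
  unfolding skip_def using conf_update_input[of k x h \<sigma> out h]
  by (intro runs_Op) (auto simp: read_def)

lemma runs_emit: "runs (emit k b) (conf k x h \<sigma> out) 1 (conf k x h \<sigma> (out @ [b]))"
  unfolding emit_def using conf_update_output[of k x h \<sigma> out b]
  by (intro runs_Op) (auto simp: add.commute input_tape_snoc)

lemma runs_while_nz:
  assumes "i < k" "\<And>j. j < n \<Longrightarrow> S j i \<noteq> 0" "S n i = 0"
    and "\<And>j. j < n \<Longrightarrow>
      runs c (conf k x (H j) (S j) (Out j)) m (conf k x (H (Suc j)) (S (Suc j)) (Out (Suc j)))"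
  shows "runs (while_nz i c) (conf k x (H 0) (S 0) (Out 0)) (n * Suc m + 1) (conf k x (H n) (S n) (Out n))"
  unfolding while_nz_def using assms
  by (intro runs_Loop[where S = "\<lambda>j. conf k x (H j) (S j) (Out j)"]) (auto simp: read_reg)

lemma runs_if_nz:
  assumes "i < k" "runs (if \<sigma> i \<noteq> 0 then a else b) (conf k x h \<sigma> out) n ts"
  shows "runs (if_nz i a b) (conf k x h \<sigma> out) (Suc n) ts"
  unfolding if_nz_def using assms by (intro runs_Cond) (auto simp: read_reg split: if_splits)

definition "clear i = while_nz i (dec i)"
definition "move i j = while_nz i (Seq (dec i) (inc j))"
text \<open>Counting \<open>i\<close> down destroys it; the auxiliary counter \<open>t\<close>,
  initially 0, records the value and restores it.\<close>

definition "copy i j t = Seq (while_nz i (Seq (dec i) (Seq (inc j) (inc t)))) (move t i)"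

lemma ok_clear [simp]:
  "ok_com n (clear i) \<longleftrightarrow> Suc i < n" "ok_com n (move i j) \<longleftrightarrow> Suc i < n \<and> Suc j < n"
  "ok_com n (copy i j t) \<longleftrightarrow> Suc i < n \<and> Suc j < n \<and> Suc t < n"
  by (auto simp: clear_def move_def copy_def)

lemma runs_clear:
  assumes "i < k" "\<sigma>' = \<sigma>(i := 0)" "\<sigma> i \<le> B"
  shows "runs (clear i) (conf k x h \<sigma> out) (2 * B + 1) (conf k x h \<sigma>' out)"
proof -
  have "runs (clear i) (conf k x h (\<sigma>(i := \<sigma> i - 0)) out) (\<sigma> i * Suc 1 + 1) (conf k x h (\<sigma>(i := \<sigma> i - \<sigma> i)) out)"
    unfolding clear_def using assms
    by (intro runs_while_nz[where S = "\<lambda>j. \<sigma>(i := \<sigma> i - j)" and H = "\<lambda>_. h" and Out = "\<lambda>_. out"] runs_dec) auto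
  then show ?thesis using assms by (auto intro: runs_mono)
qed

lemma runs_move:
  assumes "i < k" "j < k" "i \<noteq> j" "\<sigma>' = \<sigma>(i := 0, j := \<sigma> j + \<sigma> i)" "\<sigma> i \<le> B"
  shows "runs (move i j) (conf k x h \<sigma> out) (4 * B + 1) (conf k x h \<sigma>' out)"
proof -
  have "runs (move i j) (conf k x h (\<sigma>(i := \<sigma> i - 0, j := \<sigma> j + 0)) out) (\<sigma> i * Suc (Suc (1 + 1)) + 1)
     (conf k x h (\<sigma>(i := \<sigma> i - \<sigma> i, j := \<sigma> j + \<sigma> i)) out)"
    unfolding move_def using assms
    by (intro runs_while_nz[where S = "\<lambda>l. \<sigma>(i := \<sigma> i - l, j := \<sigma> j + l)" and H = "\<lambda>_. h" and Out = "\<lambda>_. out"]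
          runs_Seq[OF runs_dec[OF _ _ refl] runs_inc]) (auto simp: fun_upd_twist)
  then show ?thesis using assms by (auto intro: runs_mono)
qed

lemma runs_copy:
  assumes "i < k" "j < k" "t < k" "i \<noteq> j" "i \<noteq> t" "t \<noteq> j" "\<sigma>' = \<sigma>(j := \<sigma> j + \<sigma> i)" "\<sigma> i \<le> B" "\<sigma> t = 0"
  shows "runs (copy i j t) (conf k x h \<sigma> out) (10 * B + 3) (conf k x h \<sigma>' out)"
proof -
  define \<tau> where "\<tau> l = \<sigma>(i := \<sigma> i - l, j := \<sigma> j + l, t := l)" for l
  have 1: "runs (while_nz i (Seq (dec i) (Seq (inc j) (inc t)))) (conf k x h (\<tau> 0) out)
     (\<sigma> i * Suc (Suc (1 + Suc (1 + 1))) + 1) (conf k x h (\<tau> (\<sigma> i)) out)"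
    using assms unfolding \<tau>_def
    by (intro runs_while_nz[where S = "\<lambda>l. \<sigma>(i := \<sigma> i - l, j := \<sigma> j + l, t := l)" and H = "\<lambda>_. h" and Out = "\<lambda>_. out"]
          runs_Seq[OF runs_dec[OF _ _ refl] runs_Seq[OF runs_inc[OF _ refl] runs_inc]]) (auto intro!: ext)
  have 2: "runs (move t i) (conf k x h (\<tau> (\<sigma> i)) out) (4 * \<sigma> i + 1) (conf k x h \<sigma>' out)"
    using assms unfolding \<tau>_def by (intro runs_move) (auto intro!: ext)
  have 3: "\<tau> 0 = \<sigma>" using assms by (auto simp: \<tau>_def)
  show ?thesis unfolding copy_def
    using runs_Seq[OF 1 2] assms unfolding 3 by (auto intro: runs_mono)
qed

section \<open>Functions computed by programs in polynomial time\<close>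

text \<open>A function \<open>f x e\<close> depends on the input \<open>x\<close> and on an environment \<open>e\<close> of bound
  variables in de Bruijn numbering. A program finds the variable \<open>j\<close> in register \<open>\<rho> j\<close>, puts the result into
  register \<open>s\<close> and uses the registers from \<open>s\<close> on as work space.\<close>

definition computes_reg ::
  "com \<Rightarrow> nat \<Rightarrow> nat poly \<Rightarrow> (nat \<Rightarrow> nat) \<Rightarrow> nat \<Rightarrow> (bool list \<Rightarrow> (nat \<Rightarrow> nat) \<Rightarrow> nat) \<Rightarrow> bool" where
  "computes_reg c R p \<rho> s f \<longleftrightarrow> ok_com (Suc R) c \<and>
     (\<forall>k x \<sigma> out B. R \<le> k \<longrightarrow> (\<forall>i\<ge>s. \<sigma> i = 0) \<longrightarrow> (\<forall>i. \<sigma> i \<le> B) \<longrightarrow> length x \<le> B \<longrightarrow>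
        runs c (conf k x 0 \<sigma> out) (poly p B) (conf k x 0 (\<sigma>(s := f x (\<lambda>j. \<sigma> (\<rho> j)))) out))"

definition pbounded :: "(bool list \<Rightarrow> (nat \<Rightarrow> nat) \<Rightarrow> nat) \<Rightarrow> bool" where
  "pbounded f \<longleftrightarrow> (\<exists>q :: nat poly. \<forall>x e B. length x \<le> B \<longrightarrow> (\<forall>j. e j \<le> B) \<longrightarrow> f x e \<le> poly q B)"

text \<open>The program may depend on the places \<open>\<rho>\<close> of the variables and on the
  first free register \<open>s\<close>, because nesting changes both. Boundedness is part of the
  notion, since later commands are charged by the values that they find in the registers.\<close>

definition pcomp :: "(bool list \<Rightarrow> (nat \<Rightarrow> nat) \<Rightarrow> nat) \<Rightarrow> bool" where
  "pcomp f \<longleftrightarrow> pbounded f \<and>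
     (\<forall>\<rho> s. (\<forall>j. \<rho> j < s) \<longrightarrow> (\<exists>c R p. computes_reg c R p \<rho> s f))"

lemma computes_regI:
  assumes "ok_com (Suc R) c"
    and "\<And>k x \<sigma> out B. R \<le> k \<Longrightarrow> \<forall>i\<ge>s. \<sigma> i = 0 \<Longrightarrow> \<forall>i. \<sigma> i \<le> B \<Longrightarrow> length x \<le> B \<Longrightarrow>
        runs c (conf k x 0 \<sigma> out) (poly p B) (conf k x 0 (\<sigma>(s := f x (\<lambda>j. \<sigma> (\<rho> j)))) out)"
  shows "\<exists>c R p. computes_reg c R p \<rho> s f"
  using assms unfolding computes_reg_def by blast

lemma computes_regD:
  assumes "computes_reg c R p \<rho> s f" "R \<le> k" "\<forall>i\<ge>s. \<sigma> i = 0" "\<forall>i. \<sigma> i \<le> B" "length x \<le> B"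
    "\<sigma>' = \<sigma>(s := f x (\<lambda>j. \<sigma> (\<rho> j)))"
  shows "runs c (conf k x 0 \<sigma> out) (poly p B) (conf k x 0 \<sigma>' out)"
  using assms unfolding computes_reg_def by blast

lemma computes_reg_ok: "computes_reg c R p \<rho> s f \<Longrightarrow> R \<le> R' \<Longrightarrow> ok_com (Suc R') c"
  unfolding computes_reg_def using ok_com_mono by (metis Suc_le_mono)

lemma pcomp_obtain:
  assumes "pcomp f" "\<forall>j. \<rho> j < s"
  obtains c R p where "computes_reg c R p \<rho> s f"
  using assms unfolding pcomp_def by blast

lemma pcomp_bound:
  assumes "pcomp f"
  obtains q :: "nat poly" where "\<And>x e B. length x \<le> B \<Longrightarrow> \<forall>j. e j \<le> B \<Longrightarrow> f x e \<le> poly q B"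
  using assms unfolding pcomp_def pbounded_def by blast

lemma pboundedI: "(\<And>x e B. length x \<le> B \<Longrightarrow> \<forall>j. e j \<le> B \<Longrightarrow> f x e \<le> poly q B) \<Longrightarrow> pbounded f"
  unfolding pbounded_def by blast

lemma pcompI:
  "pbounded f \<Longrightarrow> (\<And>\<rho> s. \<forall>j. \<rho> j < s \<Longrightarrow> \<exists>c R p. computes_reg c R p \<rho> s f) \<Longrightarrow> pcomp f"
  unfolding pcomp_def by blast

section \<open>Basic functions and bounded recursion\<close>

named_theorems pcomp_intros

lemma pcomp_var [pcomp_intros]: "pcomp (\<lambda>x e. e j)"
proof (rule pcompI)
  show "pbounded (\<lambda>x e. e j)" by (rule pboundedI[where q = "[:0, 1:]"]) simp
next
  fix \<rho> :: "nat \<Rightarrow> nat" and s assume \<rho>: "\<forall>j. \<rho> j < s"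
  then have *: "\<rho> j < s" by simp
  show "\<exists>c R p. computes_reg c R p \<rho> s (\<lambda>x e. e j)"
  proof (rule computes_regI[where c = "copy (\<rho> j) s (Suc s)" and R = "s + 2" and p = "[:3, 10:]"])
    fix k out and x :: "bool list" and \<sigma> :: "nat \<Rightarrow> nat" and B :: nat
    assume A: "s + 2 \<le> k" "\<forall>i\<ge>s. \<sigma> i = 0" "\<forall>i. \<sigma> i \<le> B"
    have "runs (copy (\<rho> j) s (Suc s)) (conf k x 0 \<sigma> out) (10 * B + 3) (conf k x 0 (\<sigma>(s := \<sigma> (\<rho> j))) out)"
      using A * by (intro runs_copy) (auto simp: less_imp_neq)
    then show "runs (copy (\<rho> j) s (Suc s)) (conf k x 0 \<sigma> out) (poly [:3, 10:] B) (conf k x 0 (\<sigma>(s := \<sigma> (\<rho> j))) out)"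
      by (simp add: mult.commute add.commute)
  qed (use * in simp)
qed

lemma pcomp_rename:
  assumes "pcomp f"
  shows "pcomp (\<lambda>x e. f x (\<lambda>j. e (\<pi> j)))"
proof (rule pcompI)
  obtain q :: "nat poly" where q: "\<And>x e B. length x \<le> B \<Longrightarrow> \<forall>j. e j \<le> B \<Longrightarrow> f x e \<le> poly q B"
    using pcomp_bound[OF assms] by blast
  show "pbounded (\<lambda>x e. f x (\<lambda>j. e (\<pi> j)))"
    by (rule pboundedI[where q = q]) (simp add: q)
next
  fix \<rho> :: "nat \<Rightarrow> nat" and s assume \<rho>: "\<forall>j. \<rho> j < s"
  then obtain c R p where "computes_reg c R p (\<lambda>j. \<rho> (\<pi> j)) s f"
    using pcomp_obtain[OF assms, of "\<lambda>j. \<rho> (\<pi> j)" s] by blast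
  then have "computes_reg c R p \<rho> s (\<lambda>x e. f x (\<lambda>j. e (\<pi> j)))"
    by (simp add: computes_reg_def)
  then show "\<exists>c R p. computes_reg c R p \<rho> s (\<lambda>x e. f x (\<lambda>j. e (\<pi> j)))" by blast
qed

lemma pcomp_zero: "pcomp (\<lambda>x e. 0)"
proof (rule pcompI)
  show "pbounded (\<lambda>x e. 0)" by (rule pboundedI[where q = 0]) simp
next
  fix \<rho> :: "nat \<Rightarrow> nat" and s assume \<rho>: "\<forall>j. \<rho> j < s"
  show "\<exists>c R p. computes_reg c R p \<rho> s (\<lambda>x e. 0)"
    by (rule computes_regI[where c = skip and R = 0 and p = 1])
      (auto simp: fun_upd_idem intro: runs_mono[OF runs_skip])
qed

lemma pcomp_Suc [pcomp_intros]:
  assumes "pcomp f"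
  shows "pcomp (\<lambda>x e. Suc (f x e))"
proof (rule pcompI)
  obtain q :: "nat poly" where q: "\<And>x e B. length x \<le> B \<Longrightarrow> \<forall>j. e j \<le> B \<Longrightarrow> f x e \<le> poly q B"
    using pcomp_bound[OF assms] by blast
  show "pbounded (\<lambda>x e. Suc (f x e))"
    by (rule pboundedI[where q = "q + 1"]) (simp add: q)
next
  fix \<rho> :: "nat \<Rightarrow> nat" and s assume \<rho>: "\<forall>j. \<rho> j < s"
  obtain c R p where c: "computes_reg c R p \<rho> s f" using pcomp_obtain[OF assms \<rho>] .
  show "\<exists>c R p. computes_reg c R p \<rho> s (\<lambda>x e. Suc (f x e))"
  proof (rule computes_regI[where c = "Seq c (inc s)" and R = "R + s + 2" and p = "p + [:2:]"])
    fix k out and x :: "bool list" and \<sigma> :: "nat \<Rightarrow> nat" and B :: nat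
    assume A: "R + s + 2 \<le> k" "\<forall>i\<ge>s. \<sigma> i = 0" "\<forall>i. \<sigma> i \<le> B" "length x \<le> B"
    show "runs (Seq c (inc s)) (conf k x 0 \<sigma> out) (poly (p + [:2:]) B)
       (conf k x 0 (\<sigma>(s := Suc (f x (\<lambda>j. \<sigma> (\<rho> j))))) out)"
      by (rule runs_mono, rule runs_Seq[OF computes_regD[OF c _ A(2-4) refl] runs_inc]) (use A in auto)
  qed (use computes_reg_ok[OF c] in simp)
qed

lemma pcomp_pred:
  assumes "pcomp f"
  shows "pcomp (\<lambda>x e. f x e - 1)"
proof (rule pcompI)
  obtain q :: "nat poly" where q: "\<And>x e B. length x \<le> B \<Longrightarrow> \<forall>j. e j \<le> B \<Longrightarrow> f x e \<le> poly q B"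
    using pcomp_bound[OF assms] by blast
  show "pbounded (\<lambda>x e. f x e - 1)"
    by (rule pboundedI[where q = q]) (simp add: q le_diff_conv le_SucI)
next
  fix \<rho> :: "nat \<Rightarrow> nat" and s assume \<rho>: "\<forall>j. \<rho> j < s"
  obtain c R p where c: "computes_reg c R p \<rho> s f" using pcomp_obtain[OF assms \<rho>] .
  show "\<exists>c R p. computes_reg c R p \<rho> s (\<lambda>x e. f x e - 1)"
  proof (rule computes_regI[where c = "Seq c (if_nz s (dec s) skip)" and R = "R + s + 2" and p = "p + [:3:]"])
    fix k out and x :: "bool list" and \<sigma> :: "nat \<Rightarrow> nat" and B :: nat
    assume A: "R + s + 2 \<le> k" "\<forall>i\<ge>s. \<sigma> i = 0" "\<forall>i. \<sigma> i \<le> B" "length x \<le> B"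
    let ?v = "f x (\<lambda>j. \<sigma> (\<rho> j))"
    have "runs (if ?v \<noteq> 0 then dec s else skip) (conf k x 0 (\<sigma>(s := ?v)) out) 1
      (conf k x 0 (\<sigma>(s := ?v - 1)) out)"
      using runs_dec[of s k "\<sigma>(s := ?v)"] runs_skip[of k x 0 "\<sigma>(s := ?v)" out] A by auto
    then have "runs (if_nz s (dec s) skip) (conf k x 0 (\<sigma>(s := ?v)) out) (Suc 1) (conf k x 0 (\<sigma>(s := ?v - 1)) out)"
      using A by (intro runs_if_nz) auto
    from runs_Seq[OF computes_regD[OF c _ A(2-4) refl] this]
    show "runs (Seq c (if_nz s (dec s) skip)) (conf k x 0 \<sigma> out) (poly (p + [:3:]) B)
       (conf k x 0 (\<sigma>(s := f x (\<lambda>j. \<sigma> (\<rho> j)) - 1)) out)"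
      using A by (auto intro: runs_mono)
  qed (use computes_reg_ok[OF c] in simp)
qed

lemma pcomp_if_nz:
  assumes "pcomp b" "pcomp f" "pcomp g"
  shows "pcomp (\<lambda>x e. if b x e \<noteq> 0 then f x e else g x e)"
proof (rule pcompI)
  obtain q1 q2 :: "nat poly" where q: "\<And>x e B. length x \<le> B \<Longrightarrow> \<forall>j. e j \<le> B \<Longrightarrow> f x e \<le> poly q1 B"
     "\<And>x e B. length x \<le> B \<Longrightarrow> \<forall>j. e j \<le> B \<Longrightarrow> g x e \<le> poly q2 B"
    using pcomp_bound[OF assms(2)] pcomp_bound[OF assms(3)] by metis
  show "pbounded (\<lambda>x e. if b x e \<noteq> 0 then f x e else g x e)"
    by (rule pboundedI[where q = "q1 + q2"]) (simp add: q trans_le_add1 trans_le_add2)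
next
  fix \<rho> :: "nat \<Rightarrow> nat" and s assume \<rho>: "\<forall>j. \<rho> j < s"
  obtain q0 :: "nat poly" where q0: "\<And>x e B. length x \<le> B \<Longrightarrow> \<forall>j. e j \<le> B \<Longrightarrow> b x e \<le> poly q0 B"
    using pcomp_bound[OF assms(1)] by blast
  obtain cb Rb pb where b: "computes_reg cb Rb pb \<rho> s b" using pcomp_obtain[OF assms(1) \<rho>] .
  obtain cf Rf pf where f: "computes_reg cf Rf pf \<rho> s f" using pcomp_obtain[OF assms(2) \<rho>] .
  obtain cg Rg pg where g: "computes_reg cg Rg pg \<rho> s g" using pcomp_obtain[OF assms(3) \<rho>] .
  let ?p = "pb + pf + pg + smult 2 q0 + [:4:]"
  \<comment> \<open>The condition is evaluated in the result register itself. In the else branch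
    this register is 0 already, so only the other branch has to clear it.\<close>
  let ?c = "Seq cb (if_nz s (Seq (clear s) cf) cg)"
  show "\<exists>c R p. computes_reg c R p \<rho> s (\<lambda>x e. if b x e \<noteq> 0 then f x e else g x e)"
  proof (rule computes_regI[where c = ?c and R = "Rb + Rf + Rg + s + 2" and p = ?p])
    fix k out and x :: "bool list" and \<sigma> :: "nat \<Rightarrow> nat" and B :: nat
    assume A: "Rb + Rf + Rg + s + 2 \<le> k" "\<forall>i\<ge>s. \<sigma> i = 0" "\<forall>i. \<sigma> i \<le> B" "length x \<le> B"
    let ?e = "\<lambda>j. \<sigma> (\<rho> j)"
    let ?w = "if b x ?e \<noteq> 0 then f x ?e else g x ?e"
    have 1: "runs (clear s) (conf k x 0 (\<sigma>(s := b x ?e)) out) (2 * poly q0 B + 1) (conf k x 0 \<sigma> out)"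
      using A q0[OF A(4), of ?e] by (intro runs_clear) auto
    have 2: "runs cf (conf k x 0 \<sigma> out) (poly pf B) (conf k x 0 (\<sigma>(s := f x ?e)) out)"
      using A by (intro computes_regD[OF f _ A(2-4) refl]) simp
    have 3: "runs cg (conf k x 0 \<sigma> out) (poly pg B) (conf k x 0 (\<sigma>(s := g x ?e)) out)"
      using A by (intro computes_regD[OF g _ A(2-4) refl]) simp
    have 4: "\<sigma>(s := 0) = \<sigma>" using A by auto
    have "runs (if b x ?e \<noteq> 0 then Seq (clear s) cf else cg) (conf k x 0 (\<sigma>(s := b x ?e)) out)
        (2 * poly q0 B + 2 + poly pf B + poly pg B) (conf k x 0 (\<sigma>(s := ?w)) out)"
      using runs_mono[OF runs_Seq[OF 1 2]] runs_mono[OF 3] 4 by auto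
    then have "runs (if_nz s (Seq (clear s) cf) cg) (conf k x 0 (\<sigma>(s := b x ?e)) out)
        (Suc (2 * poly q0 B + 2 + poly pf B + poly pg B)) (conf k x 0 (\<sigma>(s := ?w)) out)"
      using A by (intro runs_if_nz) auto
    from runs_Seq[OF computes_regD[OF b _ A(2-4) refl] this]
    show "runs ?c (conf k x 0 \<sigma> out) (poly ?p B) (conf k x 0 (\<sigma>(s := ?w)) out)"
      using A by (auto intro: runs_mono)
  qed (use computes_reg_ok[OF b] computes_reg_ok[OF f] computes_reg_ok[OF g] in simp)
qed

lemma pcomp_sym:
  assumes "pcomp f"
  shows "pcomp (\<lambda>x e. sym x (f x e))"
proof (rule pcompI)
  have "sym x i \<le> 2" for x i
    by (cases "x ! i") (auto simp: sym_def)
  then show "pbounded (\<lambda>x e. sym x (f x e))"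
    by (intro pboundedI[where q = "[:2:]"]) simp
next
  fix \<rho> :: "nat \<Rightarrow> nat" and s assume \<rho>: "\<forall>j. \<rho> j < s"
  obtain q :: "nat poly" where q: "\<And>x e B. length x \<le> B \<Longrightarrow> \<forall>j. e j \<le> B \<Longrightarrow> f x e \<le> poly q B"
    using pcomp_bound[OF assms] by blast
  obtain cf R p where f: "computes_reg cf R p \<rho> s f" using pcomp_obtain[OF assms \<rho>] .
  \<comment> \<open>Programs expect the input head on cell 0. The first loop walks it
    \<open>f x e\<close> cells to the right and saves this number in register \<open>Suc s\<close>;
    the last loop uses the saved number to walk back.\<close>
  let ?c1 = "while_nz s (Seq (dec s) (Seq (inc (Suc s)) inR))"
  let ?c2 = "Cond 0 (\<lambda>a. a = 0) skip (Cond 0 (\<lambda>a. a = 1) (inc s) (Seq (inc s) (inc s)))"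
  let ?c3 = "while_nz (Suc s) (Seq (dec (Suc s)) inL)"
  let ?c = "Seq cf (Seq ?c1 (Seq ?c2 ?c3))"
  let ?p = "p + smult 10 q + [:10:]"
  show "\<exists>c R p. computes_reg c R p \<rho> s (\<lambda>x e. sym x (f x e))"
  proof (rule computes_regI[where c = ?c and R = "R + s + 2" and p = ?p])
    fix k out and x :: "bool list" and \<sigma> :: "nat \<Rightarrow> nat" and B :: nat
    assume A: "R + s + 2 \<le> k" "\<forall>i\<ge>s. \<sigma> i = 0" "\<forall>i. \<sigma> i \<le> B" "length x \<le> B"
    define v where "v = f x (\<lambda>j. \<sigma> (\<rho> j))"
    define w where "w = sym x v"
    have v: "v \<le> poly q B" using A by (simp add: v_def q)
    define S where "S j = \<sigma>(s := v - j, Suc s := j)" for j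
    have 1: "runs ?c1 (conf k x 0 (S 0) out) (v * Suc (Suc (1 + Suc (1 + 1))) + 1) (conf k x v (S v) out)"
      using A by (intro runs_while_nz[where S = S and H = "\<lambda>j. j" and Out = "\<lambda>_. out"]
        runs_Seq[OF runs_dec[OF _ _ refl] runs_Seq[OF runs_inc runs_inR]]) (auto simp: S_def intro!: ext)
    have r: "read (conf k x v (S v) out ! 0) = w" by (simp add: read_input w_def)
    have 2: "runs ?c2 (conf k x v (S v) out) (Suc (Suc (Suc (1 + 1)))) (conf k x v ((S v)(s := w)) out)"
    proof (rule runs_Cond)
      show "runs (if read (conf k x v (S v) out ! 0) = 0 then skip
          else Cond 0 (\<lambda>a. a = 1) (inc s) (Seq (inc s) (inc s))) (conf k x v (S v) out)
          (Suc (Suc (1 + 1))) (conf k x v ((S v)(s := w)) out)"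
      proof (cases "w = 0")
        case True
        then have "(S v)(s := w) = S v" by (auto simp: S_def)
        then show ?thesis using True runs_mono[OF runs_skip] by (simp add: read_input w_def)
      next
        case False
        have "runs (if w = 1 then inc s else Seq (inc s) (inc s)) (conf k x v (S v) out)
            (Suc (1 + 1)) (conf k x v ((S v)(s := w)) out)"
        proof (cases "w = 1")
          case True
          then show ?thesis using A
            by (auto intro!: runs_mono[OF runs_inc] simp: S_def)
        next
          case 2: False
          have "w = 2" using False 2 by (cases "x ! v") (auto simp: w_def sym_def split: if_splits)
          then have eq: "(if w = 1 then inc s else Seq (inc s) (inc s)) = Seq (inc s) (inc s)" by simp
          show ?thesis unfolding eq using A \<open>w = 2\<close>
            by (intro runs_Seq[OF runs_inc[OF _ refl] runs_inc]) (auto simp: S_def)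
        qed
        then have "runs (Cond 0 (\<lambda>a. a = 1) (inc s) (Seq (inc s) (inc s))) (conf k x v (S v) out)
            (Suc (Suc (1 + 1))) (conf k x v ((S v)(s := w)) out)"
          by (intro runs_Cond) (simp_all only: r length_conf)
        then show ?thesis using False by (simp only: r if_False)
      qed
    qed simp
    have 3: "runs ?c3 (conf k x v ((S v)(s := w)) out) (v * Suc (Suc (1 + 1)) + 1) (conf k x 0 (\<sigma>(s := w)) out)"
    proof -
      have "runs ?c3 (conf k x (v - 0) (\<sigma>(s := w, Suc s := v - 0)) out) (v * Suc (Suc (1 + 1)) + 1)
         (conf k x (v - v) (\<sigma>(s := w, Suc s := v - v)) out)"
      proof (rule runs_while_nz[where S = "\<lambda>j. \<sigma>(s := w, Suc s := v - j)" and H = "\<lambda>j. v - j" and Out = "\<lambda>_. out"])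
        fix j assume "j < v"
        then have *: "v - Suc j = v - j - 1" "v - j \<noteq> 0" by auto
        show "runs (Seq (dec (Suc s)) inL) (conf k x (v - j) (\<sigma>(s := w, Suc s := v - j)) out) (Suc (1 + 1))
            (conf k x (v - Suc j) (\<sigma>(s := w, Suc s := v - Suc j)) out)"
          unfolding *(1) using A *(2)
          by (intro runs_Seq[OF runs_dec runs_inL]) auto
      qed (use A in auto)
      moreover have "(S v)(s := w) = \<sigma>(s := w, Suc s := v)" "\<sigma>(s := w, Suc s := 0) = \<sigma>(s := w)"
        using A by (auto simp: S_def)
      ultimately show ?thesis by simp
    qed
    have 0: "runs cf (conf k x 0 \<sigma> out) (poly p B) (conf k x 0 (S 0) out)"
      using A by (intro computes_regD[OF f _ A(2-4)]) (auto simp: S_def v_def)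
    show "runs ?c (conf k x 0 \<sigma> out) (poly ?p B) (conf k x 0 (\<sigma>(s := sym x (f x (\<lambda>j. \<sigma> (\<rho> j))))) out)"
      using runs_mono[OF runs_Seq[OF 0 runs_Seq[OF 1 runs_Seq[OF 2 3]]], of "poly ?p B"] v
      by (simp add: w_def v_def)
  qed (use computes_reg_ok[OF f] in simp)
qed

lemma pcomp_length [pcomp_intros]: "pcomp (\<lambda>x e. length x)"
proof (rule pcompI)
  show "pbounded (\<lambda>x e. length x)"
    by (rule pboundedI[where q = "[:0, 1:]"]) simp
next
  fix \<rho> :: "nat \<Rightarrow> nat" and s assume \<rho>: "\<forall>j. \<rho> j < s"
  \<comment> \<open>The count is kept twice: \<open>s\<close> retains the result, and
    \<open>Suc s\<close> is used up in returning the head.\<close>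
  let ?c1 = "Loop 0 (\<lambda>a. a \<noteq> 0) (Seq (inc s) (Seq (inc (Suc s)) inR))"
  let ?c3 = "while_nz (Suc s) (Seq (dec (Suc s)) inL)"
  show "\<exists>c R p. computes_reg c R p \<rho> s (\<lambda>x e. length x)"
  proof (rule computes_regI[where c = "Seq ?c1 ?c3" and R = "s + 2" and p = "[:10, 10:]"])
    fix k out and x :: "bool list" and \<sigma> :: "nat \<Rightarrow> nat" and B :: nat
    assume A: "s + 2 \<le> k" "\<forall>i\<ge>s. \<sigma> i = 0" "\<forall>i. \<sigma> i \<le> B" "length x \<le> B"
    define v where "v = length x"
    define S where "S j = \<sigma>(s := j, Suc s := j)" for j
    have nz: "sym x j \<noteq> 0 \<longleftrightarrow> j < v" for j by (cases "x ! j") (auto simp: sym_def v_def)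
    have 1: "runs ?c1 (conf k x 0 (S 0) out) (v * Suc (Suc (1 + Suc (1 + 1))) + 1) (conf k x v (S v) out)"
      using A nz by (intro runs_Loop[where S = "\<lambda>j. conf k x j (S j) out"]
        runs_Seq[OF runs_inc[OF _ refl] runs_Seq[OF runs_inc runs_inR]]) (auto simp: S_def read_input intro!: ext)
    have 3: "runs ?c3 (conf k x v (S v) out) (v * Suc (Suc (1 + 1)) + 1) (conf k x 0 (\<sigma>(s := v)) out)"
    proof -
      have "runs ?c3 (conf k x (v - 0) (\<sigma>(s := v, Suc s := v - 0)) out) (v * Suc (Suc (1 + 1)) + 1)
         (conf k x (v - v) (\<sigma>(s := v, Suc s := v - v)) out)"
      proof (rule runs_while_nz[where S = "\<lambda>j. \<sigma>(s := v, Suc s := v - j)" and H = "\<lambda>j. v - j" and Out = "\<lambda>_. out"])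
        fix j assume "j < v"
        then have *: "v - Suc j = v - j - 1" "v - j \<noteq> 0" by auto
        show "runs (Seq (dec (Suc s)) inL) (conf k x (v - j) (\<sigma>(s := v, Suc s := v - j)) out) (Suc (1 + 1))
            (conf k x (v - Suc j) (\<sigma>(s := v, Suc s := v - Suc j)) out)"
          unfolding *(1) using A *(2)
          by (intro runs_Seq[OF runs_dec runs_inL]) auto
      qed (use A in auto)
      moreover have "\<sigma>(s := v, Suc s := 0) = \<sigma>(s := v)" using A by auto
      ultimately show ?thesis by (simp add: S_def)
    qed
    have "S 0 = \<sigma>" using A by (auto simp: S_def)
    then show "runs (Seq ?c1 ?c3) (conf k x 0 \<sigma> out) (poly [:10, 10:] B) (conf k x 0 (\<sigma>(s := length x)) out)"
      using runs_mono[OF runs_Seq[OF 1 3], of "poly [:10, 10:] B"] A(4) by (simp add: v_def)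
  qed simp
qed

text \<open>The bound on all intermediate values is what keeps the iteration polynomial; without it,
  repeated doubling would already give exponential values. Registers \<open>s\<close>,
  \<open>s + 1\<close> and \<open>s + 2\<close> hold the remaining passes, the accumulator and the
  index of the pass.\<close>

lemma pcomp_rec:
  assumes n: "pcomp n" and a: "pcomp a"
    and g: "pcomp (\<lambda>x e. g x (\<lambda>j. e (Suc (Suc j))) (e (Suc 0)) (e 0))"
    and bound: "\<And>x e B i. length x \<le> B \<Longrightarrow> \<forall>j. e j \<le> B \<Longrightarrow> i \<le> n x e \<Longrightarrow>
        rec_nat (a x e) (g x e) i \<le> poly (r :: nat poly) B"
  shows "pcomp (\<lambda>x e. rec_nat (a x e) (g x e) (n x e))"
proof (rule pcompI)
  show "pbounded (\<lambda>x e. rec_nat (a x e) (g x e) (n x e))"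
    by (rule pboundedI[where q = r]) (simp add: bound)
next
  fix \<rho> :: "nat \<Rightarrow> nat" and s assume \<rho>: "\<forall>j. \<rho> j < s"
  \<comment> \<open>In the environment of \<open>g\<close> the accumulator is variable 0 and the
    index is variable 1; the outer variables follow.\<close>
  define \<rho>' where "\<rho>' = case_nat (s + 1) (case_nat (s + 2) \<rho>)"
  have \<rho>1: "\<forall>j. \<rho> j < s + 1" using \<rho> by (simp add: less_Suc_eq)
  have \<rho>': "\<forall>j. \<rho>' j < s + 3" using \<rho> by (auto simp: \<rho>'_def split: nat.split intro: less_trans)
  obtain q :: "nat poly" where q: "\<And>x e B. length x \<le> B \<Longrightarrow> \<forall>j. e j \<le> B \<Longrightarrow> n x e \<le> poly q B"
    using pcomp_bound[OF n] by blast
  obtain qa :: "nat poly" where qa: "\<And>x e B. length x \<le> B \<Longrightarrow> \<forall>j. e j \<le> B \<Longrightarrow> a x e \<le> poly qa B"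
    using pcomp_bound[OF a] by blast
  obtain cn Rn pn where cn: "computes_reg cn Rn pn \<rho> s n" using pcomp_obtain[OF n \<rho>] .
  obtain ca Ra pa where ca: "computes_reg ca Ra pa \<rho> (s + 1) a" using pcomp_obtain[OF a \<rho>1] .
  obtain cg Rg pg where cg: "computes_reg cg Rg pg \<rho>' (s + 3) (\<lambda>x e. g x (\<lambda>j. e (Suc (Suc j))) (e (Suc 0)) (e 0))"
    using pcomp_obtain[OF g \<rho>'] .
  define body where "body = Seq (dec s) (Seq cg (Seq (clear (s + 1)) (Seq (move (s + 3) (s + 1)) (inc (s + 2)))))"
  define c where "c = Seq cn (Seq ca (Seq (while_nz s body) (Seq (clear (s + 2)) (move (s + 1) s))))"
  \<comment> \<open>\<open>bb\<close> majorizes the input length and the registers during the loop,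
    so the subprograms inside are charged at \<open>bb\<close> instead of the original
    bound.\<close>
  define bb where "bb = [:0, 1:] + q + qa + r"
  define p where "p = pn + pcompose pa bb + q * (pcompose pg bb + smult 6 bb + [:10:]) + smult 6 bb + [:10:]"
  have ok: "ok_com (Suc (Rn + Ra + Rg + s + 5)) c"
    using computes_reg_ok[OF cn, of "Rn + Ra + Rg + s + 5"] computes_reg_ok[OF ca, of "Rn + Ra + Rg + s + 5"]
      computes_reg_ok[OF cg, of "Rn + Ra + Rg + s + 5"]
    by (simp add: c_def body_def)
  show "\<exists>c R p. computes_reg c R p \<rho> s (\<lambda>x e. rec_nat (a x e) (g x e) (n x e))"
  proof (rule computes_regI[where p = p, OF ok])
    fix k out and x :: "bool list" and \<sigma> :: "nat \<Rightarrow> nat" and B :: nat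
    assume A: "Rn + Ra + Rg + s + 5 \<le> k" "\<forall>i\<ge>s. \<sigma> i = 0" "\<forall>i. \<sigma> i \<le> B" "length x \<le> B"
    let ?e = "\<lambda>j. \<sigma> (\<rho> j)"
    have e: "\<forall>j. ?e j \<le> B" using A by simp
    define N where "N = n x ?e"
    define V where "V = rec_nat (a x ?e) (g x ?e)"
    define C where "C = poly bb B"
    have NB: "N \<le> poly q B" using q[OF A(4) e] by (simp add: N_def)
    have BC: "B \<le> C" by (simp add: C_def bb_def)
    have C: "N \<le> C" "length x \<le> C" "\<And>i. \<sigma> i \<le> C" "\<And>i. i \<le> N \<Longrightarrow> V i \<le> C"
    proof -
      show "N \<le> C" using NB by (simp add: C_def bb_def)
      show "length x \<le> C" "\<And>i. \<sigma> i \<le> C" using BC A le_trans by blast+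
      show "V i \<le> C" if "i \<le> N" for i
        using bound[OF A(4) e, of i] that by (simp add: C_def bb_def V_def N_def)
    qed
    have \<rho>s: "\<rho> j \<noteq> s" "\<rho> j \<noteq> Suc s" "\<rho> j \<noteq> Suc (Suc s)" for j
      using spec[OF \<rho>, of j] by auto
    define S where "S j = \<sigma>(s := N - j, s + 1 := V j, s + 2 := j)" for j
    have 1: "runs cn (conf k x 0 \<sigma> out) (poly pn B) (conf k x 0 (\<sigma>(s := N)) out)"
      using A by (intro computes_regD[OF cn _ A(2-4)]) (auto simp: N_def)
    have 2: "runs ca (conf k x 0 (\<sigma>(s := N)) out) (poly pa C) (conf k x 0 (S 0) out)"
      using A C \<rho>s by (intro computes_regD[OF ca]) (auto simp: S_def V_def)
    have 3: "runs (while_nz s body) (conf k x 0 (S 0) out) (N * Suc (poly pg C + 6 * C + 9) + 1) (conf k x 0 (S N) out)"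
    proof (rule runs_while_nz[where S = S and H = "\<lambda>_. 0" and Out = "\<lambda>_. out"])
      fix j assume j: "j < N"
      define S1 where "S1 = (S j)(s := N - Suc j)"
      define S2 where "S2 = S1(s + 3 := V (Suc j))"
      define S3 where "S3 = S2(s + 1 := 0)"
      define S4 where "S4 = S3(s + 3 := 0, s + 1 := V (Suc j))"
      have a1: "runs (dec s) (conf k x 0 (S j) out) 1 (conf k x 0 S1 out)"
        using j A by (intro runs_dec) (auto simp: S1_def S_def)
      have env: "(\<lambda>j. S1 (\<rho>' (Suc (Suc j)))) = ?e" "S1 (\<rho>' (Suc 0)) = j" "S1 (\<rho>' 0) = V j"
        using \<rho>s by (auto simp: S1_def S_def \<rho>'_def)
      have a2: "runs cg (conf k x 0 S1 out) (poly pg C) (conf k x 0 S2 out)"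
      proof (rule computes_regD[OF cg])
        show "\<forall>i\<ge>s + 3. S1 i = 0" using A by (auto simp: S1_def S_def)
        show "\<forall>i. S1 i \<le> C" using C j by (auto simp: S1_def S_def)
        show "S2 = S1(s + 3 := g x (\<lambda>j. S1 (\<rho>' (Suc (Suc j)))) (S1 (\<rho>' (Suc 0))) (S1 (\<rho>' 0)))"
          unfolding env S2_def by (simp add: V_def)
      qed (use A C in auto)
      have a3: "runs (clear (s + 1)) (conf k x 0 S2 out) (2 * C + 1) (conf k x 0 S3 out)"
        using A C(4)[of j] j by (intro runs_clear) (auto simp: S3_def S2_def S1_def S_def)
      have a4: "runs (move (s + 3) (s + 1)) (conf k x 0 S3 out) (4 * C + 1) (conf k x 0 S4 out)"
        using A C(4)[of "Suc j"] j by (intro runs_move) (auto simp: S4_def S3_def S2_def S1_def S_def)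
      have a5: "runs (inc (s + 2)) (conf k x 0 S4 out) 1 (conf k x 0 (S (Suc j)) out)"
        using A by (intro runs_inc) (auto simp: S4_def S3_def S2_def S1_def S_def intro!: ext)
      show "runs body (conf k x 0 (S j) out) (poly pg C + 6 * C + 9) (conf k x 0 (S (Suc j)) out)"
        unfolding body_def
        by (rule runs_mono[OF runs_Seq[OF a1 runs_Seq[OF a2 runs_Seq[OF a3 runs_Seq[OF a4 a5]]]]]) simp
    qed (use A in \<open>auto simp: S_def\<close>)
    have 4: "runs (clear (s + 2)) (conf k x 0 (S N) out) (2 * C + 1) (conf k x 0 (\<sigma>(s := 0, s + 1 := V N)) out)"
      using A C by (intro runs_clear) (auto simp: S_def intro!: ext)
    have 5: "runs (move (s + 1) s) (conf k x 0 (\<sigma>(s := 0, s + 1 := V N)) out) (4 * C + 1) (conf k x 0 (\<sigma>(s := V N)) out)"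
      using A C(4)[of N] by (intro runs_move) (auto intro!: ext)
    have "runs c (conf k x 0 \<sigma> out) (poly p B) (conf k x 0 (\<sigma>(s := V N)) out)"
      unfolding c_def
    proof (rule runs_mono[OF runs_Seq[OF 1 runs_Seq[OF 2 runs_Seq[OF 3 runs_Seq[OF 4 5]]]]])
      have "N * Suc (poly pg C + 6 * C + 9) \<le> poly q B * (poly pg C + 6 * C + 10)"
      proof -
        have "Suc (poly pg C + 6 * C + 9) = poly pg C + 6 * C + 10" by simp
        then show ?thesis by (simp only: mult_le_mono1[OF NB])
      qed
      then show "Suc (poly pn B + Suc (poly pa C + Suc (N * Suc (poly pg C + 6 * C + 9) + 1 + Suc (2 * C + 1 + (4 * C + 1))))) \<le> poly p B"
        by (simp add: p_def poly_pcompose flip: C_def)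
    qed
    then show "runs c (conf k x 0 \<sigma> out) (poly p B) (conf k x 0 (\<sigma>(s := rec_nat (a x ?e) (g x ?e) (n x ?e))) out)"
      by (simp add: V_def N_def)
  qed
qed

section \<open>Programs that write a list\<close>

fun init_marks :: "nat \<Rightarrow> com" where
  "init_marks 0 = skip"
| "init_marks (Suc i) = Seq (init_marks i) (Op (Suc i) (\<lambda>_. (1, Stay)))"

text \<open>The work tapes start blank, whereas a counter is tested for zero by reading its mark in
  cell 0. The last tape stays blank, as it receives the output.\<close>

lemma runs_init_marks:
  assumes "m \<le> k"
  shows "runs (init_marks m) (input_tape x # replicate (Suc k) (input_tape [])) (2 * m + 1)
    (input_tape x # map (\<lambda>i. (mark, 0)) [0..<m] @ replicate (Suc k - m) (input_tape []))"
  using assms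
proof (induction m)
  case 0
  show ?case unfolding init_marks.simps skip_def
    by (rule runs_mono[OF runs_Op]) (auto simp: read_def input_tape_def)
next
  case (Suc m)
  let ?l = "input_tape x # map (\<lambda>i. (mark, 0)) [0..<m] @ replicate (Suc k - m) (input_tape [])"
  have *: "replicate (Suc k - m) (input_tape []) = input_tape [] # replicate (Suc k - Suc m) (input_tape [])"
    using Suc.prems by (simp add: Suc_diff_le)
  have nth: "?l ! Suc m = input_tape []"
    unfolding * by (simp add: nth_append)
  have "act (1, Stay) (input_tape []) = (mark, 0)"
    by (auto simp: input_tape_def mark_def)
  moreover have "?l[Suc m := (mark, 0)] = input_tape x # map (\<lambda>i. (mark, 0)) [0..<Suc m] @ replicate (Suc k - Suc m) (input_tape [])"
    unfolding * by (simp add: list_update_append)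
  ultimately have "runs (Op (Suc m) (\<lambda>_. (1, Stay))) ?l 1
     (input_tape x # map (\<lambda>i. (mark, 0)) [0..<Suc m] @ replicate (Suc k - Suc m) (input_tape []))"
    using Suc.prems nth by (intro runs_Op) auto
  from runs_Seq[OF Suc.IH this] show ?case using Suc.prems by simp
qed

lemma ok_init_marks: "m < n \<Longrightarrow> ok_com n (init_marks m)"
  by (induction m) auto

text \<open>The passage from \<open>pcomp\<close> to \<open>poly_time\<close>. Every function to be
  computed is brought into this form, in which the length of the output is computed beforehand and
  each bit from the input and its own index.\<close>

theorem poly_time_map:
  assumes n: "pcomp (\<lambda>x e. n x)" and g: "pcomp (\<lambda>x e. of_bool (g x (e 0)))"
  shows "poly_time (\<lambda>x. map (g x) [0..<n x])"
proof -
  obtain q :: "nat poly" where q': "\<And>x (e :: nat \<Rightarrow> nat) B. length x \<le> B \<Longrightarrow> \<forall>j. e j \<le> B \<Longrightarrow> n x \<le> poly q B"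
    using pcomp_bound[OF n] by metis
  have q: "n x \<le> poly q (length x)" for x
    using q'[of x "length x" "\<lambda>_. 0"] by simp
  \<comment> \<open>\<open>n\<close> ignores the environment, so all variables may be placed in
    register 0, which stays 0. Registers 1, 2 and 3 hold the remaining count, the index and the
    current bit.\<close>
  obtain cn Rn pn where cn: "computes_reg cn Rn pn (\<lambda>_. 0) 1 (\<lambda>x e. n x)"
    using pcomp_obtain[OF n, of "\<lambda>_. 0" 1] by auto
  obtain cg Rg pg where cg: "computes_reg cg Rg pg (\<lambda>_. 2) 3 (\<lambda>x e. of_bool (g x (e 0)))"
    using pcomp_obtain[OF g, of "\<lambda>_. 2" 3] by auto
  define k where "k = Rn + Rg + 5"
  define body where "body = Seq (dec 1) (Seq cg (Seq (if_nz 3 (Seq (emit k True) (dec 3)) (emit k False)) (inc 2)))"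
  define c where "c = Seq (init_marks k) (Seq cn (while_nz 1 body))"
  define bb where "bb = [:0, 1:] + q"
  define p where "p = [:2 * k + 10:] + pn + q * (pcompose pg bb + [:10:])"
  show ?thesis
  proof (rule poly_time_com)
    show "ok_com (k + 2) c"
      using computes_reg_ok[OF cn, of "k + 1"] computes_reg_ok[OF cg, of "k + 1"] ok_init_marks[of k "k + 2"]
      by (simp add: c_def body_def k_def)
    show "1 \<le> k + 2" by simp
  next
    fix x
    define N where "N = n x"
    define C where "C = length x + poly q (length x)"
    have C: "length x \<le> C" "N \<le> C" using q[of x] by (auto simp: C_def N_def)
    define S :: "nat \<Rightarrow> nat \<Rightarrow> nat" where "S j = (\<lambda>_. 0)(1 := N - j, 2 := j)" for j
    have 1: "runs (init_marks k) (input_tape x # replicate (k + 2 - 1) (input_tape [])) (2 * k + 1)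
        (conf k x 0 (\<lambda>_. 0) [])"
      using runs_init_marks[of k k x] by (simp add: conf_def input_tape_def)
    have 2: "runs cn (conf k x 0 (\<lambda>_. 0) []) (poly pn (length x)) (conf k x 0 (S 0) [])"
      by (rule computes_regD[OF cn]) (auto simp: k_def S_def N_def)
    have 3: "runs (while_nz 1 body) (conf k x 0 (S 0) (map (g x) [0..<0])) (N * Suc (poly pg C + 9) + 1)
        (conf k x 0 (S N) (map (g x) [0..<N]))"
    proof (rule runs_while_nz[where S = S and H = "\<lambda>_. 0" and Out = "\<lambda>j. map (g x) [0..<j]"])
      fix j assume j: "j < N"
      let ?o = "map (g x) [0..<j]" and ?o' = "map (g x) [0..<Suc j]"
      define S1 where "S1 = (S j)(1 := N - Suc j)"
      define S2 where "S2 = S1(3 := of_bool (g x j))"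
      have a1: "runs (dec 1) (conf k x 0 (S j) ?o) 1 (conf k x 0 S1 ?o)"
        using j by (intro runs_dec) (auto simp: S1_def S_def k_def)
      have a2: "runs cg (conf k x 0 S1 ?o) (poly pg C) (conf k x 0 S2 ?o)"
        using C j by (intro computes_regD[OF cg]) (auto simp: k_def S2_def S1_def S_def)
      have a3: "runs (if_nz 3 (Seq (emit k True) (dec 3)) (emit k False)) (conf k x 0 S2 ?o) (Suc (Suc (1 + 1)))
          (conf k x 0 S1 ?o')"
      proof (rule runs_if_nz)
        show "runs (if S2 3 \<noteq> 0 then Seq (emit k True) (dec 3) else emit k False)
            (conf k x 0 S2 ?o) (Suc (1 + 1)) (conf k x 0 S1 ?o')"
        proof (cases "g x j")
          case True
          then have "runs (dec 3) (conf k x 0 S2 (?o @ [True])) 1 (conf k x 0 S1 (?o @ [True]))"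
            by (intro runs_dec) (auto simp: S2_def S1_def S_def k_def)
          from runs_Seq[OF runs_emit this] True show ?thesis by (simp add: S2_def)
        next
          case False
          then have "S1 = S2" by (auto simp: S2_def S1_def S_def)
          moreover have "(if S2 3 \<noteq> 0 then Seq (emit k True) (dec 3) else emit k False) = emit k False"
            using False by (simp add: S2_def)
          moreover have "?o' = ?o @ [False]" using False by simp
          ultimately show ?thesis
            by (simp only:) (rule runs_mono[OF runs_emit], simp)
        qed
      qed (simp add: k_def)
      have a4: "runs (inc 2) (conf k x 0 S1 ?o') 1 (conf k x 0 (S (Suc j)) ?o')"
        by (intro runs_inc) (auto simp: S1_def S_def k_def)
      show "runs body (conf k x 0 (S j) ?o) (poly pg C + 9) (conf k x 0 (S (Suc j)) ?o')"
        unfolding body_def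
        by (rule runs_mono[OF runs_Seq[OF a1 runs_Seq[OF a2 runs_Seq[OF a3 a4]]]]) simp
    qed (auto simp: S_def k_def)
    have "runs c (input_tape x # replicate (k + 2 - 1) (input_tape [])) (poly p (length x)) (conf k x 0 (S N) (map (g x) [0..<N]))"
      unfolding c_def
    proof (rule runs_mono[OF runs_Seq[OF 1 runs_Seq[OF 2]]])
      show "runs (while_nz 1 body) (conf k x 0 (S 0) []) (N * Suc (poly pg C + 9) + 1) (conf k x 0 (S N) (map (g x) [0..<N]))"
        using 3 by simp
      have "N * Suc (poly pg C + 9) \<le> poly q (length x) * (poly pg C + 10)"
      proof -
        have "Suc (poly pg C + 9) = poly pg C + 10" by simp
        then show ?thesis by (simp only: mult_le_mono1[OF q] N_def)
      qed
      then show "Suc (2 * k + 1 + Suc (poly pn (length x) + (N * Suc (poly pg C + 9) + 1))) \<le> poly p (length x)"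
        by (simp add: p_def bb_def poly_pcompose C_def)
    qed
    moreover have "tape_holds (last (conf k x 0 (S N) (map (g x) [0..<N]))) (map (g x) [0..<n x])"
      by (auto simp: conf_def tape_holds_def input_tape_def N_def)
    ultimately show "\<exists>ts. runs c (input_tape x # replicate (k + 2 - 1) (input_tape [])) (poly p (length x)) ts \<and>
        tape_holds (last ts) (map (g x) [0..<n x])"
      by blast
  qed
qed

subsection \<open>Closure properties\<close>

definition pdec :: "(bool list \<Rightarrow> (nat \<Rightarrow> nat) \<Rightarrow> bool) \<Rightarrow> bool" where
  "pdec P \<longleftrightarrow> pcomp (\<lambda>x e. of_bool (P x e))"

lemma pcomp_const [pcomp_intros]: "pcomp (\<lambda>x e. c)"
  by (induction c) (auto intro: pcomp_zero pcomp_Suc)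

lemma pdec_const [pcomp_intros]: "pdec (\<lambda>x e. c)"
  unfolding pdec_def by (rule pcomp_const)

lemma pcomp_of_bool [pcomp_intros]: "pdec P \<Longrightarrow> pcomp (\<lambda>x e. of_bool (P x e))"
  unfolding pdec_def .

lemma pcomp_if [pcomp_intros]:
  assumes "pdec P" "pcomp f" "pcomp g"
  shows "pcomp (\<lambda>x e. if P x e then f x e else g x e)"
  using pcomp_if_nz[OF assms(1)[unfolded pdec_def] assms(2,3)] by (simp cong: if_cong)

lemma pcomp_add [pcomp_intros]:
  assumes "pcomp f" "pcomp g"
  shows "pcomp (\<lambda>x e. f x e + g x e)"
proof -
  have rec: "rec_nat a (\<lambda>i. Suc) n = a + n" for a n by (induction n) auto
  obtain p q :: "nat poly" where pq: "\<And>x e B. length x \<le> B \<Longrightarrow> \<forall>j. e j \<le> B \<Longrightarrow> f x e \<le> poly p B"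
     "\<And>x e B. length x \<le> B \<Longrightarrow> \<forall>j. e j \<le> B \<Longrightarrow> g x e \<le> poly q B"
    using pcomp_bound[OF assms(1)] pcomp_bound[OF assms(2)] by metis
  have "pcomp (\<lambda>x e. rec_nat (f x e) (\<lambda>i. Suc) (g x e))"
  proof (rule pcomp_rec[where r = "p + q", OF assms(2,1)])
    show "rec_nat (f x e) (\<lambda>i. Suc) i \<le> poly (p + q) B"
      if "length x \<le> B" "\<forall>j. e j \<le> B" "i \<le> g x e" for x e B i
      unfolding rec using add_mono[OF pq(1)[OF that(1,2)] le_trans[OF that(3) pq(2)[OF that(1,2)]]] by simp
  qed (intro pcomp_intros)
  then show ?thesis by (simp only: rec)
qed

lemma pcomp_diff [pcomp_intros]:
  assumes "pcomp f" "pcomp g"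
  shows "pcomp (\<lambda>x e. f x e - g x e)"
proof -
  have rec: "rec_nat a (\<lambda>i v. v - 1) n = a - n" for a n by (induction n) auto
  obtain p :: "nat poly" where p: "\<And>x e B. length x \<le> B \<Longrightarrow> \<forall>j. e j \<le> B \<Longrightarrow> f x e \<le> poly p B"
    using pcomp_bound[OF assms(1)] by metis
  have "pcomp (\<lambda>x e. rec_nat (f x e) (\<lambda>i v. v - 1) (g x e))"
  proof (rule pcomp_rec[where r = p, OF assms(2,1)])
    show "rec_nat (f x e) (\<lambda>i v. v - 1) i \<le> poly p B"
      if "length x \<le> B" "\<forall>j. e j \<le> B" "i \<le> g x e" for x e B i
      unfolding rec using p[OF that(1,2)] by simp
  qed (intro pcomp_pred pcomp_intros)
  then show ?thesis by (simp only: rec)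
qed

lemma pcomp_sum [pcomp_intros]:
  assumes n: "pcomp n" and f: "pcomp (\<lambda>x e. f x (\<lambda>j. e (Suc j)) (e 0))"
  shows "pcomp (\<lambda>x e. \<Sum>i<n x e. f x e i)"
proof -
  have rec: "rec_nat 0 (\<lambda>i v. v + h i) m = (\<Sum>i<m. h i)" for h :: "nat \<Rightarrow> nat" and m
    by (induction m) auto
  obtain p :: "nat poly" where p: "\<And>x e B. length x \<le> B \<Longrightarrow> \<forall>j. e j \<le> B \<Longrightarrow> n x e \<le> poly p B"
    using pcomp_bound[OF n] by metis
  obtain q :: "nat poly" where q: "\<And>x e B. length x \<le> B \<Longrightarrow> \<forall>j. e j \<le> B \<Longrightarrow> f x (\<lambda>j. e (Suc j)) (e 0) \<le> poly q B"
    using pcomp_bound[OF f] by metis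
  have "pcomp (\<lambda>x e. rec_nat 0 (\<lambda>i v. v + f x e i) (n x e))"
  proof (rule pcomp_rec[where r = "p * pcompose q ([:0, 1:] + p)", OF n pcomp_const])
    \<comment> \<open>The summand has its index as variable 0. Inside the recursion the accumulator
      takes this place, so the index becomes variable 1 and the outer variables move by two.\<close>
    show "pcomp (\<lambda>x e. e 0 + f x (\<lambda>j. e (Suc (Suc j))) (e (Suc 0)))"
      using pcomp_rename[OF f, of "case_nat (Suc 0) (\<lambda>j. Suc (Suc j))"]
      by (intro pcomp_add pcomp_var) simp
  next
    fix x e B i assume A: "length x \<le> B" "\<forall>j. e j \<le> B" "i \<le> n x e"
    \<comment> \<open>Binding the index raises the bound on the environment from \<open>B\<close> to
      \<open>B + poly p B\<close>, which explains the composition in the bound.\<close>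
    have "f x e l \<le> poly q (B + poly p B)" if "l < i" for l
      using q[of x "B + poly p B" "case_nat l e"] A that p[OF A(1,2)]
      by (auto simp: trans_le_add1 split: nat.split)
    then have "(\<Sum>l<i. f x e l) \<le> i * poly q (B + poly p B)"
      using sum_bounded_above[of "{..<i}" "f x e"] by simp
    also have "\<dots> \<le> poly p B * poly q (B + poly p B)"
      using le_trans[OF A(3) p[OF A(1,2)]] by simp
    finally show "rec_nat 0 (\<lambda>i v. v + f x e i) i \<le> poly (p * pcompose q ([:0, 1:] + p)) B"
      unfolding rec by (simp add: poly_pcompose)
  qed
  then show ?thesis by (simp only: rec)
qed

lemma pcomp_shift: "pcomp f \<Longrightarrow> pcomp (\<lambda>x e. f x (\<lambda>j. e (Suc j)))"
  by (rule pcomp_rename)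

lemma pcomp_mult [pcomp_intros]:
  assumes "pcomp f" "pcomp g"
  shows "pcomp (\<lambda>x e. f x e * g x e)"
proof -
  have "pcomp (\<lambda>x e. \<Sum>i<f x e. g x e)"
    by (intro pcomp_sum pcomp_shift assms)
  then show ?thesis by simp
qed

lemma pdec_le [pcomp_intros]:
  assumes "pcomp f" "pcomp g"
  shows "pdec (\<lambda>x e. f x e \<le> g x e)"
proof -
  have "pcomp (\<lambda>x e. 1 - (f x e - g x e))" by (intro pcomp_intros assms)
  moreover have "1 - (a - b) = of_bool (a \<le> b)" for a b :: nat by auto
  ultimately show ?thesis by (simp only: pdec_def)
qed

lemma pdec_less [pcomp_intros]: "pcomp f \<Longrightarrow> pcomp g \<Longrightarrow> pdec (\<lambda>x e. f x e < g x e)"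
  unfolding less_eq_Suc_le by (intro pcomp_intros)

lemma pdec_not [pcomp_intros]:
  assumes "pdec P"
  shows "pdec (\<lambda>x e. \<not> P x e)"
proof -
  have "pcomp (\<lambda>x e. if P x e then 0 else 1)" by (intro pcomp_intros assms)
  moreover have "(if Q then 0 else 1) = (of_bool (\<not> Q) :: nat)" for Q by auto
  ultimately show ?thesis by (simp only: pdec_def)
qed

lemma pdec_if [pcomp_intros]:
  assumes "pdec P" "pdec Q" "pdec R"
  shows "pdec (\<lambda>x e. if P x e then Q x e else R x e)"
proof -
  have "pcomp (\<lambda>x e. if P x e then of_bool (Q x e) else of_bool (R x e))" by (intro pcomp_intros assms)
  moreover have "(if a then of_bool b else of_bool c) = (of_bool (if a then b else c) :: nat)" for a b c by auto
  ultimately show ?thesis by (simp only: pdec_def)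
qed

lemma pdec_conj [pcomp_intros]:
  assumes "pdec P" "pdec Q"
  shows "pdec (\<lambda>x e. P x e \<and> Q x e)"
proof -
  have "(if a then b else False) \<longleftrightarrow> a \<and> b" for a b by simp
  then show ?thesis using pdec_if[OF assms pdec_const[of False]] by (simp only:)
qed

lemma pdec_disj [pcomp_intros]:
  assumes "pdec P" "pdec Q"
  shows "pdec (\<lambda>x e. P x e \<or> Q x e)"
  using pdec_not[OF pdec_conj[OF pdec_not[OF assms(1)] pdec_not[OF assms(2)]]] by simp

lemma pdec_imp [pcomp_intros]:
  assumes "pdec P" "pdec Q"
  shows "pdec (\<lambda>x e. P x e \<longrightarrow> Q x e)"
  using pdec_disj[OF pdec_not[OF assms(1)] assms(2)] by (simp only: imp_conv_disj)

lemma pdec_eq [pcomp_intros]: "pcomp f \<Longrightarrow> pcomp g \<Longrightarrow> pdec (\<lambda>x e. f x e = g x e)"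
  unfolding eq_iff by (intro pcomp_intros)

lemma pdec_Ex [pcomp_intros]:
  assumes "pcomp n" "pdec (\<lambda>x e. P x (\<lambda>j. e (Suc j)) (e 0))"
  shows "pdec (\<lambda>x e. \<exists>i<n x e. P x e i)"
proof -
  have "pdec (\<lambda>x e. (\<Sum>i<n x e. of_bool (P x e i) :: nat) \<noteq> 0)"
    by (intro pcomp_intros assms)
  moreover have "(\<Sum>i<m. of_bool (Q i) :: nat) \<noteq> 0 \<longleftrightarrow> (\<exists>i<m. Q i)" for m :: nat and Q
    by auto
  ultimately show ?thesis by (simp only:)
qed

lemma pdec_All [pcomp_intros]:
  assumes "pcomp n" "pdec (\<lambda>x e. P x (\<lambda>j. e (Suc j)) (e 0))"
  shows "pdec (\<lambda>x e. \<forall>i<n x e. P x e i)"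
  using pdec_not[OF pdec_Ex[OF assms(1) pdec_not[OF assms(2)]]] by simp

text \<open>The quotient counts the positive multiples of the divisor up to the dividend; divisor 0
  is treated separately, as every multiple would be counted.\<close>

lemma pcomp_div [pcomp_intros]:
  assumes "pcomp f" "pcomp g"
  shows "pcomp (\<lambda>x e. f x e div g x e)"
proof -
  have "(\<Sum>i<a. of_bool (Suc i * b \<le> a)) = a div b" if "b \<noteq> 0" for a b :: nat
  proof -
    have "Suc i * b \<le> a \<longleftrightarrow> i < a div b" for i
      using that by (simp add: less_eq_div_iff_mult_less_eq Suc_le_eq flip: less_eq_Suc_le)
        (metis Suc_le_eq less_eq_div_iff_mult_less_eq mult_Suc neq0_conv)
    then have "(\<Sum>i<a. of_bool (Suc i * b \<le> a)) = card ({..<a} \<inter> {..<a div b})"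
      by (simp add: sum.If_cases of_bool_def lessThan_def)
    also have "{..<a} \<inter> {..<a div b} = {..<a div b}"
      using div_le_dividend[of a b] by (auto intro: less_le_trans)
    finally show ?thesis by simp
  qed
  then have "a div b = (if b = 0 then 0 else \<Sum>i<a. of_bool (Suc i * b \<le> a))" for a b :: nat
    by simp
  then have eq: "(\<lambda>x e. f x e div g x e) =
      (\<lambda>x e. if g x e = 0 then 0 else \<Sum>i<f x e. of_bool (Suc i * g x e \<le> f x e))"
    by (intro ext)
  show ?thesis
    unfolding eq by (intro pcomp_intros pcomp_shift assms)
qed

lemma pcomp_mod [pcomp_intros]:
  assumes "pcomp f" "pcomp g"
  shows "pcomp (\<lambda>x e. f x e mod g x e)"
  unfolding minus_mult_div_eq_mod[symmetric] by (intro pcomp_intros assms)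

lemma pdec_even [pcomp_intros]: "pcomp f \<Longrightarrow> pdec (\<lambda>x e. even (f x e))"
  unfolding even_iff_mod_2_eq_zero by (intro pcomp_intros)

lemma pcomp_min [pcomp_intros]: "pcomp f \<Longrightarrow> pcomp g \<Longrightarrow> pcomp (\<lambda>x e. min (f x e) (g x e))"
  unfolding min_def by (intro pcomp_intros)

lemma pcomp_poly [pcomp_intros]:
  assumes "pcomp f"
  shows "pcomp (\<lambda>x e. poly (p :: nat poly) (f x e))"
  by (induction p) (auto intro!: pcomp_intros assms)

text \<open>The power alone is not polynomially bounded. Capping after every doubling gives the same
  result as capping once at the end, and keeps the intermediate values small.\<close>

lemma pcomp_min_power [pcomp_intros]:
  assumes "pcomp f" "pcomp g"
  shows "pcomp (\<lambda>x e. min (2 ^ f x e) (g x e))"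
proof -
  have rec: "rec_nat (min 1 b) (\<lambda>i v. min (2 * v) b) n = min (2 ^ n) b" for b n :: nat
    by (induction n) (auto simp: min_def)
  obtain q :: "nat poly" where q: "\<And>x e B. length x \<le> B \<Longrightarrow> \<forall>j. e j \<le> B \<Longrightarrow> g x e \<le> poly q B"
    using pcomp_bound[OF assms(2)] by metis
  have "pcomp (\<lambda>x e. rec_nat (min 1 (g x e)) (\<lambda>i v. min (2 * v) (g x e)) (f x e))"
  proof (rule pcomp_rec[where r = q, OF assms(1)])
    show "rec_nat (min 1 (g x e)) (\<lambda>i v. min (2 * v) (g x e)) i \<le> poly q B"
      if "length x \<le> B" "\<forall>j. e j \<le> B" "i \<le> f x e" for x e B i
      unfolding rec using q[OF that(1,2)] by simp
  qed (intro pcomp_intros pcomp_shift assms pcomp_rename[OF assms(2)])+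
  then show ?thesis by (simp only: rec)
qed

text \<open>Repeated halving gives the quotient without ever forming the power, which may be too
  large for a counter.\<close>

lemma pcomp_div_power [pcomp_intros]:
  assumes "pcomp f" "pcomp g"
  shows "pcomp (\<lambda>x e. f x e div 2 ^ g x e)"
proof -
  have rec: "rec_nat a (\<lambda>i v. v div 2) n = a div 2 ^ n" for a n :: nat
    by (induction n) (auto simp: div_mult2_eq[symmetric] mult.commute)
  obtain q :: "nat poly" where q: "\<And>x e B. length x \<le> B \<Longrightarrow> \<forall>j. e j \<le> B \<Longrightarrow> f x e \<le> poly q B"
    using pcomp_bound[OF assms(1)] by metis
  have "pcomp (\<lambda>x e. rec_nat (f x e) (\<lambda>i v. v div 2) (g x e))"
  proof (rule pcomp_rec[where r = q, OF assms(2,1)])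
    show "rec_nat (f x e) (\<lambda>i v. v div 2) i \<le> poly q B"
      if "length x \<le> B" "\<forall>j. e j \<le> B" "i \<le> g x e" for x e B i
      unfolding rec using le_trans[OF div_le_dividend q[OF that(1,2)]] .
  qed (intro pcomp_intros)+
  then show ?thesis by (simp only: rec)
qed

definition bitat :: "bool list \<Rightarrow> nat \<Rightarrow> bool" where
  "bitat x i \<longleftrightarrow> i < length x \<and> x ! i"

lemma pdec_bitat [pcomp_intros]:
  assumes "pcomp f"
  shows "pdec (\<lambda>x e. bitat x (f x e))"
proof -
  have "pdec (\<lambda>x e. sym x (f x e) = 2)" by (intro pcomp_intros pcomp_sym assms)
  moreover have "sym x i = 2 \<longleftrightarrow> bitat x i" for x i
    by (cases "x ! i") (auto simp: sym_def bitat_def)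
  ultimately show ?thesis by simp
qed

text \<open>No uniformity in \<open>a\<close> is required: the finitely many programs are joined by
  nested conditionals. This is how tags, which are not treated arithmetically, enter decidable
  predicates.\<close>

lemma pcomp_cases:
  assumes "pcomp f" "\<And>x e. f x e < K" "\<And>a. a < K \<Longrightarrow> pcomp (g a)"
  shows "pcomp (\<lambda>x e. g (f x e) x e)"
proof -
  have "pcomp (\<lambda>x e. if f x e < k then g (f x e) x e else 0)" if "k \<le> K" for k
    using that
  proof (induction k)
    case (Suc k)
    then have "pcomp (\<lambda>x e. if f x e = k then g k x e else if f x e < k then g (f x e) x e else 0)"
      by (intro pcomp_if pdec_eq pcomp_const assms(1) Suc.IH assms(3)) simp_all
    also have "(\<lambda>x e. if f x e = k then g k x e else if f x e < k then g (f x e) x e else 0) =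
        (\<lambda>x e. if f x e < Suc k then g (f x e) x e else 0)"
      by (auto intro!: ext)
    finally show ?case .
  qed (simp add: pcomp_const)
  from this[OF order_refl] show ?thesis by (simp add: assms(2))
qed

lemma pdec_cases:
  assumes "pcomp f" "\<And>x e. f x e < K" "\<And>a. a < K \<Longrightarrow> pdec (P a)"
  shows "pdec (\<lambda>x e. P (f x e) x e)"
  using assms unfolding pdec_def by (rule pcomp_cases)

lemma class_P_I:
  assumes "pdec (\<lambda>x e. V x)"
  shows "{x. V x} \<in> class_P"
proof -
  have "poly_time (\<lambda>x. map (\<lambda>i. V x) [0..<1])"
    by (intro poly_time_map pcomp_const assms[unfolded pdec_def])
  then show ?thesis by (simp add: class_P_def)
qed

section \<open>Encodings and membership in NP\<close>

definition bits_val :: "bool list \<Rightarrow> nat" where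
  "bits_val bs = (\<Sum>l<length bs. of_bool (bs ! l) * 2 ^ l)"

lemma bits_val_Cons: "bits_val (b # bs) = of_bool b + 2 * bits_val bs"
  by (simp add: bits_val_def sum.lessThan_Suc_shift sum_distrib_left del: sum.lessThan_Suc)

lemma bits_val_binary: "bits_val (binary d) = d"
proof (induction d rule: less_induct)
  case (less d)
  show ?case
  proof (cases "d = 0")
    case False
    have "of_bool (odd d) + 2 * (d div 2) = d" by (cases "even d") (auto elim!: evenE oddE)
    then show ?thesis using less.IH[of "d div 2"] False by (simp add: binary_pos bits_val_Cons)
  qed (simp add: binary_0 bits_val_def)
qed

lemma bits_val_pos: "bs \<noteq> [] \<Longrightarrow> last bs \<Longrightarrow> 0 < bits_val bs"
proof (induction bs)
  case (Cons b bs)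
  then show ?case by (cases "bs = []") (auto simp: bits_val_Cons)
qed simp

text \<open>A bit list is a binary representation if it has no leading zero, and with the least
  significant bit first this concerns its last entry.\<close>

lemma binary_bits_val: "bs = [] \<or> last bs \<Longrightarrow> binary (bits_val bs) = bs"
proof (induction bs)
  case Nil
  then show ?case by (simp add: bits_val_def binary_0)
next
  case (Cons b bs)
  have "bits_val (b # bs) \<noteq> 0" using bits_val_pos[of "b # bs"] Cons.prems by auto
  then have "binary (bits_val (b # bs)) = b # binary (bits_val bs)"
    by (simp add: binary_pos bits_val_Cons)
  then show ?case using Cons by (auto split: if_splits)
qed

lemma binary_last: "d \<noteq> 0 \<Longrightarrow> binary d \<noteq> [] \<and> last (binary d)"
proof (induction d rule: less_induct)
  case (less d)
  show ?case
  proof (cases "d = 1")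
    case False
    then have "d div 2 < d" "d div 2 \<noteq> 0" using less.prems by auto
    then show ?thesis using less by (simp add: binary_pos[of d])
  qed (simp add: binary_pos binary_0)
qed

lemma nth_binary: "l < length (binary d) \<Longrightarrow> binary d ! l = odd (d div 2 ^ l)"
proof (induction l arbitrary: d)
  case 0
  then show ?case by (cases "d = 0") (auto simp: binary_0 binary_pos)
next
  case (Suc l)
  then have "d \<noteq> 0" by (cases "d = 0") (auto simp: binary_0)
  then show ?case using Suc by (simp add: binary_pos[of d] div_mult2_eq)
qed

text \<open>The length is the number of shifts that leave a nonzero number. As a bounded sum it
  falls under the closure rules, and \<open>d\<close> terms suffice because
  \<open>d div 2 ^ d = 0\<close>.\<close>

lemma length_binary: "length (binary d) = (\<Sum>j<d. of_bool (d div 2 ^ j \<noteq> 0))"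
proof -
  have *: "length (binary d) = (\<Sum>j<n. of_bool (d div 2 ^ j \<noteq> 0))" if "d \<le> n" for n
    using that
  proof (induction d arbitrary: n rule: less_induct)
    case (less d)
    show ?case
    proof (cases "d = 0")
      case False
      then obtain m where n: "n = Suc m" using less.prems by (cases n) auto
      have "d div 2 \<le> m" using less.prems n False by auto
      then have "length (binary (d div 2)) = (\<Sum>j<m. of_bool (d div 2 div 2 ^ j \<noteq> 0))"
        using less.IH[of "d div 2" m] False by simp
      then show ?thesis
        using False by (simp add: n sum.lessThan_Suc_shift binary_pos[of d] div_mult2_eq del: sum.lessThan_Suc)
    qed (simp add: binary_0)
  qed
  show ?thesis by (rule *) simp
qed

text \<open>The capped powers keep all numbers polynomially bounded although the distance is given in binary.\<close>

lemma sum_capped_powers_le: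
  "(\<Sum>l<n. of_bool (b l) * min (2 ^ l) (Suc k)) \<le> k \<longleftrightarrow> (\<Sum>l<n. of_bool (b l) * 2 ^ l) \<le> k"
proof (cases "\<exists>l<n. b l \<and> 2 ^ l > k")
  case True
  then obtain l where l: "l < n" "b l" "2 ^ l > k" by blast
  \<comment> \<open>A single set bit beyond \<open>k\<close> makes both sums exceed
    \<open>k\<close>, since its capped power is still \<open>Suc k\<close>. If there is no such bit,
    no cap takes effect.\<close>
  have "(\<Sum>l<n. of_bool (b l) * f l) > k" if "f l > k" for f :: "nat \<Rightarrow> nat"
    using member_le_sum[of l "{..<n}" "\<lambda>l. of_bool (b l) * f l"] l that by simp
  from this[of "\<lambda>l. min (2 ^ l) (Suc k)"] this[of "\<lambda>l. 2 ^ l"] l(3) show ?thesis by simp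
next
  case False
  then have "(\<Sum>l<n. of_bool (b l) * min (2 ^ l) (Suc k)) = (\<Sum>l<n. of_bool (b l) * 2 ^ l)"
    by (intro sum.cong) (auto simp: not_less min_def)
  then show ?thesis by simp
qed

section \<open>Bits of an encoded instance\<close>

lemma length_encode: "length (encode I) = nS I + nT I + 2 + nS I * nT I + length (binary (min_dist I))"
  by (simp add: encode_def)

text \<open>Random access to an encoding. Lists are written bit by bit by
  \<open>poly_time_map\<close> and read at single positions by the verifier, so the list operations
  of \<open>encode\<close> are replaced by arithmetic on the position.\<close>

definition encode_bit :: "nat \<Rightarrow> nat \<Rightarrow> (nat \<Rightarrow> nat \<Rightarrow> bool) \<Rightarrow> nat \<Rightarrow> nat \<Rightarrow> bool" where
  "encode_bit a b E d k =
     (if k < a then True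
      else if k = a then False
      else if k < a + 1 + b then True
      else if k = a + 1 + b then False
      else if k < a + b + 2 + a * b then E ((k - (a + b + 2)) div b) ((k - (a + b + 2)) mod b)
      else odd (d div 2 ^ (k - (a + b + 2 + a * b))))"

lemma nth_encode:
  assumes "k < length (encode I)"
  shows "encode I ! k = encode_bit (nS I) (nT I) (\<lambda>i t. (i, t) \<in> edges I) (min_dist I) k"
proof -
  let ?a = "nS I" and ?b = "nT I"
  have adj: "List.product [0..<?a] [0..<?b] ! j \<in> edges I \<longleftrightarrow> (j div ?b, j mod ?b) \<in> edges I" if "j < ?a * ?b" for j
  proof -
    have "?b \<noteq> 0" using that by (cases "?b = 0") auto
    then have "j div ?b < ?a" "j mod ?b < ?b" using that by (auto simp: less_mult_imp_div_less)
    then show ?thesis using that by (simp add: product_nth)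
  qed
  consider "k < ?a" | "k = ?a" | "?a < k" "k < ?a + 1 + ?b" | "k = ?a + 1 + ?b"
    | "?a + ?b + 2 \<le> k" "k < ?a + ?b + 2 + ?a * ?b" | "?a + ?b + 2 + ?a * ?b \<le> k" by linarith
  then show ?thesis
  proof cases
    case 3
    define j where "j = k - (?a + 1)"
    have "j < ?b" "k = ?a + 1 + j" using 3 by (auto simp: j_def)
    then show ?thesis by (simp add: encode_def encode_bit_def nth_append)
  next
    case 5
    define j where "j = k - (?a + ?b + 2)"
    have "j < ?a * ?b" "k = ?a + ?b + 2 + j" using 5 by (auto simp: j_def)
    then show ?thesis by (simp add: encode_def encode_bit_def nth_append adj)
  next
    case 6
    define j where "j = k - (?a + ?b + 2 + ?a * ?b)"
    have k: "k = ?a + ?b + 2 + ?a * ?b + j" using 6 by (auto simp: j_def)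
    then have "j < length (binary (min_dist I))" using assms by (simp add: length_encode)
    from nth_binary[OF this] show ?thesis by (simp add: k encode_def encode_bit_def nth_append)
  qed (simp_all add: encode_def encode_bit_def nth_append)
qed

text \<open>Here \<open>X\<close> and \<open>U\<close> are the bits of the input and of the witness, \<open>n\<close> is the length of the input, and
  \<open>a\<close>, \<open>b\<close> are the numbers of nodes. The witness marks the edges of the matching in the
  adjacency matrix. With \<open>c\<close> the degrees are bounded as well.\<close>

definition check :: "bool \<Rightarrow> (nat \<Rightarrow> bool) \<Rightarrow> (nat \<Rightarrow> bool) \<Rightarrow> nat \<Rightarrow> nat \<Rightarrow> nat \<Rightarrow> bool" where
  "check c X U n a b \<longleftrightarrow>
     (\<forall>i<a. X i) \<and> \<not> X a \<and> (\<forall>i<b. X (a + 1 + i)) \<and> \<not> X (a + 1 + b) \<and>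
     a + b + 2 + a * b < n \<and> X (n - 1) \<and>
     (\<forall>i<a. \<exists>t<b. (X (a + b + 2 + (i * b + t)) \<and> U (i * b + t)) \<and>
        (\<forall>t'<b. X (a + b + 2 + (i * b + t')) \<and> U (i * b + t') \<longrightarrow> t' = t)) \<and>
     (\<forall>t<b. \<forall>j<a. \<forall>i<j.
        (X (a + b + 2 + (i * b + t)) \<and> U (i * b + t)) \<and> (X (a + b + 2 + (j * b + t)) \<and> U (j * b + t)) \<longrightarrow>
        (\<Sum>l<n - (a + b + 2 + a * b). of_bool (X (a + b + 2 + a * b + l)) * min (2 ^ l) (Suc (j - i))) \<le> j - i) \<and>
     (c \<longrightarrow> (\<forall>i<a. (\<Sum>t<b. of_bool (X (a + b + 2 + (i * b + t)))) \<le> (4 :: nat)) \<and>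
           (\<forall>t<b. (\<Sum>i<a. of_bool (X (a + b + 2 + (i * b + t)))) \<le> (4 :: nat)))"

text \<open>The pair is split by searching for the length \<open>n\<close> of its first component:
  the even positions carry 1 before \<open>2 * n\<close>, and the announcing 0 stands at
  \<open>2 * n\<close>. The guard \<open>i < n\<close> keeps the input bits from running into the
  witness.\<close>

definition verify :: "bool \<Rightarrow> bool list \<Rightarrow> bool" where
  "verify c z \<longleftrightarrow> (\<exists>n<length z. (\<forall>i<n. bitat z (2 * i)) \<and> \<not> bitat z (2 * n) \<and> 2 * n < length z \<and>
     (\<exists>a<n. \<exists>b<n. check c (\<lambda>i. i < n \<and> bitat z (2 * i + 1)) (\<lambda>i. bitat z (2 * n + 1 + i)) n a b))"

text \<open>All quantifiers and sums are bounded by numbers computable from the input, and powers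
  occur only with a cap, so the closure rules apply directly.\<close>

lemma verify_class_P: "{z. verify c z} \<in> class_P"
  unfolding verify_def check_def
  by (intro class_P_I pcomp_intros)

lemma length_pair_code: "length (pair_code x u) = 2 * length x + 1 + length u"
  by (induction x) (auto simp: pair_code_def)

lemma nth_pair_code:
  shows "i < length x \<Longrightarrow> pair_code x u ! (2 * i) = True"
    and "i < length x \<Longrightarrow> pair_code x u ! (2 * i + 1) = x ! i"
    and "pair_code x u ! (2 * length x) = False"
    and "pair_code x u ! (2 * length x + 1 + j) = u ! j"
proof -
  have "(i < length x \<longrightarrow> pair_code x u ! (2 * i) = True \<and> pair_code x u ! (2 * i + 1) = x ! i)
     \<and> pair_code x u ! (2 * length x) = False \<and> pair_code x u ! (2 * length x + 1 + j) = u ! j" for i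
    by (induction x arbitrary: i) (auto simp: pair_code_def nth_Cons split: nat.split)
  then show "i < length x \<Longrightarrow> pair_code x u ! (2 * i) = True"
    and "i < length x \<Longrightarrow> pair_code x u ! (2 * i + 1) = x ! i"
    and "pair_code x u ! (2 * length x) = False"
    and "pair_code x u ! (2 * length x + 1 + j) = u ! j" by blast+
qed

lemma verify_pair_code:
  "verify c (pair_code x u) \<longleftrightarrow> (\<exists>a<length x. \<exists>b<length x. check c (bitat x) (bitat u) (length x) a b)"
proof -
  let ?z = "pair_code x u"
  have 1: "(\<forall>i<n. bitat ?z (2 * i)) \<and> \<not> bitat ?z (2 * n) \<and> 2 * n < length ?z \<longleftrightarrow> n = length x" for n
  proof
    assume A: "(\<forall>i<n. bitat ?z (2 * i)) \<and> \<not> bitat ?z (2 * n) \<and> 2 * n < length ?z"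
    have "\<not> n < length x"
      using A nth_pair_code(1)[of n x u] by (auto simp: bitat_def)
    moreover have "\<not> length x < n"
      using A nth_pair_code(3)[of x u] by (auto simp: bitat_def)
    ultimately show "n = length x" by simp
  qed (auto simp: bitat_def nth_pair_code length_pair_code)
  have 2: "(\<lambda>i. i < length x \<and> bitat ?z (2 * i + 1)) = bitat x"
  proof
    fix i show "(i < length x \<and> bitat ?z (2 * i + 1)) = bitat x i"
      using nth_pair_code(2)[of i x u] by (cases "i < length x") (simp_all add: bitat_def length_pair_code)
  qed
  have 3: "(\<lambda>i. bitat ?z (2 * length x + 1 + i)) = bitat u"
  proof
    fix i show "bitat ?z (2 * length x + 1 + i) = bitat u i"
      using nth_pair_code(4)[of x u i] by (simp add: bitat_def length_pair_code)
  qed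
  have "verify c ?z \<longleftrightarrow> (\<exists>n<length ?z. n = length x \<and>
      (\<exists>a<n. \<exists>b<n. check c (\<lambda>i. i < n \<and> bitat ?z (2 * i + 1)) (\<lambda>i. bitat ?z (2 * n + 1 + i)) n a b))"
    unfolding verify_def 1[symmetric] by blast
  also have "\<dots> \<longleftrightarrow> (\<exists>a<length x. \<exists>b<length x. check c (\<lambda>i. i < length x \<and> bitat ?z (2 * i + 1))
      (\<lambda>i. bitat ?z (2 * length x + 1 + i)) (length x) a b)"
    by (simp add: length_pair_code)
  finally show ?thesis unfolding 2 3 .
qed

section \<open>Correctness of the verifier\<close>

lemma pair_index_less: "i < a \<Longrightarrow> t < b \<Longrightarrow> i * b + t < a * (b :: nat)"
proof -
  assume "i < a" "t < b"
  then have "i * b + t < Suc i * b" "Suc i * b \<le> a * b" by (simp, intro mult_le_mono1, simp)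
  then show ?thesis by (rule less_le_trans)
qed

lemma bitat_encode:
  assumes "k < length (encode I)"
  shows "bitat (encode I) k \<longleftrightarrow> encode_bit (nS I) (nT I) (\<lambda>i t. (i, t) \<in> edges I) (min_dist I) k"
  using nth_encode[OF assms] assms by (simp add: bitat_def)

lemma bitat_encode_edge:
  assumes "i < nS I" "t < nT I"
  shows "bitat (encode I) (nS I + nT I + 2 + (i * nT I + t)) \<longleftrightarrow> (i, t) \<in> edges I"
  using pair_index_less[OF assms] assms
  by (subst bitat_encode) (simp_all add: length_encode encode_bit_def)

lemma max_degree_le:
  assumes "valid_instance I"
  shows "max_degree I \<le> m \<longleftrightarrow>
    (\<forall>i<nS I. (\<Sum>t<nT I. of_bool ((i, t) \<in> edges I)) \<le> m) \<and>
    (\<forall>t<nT I. (\<Sum>i<nS I. of_bool ((i, t) \<in> edges I)) \<le> m)"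
proof -
  have "{..<nT I} \<inter> {t. (i, t) \<in> edges I} = {t. (i, t) \<in> edges I}" for i
    using assms by (auto simp: valid_instance_def)
  moreover have "{..<nS I} \<inter> {i. (i, t) \<in> edges I} = {i. (i, t) \<in> edges I}" for t
    using assms by (auto simp: valid_instance_def)
  ultimately show ?thesis
    unfolding max_degree_def degree_S_def degree_T_def by (auto simp: Ball_def)
qed

definition selected :: "dm_instance \<Rightarrow> bool list \<Rightarrow> (nat \<times> nat) set" where
  "selected I u = {(i, t). (i, t) \<in> edges I \<and> bitat u (i * nT I + t)}"

text \<open>A witness bit counts only at an edge, so every list \<open>u\<close> selects a set of
  edges, and the matching conditions of \<open>check\<close> are about this set.\<close>

lemma check_encode:
  assumes I: "valid_instance I"
  shows "check c (bitat (encode I)) (bitat u) (length (encode I)) (nS I) (nT I) \<longleftrightarrow>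
    perfect_distance_matching I (selected I u) \<and> (c \<longrightarrow> max_degree I \<le> 4)"
proof -
  let ?a = "nS I" and ?b = "nT I" and ?x = "encode I"
  let ?n = "length ?x" and ?d = "min_dist I" and ?M = "selected I u"
  have d: "?d \<noteq> 0" using I by (simp add: valid_instance_def)
  have E: "bitat ?x (?a + ?b + 2 + (i * ?b + t)) \<longleftrightarrow> (i, t) \<in> edges I" if "i < ?a" "t < ?b" for i t
    using bitat_encode_edge that by blast
  have M: "(i, t) \<in> ?M \<longleftrightarrow> (i, t) \<in> edges I \<and> bitat u (i * ?b + t)" for i t
    by (simp add: selected_def)
  have range: "i < ?a \<and> t < ?b" if "(i, t) \<in> edges I" for i t
    using that I by (auto simp: valid_instance_def)
  have len: "?n - (?a + ?b + 2 + ?a * ?b) = length (binary ?d)" by (simp add: length_encode)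
  have bits: "bitat ?x (?a + ?b + 2 + ?a * ?b + l) = binary ?d ! l" if "l < length (binary ?d)" for l
    using that by (subst bitat_encode) (simp_all add: length_encode encode_bit_def nth_binary)
  have dist: "(\<Sum>l<?n - (?a + ?b + 2 + ?a * ?b). of_bool (bitat ?x (?a + ?b + 2 + ?a * ?b + l)) * min (2 ^ l) (Suc k)) \<le> k
      \<longleftrightarrow> ?d \<le> k" for k
    unfolding sum_capped_powers_le len using bits bits_val_binary[of ?d]
    by (simp add: bits_val_def)
  have header: "(\<forall>i<?a. bitat ?x i) \<and> \<not> bitat ?x ?a \<and> (\<forall>i<?b. bitat ?x (?a + 1 + i)) \<and>
      \<not> bitat ?x (?a + 1 + ?b) \<and> ?a + ?b + 2 + ?a * ?b < ?n \<and> bitat ?x (?n - 1)"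
  proof -
    obtain m where m: "length (binary ?d) = Suc m" "binary ?d ! m"
      using binary_last[OF d] last_conv_nth[of "binary ?d"] by (cases "length (binary ?d)") auto
    have "?n - 1 = ?a + ?b + 2 + ?a * ?b + m" by (simp add: length_encode m(1))
    then have "bitat ?x (?n - 1)" using bits[of m] m by (simp only: lessI)
    moreover have "?a + ?b + 2 + ?a * ?b < ?n" by (simp add: length_encode m(1))
    ultimately show ?thesis by (auto simp: bitat_encode length_encode encode_bit_def)
  qed
  have perfect: "(\<forall>i<?a. \<exists>t<?b. ((i, t) \<in> ?M) \<and> (\<forall>t'<?b. (i, t') \<in> ?M \<longrightarrow> t' = t)) \<and>
      (\<forall>t<?b. \<forall>j<?a. \<forall>i<j. (i, t) \<in> ?M \<and> (j, t) \<in> ?M \<longrightarrow> ?d \<le> j - i) \<longleftrightarrow>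
      perfect_distance_matching I ?M" (is "?L1 \<and> ?L2 \<longleftrightarrow> ?R")
  proof
    assume L: "?L1 \<and> ?L2"
    have uniq: "t = t'" if "(i, t) \<in> ?M" "(i, t') \<in> ?M" for i t t'
    proof -
      have "i < ?a" "t < ?b" "t' < ?b" using range that M by blast+
      then show ?thesis using L that by metis
    qed
    have far: "int ?d \<le> \<bar>int j - int i\<bar>" if "(i, t) \<in> ?M" "(j, t) \<in> ?M" "i \<noteq> j" for i j t
    proof -
      have *: "i < ?a" "j < ?a" "t < ?b" using range that M by blast+
      show ?thesis
      proof (cases "i < j")
        case True
        then have "?d \<le> j - i" using L that * by blast
        then show ?thesis using True by simp
      next
        case False
        then have "j < i" using that by simp
        moreover from this have "?d \<le> i - j" using L that * by blast
        ultimately show ?thesis by simp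
      qed
    qed
    show ?R
      unfolding perfect_distance_matching_def distance_matching_def
    proof (intro conjI allI impI ballI)
      show "?M \<subseteq> edges I" by (auto simp: selected_def)
      show "t = t'" if "(i, t) \<in> ?M \<and> (i, t') \<in> ?M" for i t t' using uniq that by blast
      show "\<bar>int j - int i\<bar> \<ge> int ?d" if "(i, t) \<in> ?M \<and> (j, t) \<in> ?M \<and> i \<noteq> j" for i j t
        using far that by blast
      fix i assume "i \<in> {0..<?a}"
      then obtain t where "(i, t) \<in> ?M" using L by auto
      then show "\<exists>!t. (i, t) \<in> ?M" using uniq by blast
    qed
  next
    assume R: ?R
    show "?L1 \<and> ?L2"
    proof (intro conjI allI impI)
      fix i assume "i < ?a"
      then obtain t where t: "(i, t) \<in> ?M" "\<And>t'. (i, t') \<in> ?M \<Longrightarrow> t' = t"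
        using R unfolding perfect_distance_matching_def by (metis atLeastLessThan_iff le0)
      then show "\<exists>t<?b. ((i, t) \<in> ?M) \<and> (\<forall>t'<?b. (i, t') \<in> ?M \<longrightarrow> t' = t)"
        using range M by blast
    next
      fix t j i assume "i < j" "(i, t) \<in> ?M \<and> (j, t) \<in> ?M"
      then have "int ?d \<le> \<bar>int j - int i\<bar>"
        using R unfolding perfect_distance_matching_def distance_matching_def by (metis less_imp_neq)
      then show "?d \<le> j - i" using \<open>i < j\<close> by simp
    qed
  qed
  have deg: "(\<forall>i<?a. (\<Sum>t<?b. of_bool (bitat ?x (?a + ?b + 2 + (i * ?b + t)))) \<le> (4 :: nat)) \<and>
      (\<forall>t<?b. (\<Sum>i<?a. of_bool (bitat ?x (?a + ?b + 2 + (i * ?b + t)))) \<le> (4 :: nat)) \<longleftrightarrow> max_degree I \<le> 4"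
    unfolding max_degree_le[OF I] using E by simp
  have m1: "(\<forall>i<?a. \<exists>t<?b. (bitat ?x (?a + ?b + 2 + (i * ?b + t)) \<and> bitat u (i * ?b + t)) \<and>
        (\<forall>t'<?b. bitat ?x (?a + ?b + 2 + (i * ?b + t')) \<and> bitat u (i * ?b + t') \<longrightarrow> t' = t)) \<longleftrightarrow>
      (\<forall>i<?a. \<exists>t<?b. ((i, t) \<in> ?M) \<and> (\<forall>t'<?b. (i, t') \<in> ?M \<longrightarrow> t' = t))"
    unfolding M using E by (intro all_cong ex_cong) auto
  have m2: "(\<forall>t<?b. \<forall>j<?a. \<forall>i<j. (bitat ?x (?a + ?b + 2 + (i * ?b + t)) \<and> bitat u (i * ?b + t)) \<and>
        (bitat ?x (?a + ?b + 2 + (j * ?b + t)) \<and> bitat u (j * ?b + t)) \<longrightarrow> ?d \<le> j - i) \<longleftrightarrow>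
      (\<forall>t<?b. \<forall>j<?a. \<forall>i<j. (i, t) \<in> ?M \<and> (j, t) \<in> ?M \<longrightarrow> ?d \<le> j - i)"
    unfolding M using E by (intro all_cong) auto
  show ?thesis
    unfolding check_def dist deg m1 m2 perfect[symmetric] using header by blast
qed

text \<open>The conditions on the header and on the last bit reject malformed inputs. In particular
  the tail is nonempty and ends with 1, which makes it the representation of a positive
  distance.\<close>

lemma check_imp_encode:
  assumes "check c (bitat x) U (length x) a b"
  shows "\<exists>I. valid_instance I \<and> encode I = x \<and> nS I = a \<and> nT I = b"
proof -
  let ?n = "length x" and ?m = "a + b + 2 + a * b"
  define bs where "bs = drop ?m x"
  define I where "I = \<lparr>nS = a, nT = b, edges = {(i, t). i < a \<and> t < b \<and> bitat x (a + b + 2 + (i * b + t))},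
    min_dist = bits_val bs\<rparr>"
  have m: "?m < ?n" and l: "bitat x (?n - 1)" and h: "\<forall>i<a. bitat x i" "\<not> bitat x a"
    "\<forall>i<b. bitat x (a + 1 + i)" "\<not> bitat x (a + 1 + b)"
    using assms unfolding check_def by blast+
  have bs: "bs \<noteq> []" "last bs" "length bs = ?n - ?m"
  proof -
    have "x \<noteq> []" using m by auto
    moreover have "last bs = last x" using m by (simp add: bs_def)
    ultimately show "last bs" using l last_conv_nth[of x] by (simp add: bitat_def)
  qed (use m in \<open>auto simp: bs_def\<close>)
  have bin: "binary (bits_val bs) = bs" using binary_bits_val bs by blast
  have "encode I = x"
  proof (rule nth_equalityI)
    show len: "length (encode I) = ?n"
      using m bs(3) bin by (simp add: length_encode I_def)
    fix k assume k: "k < length (encode I)"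
    have "bitat x k \<longleftrightarrow> encode_bit (nS I) (nT I) (\<lambda>i t. (i, t) \<in> edges I) (min_dist I) k"
    proof -
      consider "k < a" | "k = a" | "a < k" "k < a + 1 + b" | "k = a + 1 + b"
        | "a + b + 2 \<le> k" "k < ?m" | "?m \<le> k" by linarith
      then show ?thesis
      proof cases
        case 3
        then have "bitat x k" using h(3) le_Suc_ex[of "a + 1" k] by force
        then show ?thesis using 3 by (simp add: encode_bit_def I_def)
      next
        case 5
        define j where "j = k - (a + b + 2)"
        have j: "j < a * b" "k = a + b + 2 + j" using 5 by (auto simp: j_def)
        then have "b \<noteq> 0" by (cases "b = 0") auto
        then have "j div b < a" "j mod b < b" using j by (auto simp: less_mult_imp_div_less)
        then show ?thesis using j by (simp add: encode_bit_def I_def)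
      next
        case 6
        define j where "j = k - ?m"
        have j: "k = ?m + j" using 6 by (simp add: j_def)
        then have "j < length bs" using k len bs(3) by simp
        then have "odd (bits_val bs div 2 ^ j) = bs ! j" using nth_binary[of j "bits_val bs"] bin by simp
        then show ?thesis using j k len by (simp add: encode_bit_def I_def bs_def bitat_def)
      qed (use h in \<open>auto simp: encode_bit_def I_def\<close>)
    qed
    then show "encode I ! k = x ! k" using nth_encode[OF k] k len by (simp add: bitat_def)
  qed
  moreover have "valid_instance I"
    using bits_val_pos[OF bs(1,2)] by (auto simp: valid_instance_def I_def)
  ultimately show ?thesis by (intro exI[of _ I]) (simp add: I_def)
qed

text \<open>The flag \<open>c\<close> switches the degree bound on, so that both languages of the
  theorem are treated at once.\<close>

definition matching_language :: "bool \<Rightarrow> language" where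
  "matching_language c = {encode I | I. valid_instance I \<and> (c \<longrightarrow> max_degree I \<le> 4) \<and>
     (\<exists>M. perfect_distance_matching I M)}"

lemma matching_language_NP: "matching_language c \<in> class_NP"
proof -
  have "x \<in> matching_language c \<longleftrightarrow> (\<exists>u. length u \<le> length x \<and> verify c (pair_code x u))" for x
  proof
    assume "x \<in> matching_language c"
    then obtain I M where I: "x = encode I" "valid_instance I" "c \<longrightarrow> max_degree I \<le> 4"
      and M: "perfect_distance_matching I M"
      unfolding matching_language_def by blast
    let ?a = "nS I" and ?b = "nT I"
    \<comment> \<open>The witness is the characteristic matrix of \<open>M\<close>. It is no longer
      than the input, which contains a matrix of the same size.\<close>
    define u where "u = map (\<lambda>j. (j div ?b, j mod ?b) \<in> M) [0..<?a * ?b]"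
    have sub: "M \<subseteq> edges I" "edges I \<subseteq> {0..<?a} \<times> {0..<?b}"
      using M I(2) by (auto simp: perfect_distance_matching_def distance_matching_def valid_instance_def)
    have u: "bitat u (i * ?b + t) \<longleftrightarrow> (i, t) \<in> M" if "i < ?a" "t < ?b" for i t
      using that pair_index_less[OF that] by (simp add: bitat_def u_def)
    have "selected I u = M"
    proof -
      have "(i, t) \<in> selected I u \<longleftrightarrow> (i, t) \<in> M" for i t
        using u[of i t] sub by (auto simp: selected_def)
      then show ?thesis by auto
    qed
    then have "check c (bitat x) (bitat u) (length x) ?a ?b"
      using I M check_encode[OF I(2), of c u] by simp
    moreover have "length u \<le> length x" "?a < length x" "?b < length x"
      using I by (auto simp: u_def length_encode)
    ultimately show "\<exists>u. length u \<le> length x \<and> verify c (pair_code x u)"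
      unfolding verify_pair_code by blast
  next
    assume "\<exists>u. length u \<le> length x \<and> verify c (pair_code x u)"
    then obtain u a b where C: "check c (bitat x) (bitat u) (length x) a b"
      unfolding verify_pair_code by blast
    obtain I where I: "valid_instance I" "encode I = x" "nS I = a" "nT I = b"
      using check_imp_encode[OF C] by blast
    show "x \<in> matching_language c"
      unfolding matching_language_def using C check_encode[OF I(1), of c u] I by blast
  qed
  then show ?thesis
    unfolding class_NP_def using verify_class_P[of c]
    by (intro CollectI bexI[of _ "{z. verify c z}"] exI[of _ "[:0, 1:]"]) simp_all
qed

section \<open>From clauses with four literals to distance matchings\<close>

text \<open>Literals are numbers below \<open>2 * n\<close>, the even ones are positive. A set of clauses is given as
  a predicate on quadruples of literals.\<close>

definition lit_true :: "(nat \<Rightarrow> bool) \<Rightarrow> nat \<Rightarrow> bool" where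
  "lit_true v l \<longleftrightarrow> (if even l then v (l div 2) else \<not> v (l div 2))"

definition satisfiable :: "nat \<Rightarrow> (nat \<Rightarrow> nat \<Rightarrow> nat \<Rightarrow> nat \<Rightarrow> bool) \<Rightarrow> bool" where
  "satisfiable n cl \<longleftrightarrow> (\<exists>v. \<forall>a<2 * n. \<forall>b<2 * n. \<forall>c<2 * n. \<forall>d<2 * n. cl a b c d \<longrightarrow>
     lit_true v a \<or> lit_true v b \<or> lit_true v c \<or> lit_true v d)"

text \<open>The digits in base \<open>2 * n\<close> number all quadruples of literals. Block
  \<open>n + i\<close> is responsible for the quadruple coded by \<open>i\<close>, whether or not it
  is a clause, so no list of the clauses has to be computed.\<close>

definition digit :: "nat \<Rightarrow> nat \<Rightarrow> nat \<Rightarrow> nat" where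
  "digit n j i = i div (2 * n) ^ j mod (2 * n)"

definition active :: "nat \<Rightarrow> (nat \<Rightarrow> nat \<Rightarrow> nat \<Rightarrow> nat \<Rightarrow> bool) \<Rightarrow> nat \<Rightarrow> bool" where
  "active n cl k \<longleftrightarrow> n \<le> k \<and>
     cl (digit n 0 (k - n)) (digit n 1 (k - n)) (digit n 2 (k - n)) (digit n 3 (k - n))"

text \<open>
  The nodes of \<open>S\<close> come in blocks of \<open>2 * n + 2\<close>. Offset 0 of a block is a clause node, offset
  \<open>l + 1\<close> belongs to the literal \<open>l\<close>, and the last offset is a variable node. The literal node
  \<open>l\<close> of block \<open>k\<close> takes token \<open>(k, l)\<close> or pushes on to token \<open>(k + 1, l)\<close>. Since the
  distance is the block length plus one, pushing propagates to all later blocks, a clause node of block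
  \<open>k\<close> can take token \<open>(k + 1, l)\<close> only if \<open>l\<close> is not pushed in block \<open>k\<close>, and a
  variable node that takes token \<open>(k, l)\<close> forces \<open>l\<close> to be pushed in block \<open>k\<close>. The
  literals that are never pushed are the true ones.
\<close>

definition adjacent :: "nat \<Rightarrow> (nat \<Rightarrow> nat \<Rightarrow> nat \<Rightarrow> nat \<Rightarrow> bool) \<Rightarrow> nat \<Rightarrow> nat \<Rightarrow> bool" where
  "adjacent n cl p q \<longleftrightarrow>
     (if p mod (2 * n + 2) = 0 then
        (if active n cl (p div (2 * n + 2)) then
           q = p + (2 * n + 2) + Suc (digit n 0 (p div (2 * n + 2) - n)) \<or>
           q = p + (2 * n + 2) + Suc (digit n 1 (p div (2 * n + 2) - n)) \<or>
           q = p + (2 * n + 2) + Suc (digit n 2 (p div (2 * n + 2) - n)) \<or>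
           q = p + (2 * n + 2) + Suc (digit n 3 (p div (2 * n + 2) - n))
         else q = p)
      else if p mod (2 * n + 2) = 2 * n + 1 then
        (if p div (2 * n + 2) < n then
           q = p div (2 * n + 2) * (2 * n + 2) + Suc (2 * (p div (2 * n + 2))) \<or>
           q = p div (2 * n + 2) * (2 * n + 2) + Suc (Suc (2 * (p div (2 * n + 2))))
         else q = p)
      else q = p \<or> q = p + (2 * n + 2))"

text \<open>One block for each variable and one for each quadruple of literals. The variables come
  first: pushing only spreads to later blocks and has to reach every clause node.\<close>

definition block_count :: "nat \<Rightarrow> nat" where
  "block_count n = n + (2 * n) ^ 4"

text \<open>With distance \<open>2 * n + 3\<close>, equal offsets in consecutive blocks conflict,
  but an offset and a greater one in the next block do not. \<open>T\<close> has one block more than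
  \<open>S\<close>, which takes up the tokens pushed out of the last block.\<close>

definition matching_instance :: "nat \<Rightarrow> (nat \<Rightarrow> nat \<Rightarrow> nat \<Rightarrow> nat \<Rightarrow> bool) \<Rightarrow> dm_instance" where
  "matching_instance n cl =
     \<lparr>nS = block_count n * (2 * n + 2), nT = (block_count n + 1) * (2 * n + 2),
      edges = {(p, q). p < block_count n * (2 * n + 2) \<and> q < (block_count n + 1) * (2 * n + 2) \<and> adjacent n cl p q},
      min_dist = 2 * n + 3\<rparr>"

section \<open>Neighbours and degrees in the constructed graph\<close>

lemma digit_less: "0 < n \<Longrightarrow> digit n j i < 2 * n"
  by (simp add: digit_def)

lemma block_div: "r < b \<Longrightarrow> (k * b + r) div b = (k :: nat)"
  by simp

lemma block_mod: "r < b \<Longrightarrow> (k * b + r) mod b = (r :: nat)"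
  by simp

lemma ex_less_4: "(\<exists>j<4. P j) \<longleftrightarrow> P 0 \<or> P 1 \<or> P 2 \<or> P (3 :: nat)"
  by (auto simp: less_Suc_eq numeral_eq_Suc)

lemma adjacent_clause:
  "adjacent n cl (k * (2 * n + 2)) q \<longleftrightarrow>
     (if active n cl k then \<exists>j<4. q = Suc k * (2 * n + 2) + Suc (digit n j (k - n)) else q = k * (2 * n + 2))"
proof -
  have "k * (2 * n + 2) div (2 * n + 2) = k" "k * (2 * n + 2) mod (2 * n + 2) = 0"
    using block_div[of 0 "2 * n + 2" k] block_mod[of 0 "2 * n + 2" k] by simp_all
  moreover have "k * (2 * n + 2) + (2 * n + 2) = Suc k * (2 * n + 2)" by simp
  ultimately show ?thesis
    unfolding adjacent_def ex_less_4 by (simp only: if_True simp_thms)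
qed

lemma adjacent_variable:
  "adjacent n cl (k * (2 * n + 2) + (2 * n + 1)) q \<longleftrightarrow>
     (if k < n then q = k * (2 * n + 2) + Suc (2 * k) \<or> q = k * (2 * n + 2) + Suc (Suc (2 * k))
      else q = k * (2 * n + 2) + (2 * n + 1))"
proof -
  have "(k * (2 * n + 2) + (2 * n + 1)) div (2 * n + 2) = k"
    "(k * (2 * n + 2) + (2 * n + 1)) mod (2 * n + 2) = 2 * n + 1"
    by (intro block_div block_mod; simp)+
  moreover have "2 * n + 1 \<noteq> 0" by simp
  ultimately show ?thesis unfolding adjacent_def by (simp only: if_False simp_thms if_True)
qed

lemma adjacent_literal:
  assumes "l < 2 * n"
  shows "adjacent n cl (k * (2 * n + 2) + Suc l) q \<longleftrightarrow>
     q = k * (2 * n + 2) + Suc l \<or> q = Suc k * (2 * n + 2) + Suc l"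
proof -
  have "(k * (2 * n + 2) + Suc l) div (2 * n + 2) = k"
    "(k * (2 * n + 2) + Suc l) mod (2 * n + 2) = Suc l"
    using assms by (intro block_div block_mod; simp)+
  moreover have "k * (2 * n + 2) + Suc l + (2 * n + 2) = Suc k * (2 * n + 2) + Suc l" by simp
  moreover have "Suc l \<noteq> 0" "Suc l \<noteq> 2 * n + 1" using assms by auto
  ultimately show ?thesis unfolding adjacent_def by (simp only: if_False)
qed

lemma block_cases:
  obtains (clause) k where "p = k * (2 * n + 2)"
  | (literal) k l where "l < 2 * n" "p = k * (2 * n + 2) + Suc l"
  | (var_node) k where "p = k * (2 * n + 2) + (2 * n + 1)"
proof -
  define k r where "k = p div (2 * n + 2)" and "r = p mod (2 * n + 2)"
  have p: "p = k * (2 * n + 2) + r" unfolding k_def r_def by (rule div_mult_mod_eq[symmetric])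
  have "r < 2 * n + 2" by (simp add: r_def)
  then consider "r = 0" | "r = 2 * n + 1" | "r \<noteq> 0" "r - 1 < 2 * n" by linarith
  then show thesis
  proof cases
    case 3
    then show thesis using that(2)[of "r - 1" k] p by simp
  qed (use p that(1,3) in auto)
qed

lemma matching_instance_valid: "valid_instance (matching_instance n cl)"
  by (auto simp: valid_instance_def matching_instance_def)

lemma edges_matching_instance:
  "(p, q) \<in> edges (matching_instance n cl) \<longleftrightarrow>
     p < block_count n * (2 * n + 2) \<and> q < (block_count n + 1) * (2 * n + 2) \<and> adjacent n cl p q"
  by (simp add: matching_instance_def)

lemma card_insert_le4: "S \<subseteq> {a, b, c, d} \<Longrightarrow> card S \<le> 4"
proof -
  assume "S \<subseteq> {a, b, c, d}"
  then have "card S \<le> card (set [a, b, c, d])" by (intro card_mono) auto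
  also have "\<dots> \<le> length [a, b, c, d]" by (rule card_length)
  finally show ?thesis by simp
qed

lemma adjacent_targets: "\<exists>a b c d. \<forall>q. adjacent n cl p q \<longrightarrow> q \<in> {a, b, c, d}"
proof (cases p rule: block_cases[of _ n])
  case (clause k)
  show ?thesis
  proof (cases "active n cl k")
    case True
    then show ?thesis unfolding clause adjacent_clause ex_less_4 by (simp only: if_True) blast
  next
    case False
    then show ?thesis unfolding clause adjacent_clause by (simp only: if_False) blast
  qed
next
  case (literal k l)
  show ?thesis unfolding literal(2) adjacent_literal[OF literal(1)] by blast
next
  case (var_node k)
  show ?thesis unfolding var_node adjacent_variable by (cases "k < n") (simp only: if_True if_False, blast)+
qed

text \<open>The candidates are the node with the number of the token, the literal node one block
  earlier, the clause node one block earlier and the variable node of the same block. Truncated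
  subtraction at the first block can only add candidates.\<close>

lemma adjacent_sources:
  assumes "0 < n" "adjacent n cl p q"
  shows "p \<in> {q, q - (2 * n + 2), (q div (2 * n + 2) - 1) * (2 * n + 2), q div (2 * n + 2) * (2 * n + 2) + (2 * n + 1)}"
proof (cases p rule: block_cases[of _ n])
  case (clause k)
  show ?thesis
  proof (cases "active n cl k")
    case True
    then obtain j where q: "q = Suc k * (2 * n + 2) + Suc (digit n j (k - n))"
      using assms(2) unfolding clause adjacent_clause by auto
    have "q div (2 * n + 2) = Suc k"
      using digit_less[OF assms(1), of j "k - n"] unfolding q by (intro block_div) simp
    then show ?thesis using clause by simp
  next
    case False
    then show ?thesis using assms(2) unfolding clause adjacent_clause by simp
  qed
next
  case (literal k l)
  then show ?thesis using assms(2) unfolding literal(2) adjacent_literal[OF literal(1)] by auto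
next
  case (var_node k)
  show ?thesis
  proof (cases "k < n")
    case True
    then obtain r where q: "q = k * (2 * n + 2) + r" "r < 2 * n + 2"
      using assms(2) unfolding var_node adjacent_variable by auto
    have "q div (2 * n + 2) = k" unfolding q(1) by (rule block_div[OF q(2)])
    then show ?thesis using var_node by simp
  next
    case False
    then show ?thesis using assms(2) unfolding var_node adjacent_variable by simp
  qed
qed

lemma matching_instance_degree:
  assumes "0 < n"
  shows "max_degree (matching_instance n cl) \<le> 4"
proof -
  have "degree_S (matching_instance n cl) p \<le> 4" for p
  proof -
    obtain a b c d where "\<forall>q. adjacent n cl p q \<longrightarrow> q \<in> {a, b, c, d}" using adjacent_targets by blast
    then show ?thesis
      unfolding degree_S_def edges_matching_instance by (intro card_insert_le4[of _ a b c d]) blast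
  qed
  moreover have "degree_T (matching_instance n cl) q \<le> 4" for q
    unfolding degree_T_def edges_matching_instance
    using adjacent_sources[OF assms] by (intro card_insert_le4) blast
  ultimately show ?thesis by (auto simp: max_degree_def)
qed

text \<open>The variable node of block \<open>j\<close> decides variable \<open>j\<close>: it takes
  the token of one of the two literals, which is thereby pushed from block \<open>j\<close> on and
  counts as false. No clause node in a later block can use a pushed literal, so it has found a true
  one.\<close>

lemma matching_imp_satisfiable:
  assumes n: "0 < n" and M: "perfect_distance_matching (matching_instance n cl) M"
  shows "satisfiable n cl"
proof -
  let ?b = "2 * n + 2" and ?N = "block_count n"
  have sub: "M \<subseteq> edges (matching_instance n cl)"
    and far: "\<And>p p' q. (p, q) \<in> M \<Longrightarrow> (p', q) \<in> M \<Longrightarrow> p < p' \<Longrightarrow> p + 2 * n + 3 \<le> p'"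
  proof -
    show "M \<subseteq> edges (matching_instance n cl)"
      using M by (simp add: perfect_distance_matching_def distance_matching_def)
    have *: "\<bar>int j - int i\<bar> \<ge> int (min_dist (matching_instance n cl))"
      if "(i, t) \<in> M" "(j, t) \<in> M" "i \<noteq> j" for i j t
      using M that unfolding perfect_distance_matching_def distance_matching_def by blast
    fix p p' q assume "(p, q) \<in> M" "(p', q) \<in> M" "p < p'"
    then show "p + 2 * n + 3 \<le> p'" using *[of p q p'] by (simp add: matching_instance_def)
  qed
  have "\<exists>q. (p, q) \<in> M" if "p < ?N * ?b" for p
    using M that unfolding perfect_distance_matching_def matching_instance_def by auto
  then obtain m where m: "\<And>p. p < ?N * ?b \<Longrightarrow> (p, m p) \<in> M" by metis
  then have adj: "adjacent n cl p (m p)" if "p < ?N * ?b" for p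
    using sub that edges_matching_instance by blast
  define pushed where "pushed l k \<longleftrightarrow> m (k * ?b + Suc l) = Suc k * ?b + Suc l" for l k
  \<comment> \<open>Otherwise two nodes of the same literal in consecutive blocks would share a
    token although they are only \<open>2 * n + 2\<close> apart.\<close>
  have step: "pushed l (Suc k)" if "pushed l k" "l < 2 * n" "Suc k < ?N" for l k
  proof (rule ccontr)
    have p: "k * ?b + Suc l < ?N * ?b" "Suc k * ?b + Suc l < ?N * ?b"
      using that by (intro pair_index_less; simp)+
    assume "\<not> pushed l (Suc k)"
    then have "m (Suc k * ?b + Suc l) = Suc k * ?b + Suc l"
      using adj[OF p(2)] that(2) by (simp only: adjacent_literal pushed_def) blast
    then have "m (Suc k * ?b + Suc l) = m (k * ?b + Suc l)"
      using that(1) by (simp only: pushed_def)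
    then show False
      using far[of "k * ?b + Suc l" "m (k * ?b + Suc l)" "Suc k * ?b + Suc l"] m[OF p(1)] m[OF p(2)] by simp
  qed
  have pushed_mono: "pushed l k'" if "pushed l k" "l < 2 * n" "k \<le> k'" "k' < ?N" for l k k'
    using that(3,4)
  proof (induction k' rule: dec_induct)
    case (step j)
    then show ?case using \<open>\<And>l k. pushed l k \<Longrightarrow> l < 2 * n \<Longrightarrow> Suc k < ?N \<Longrightarrow> pushed l (Suc k)\<close> that(2) by simp
  qed (rule that(1))
  \<comment> \<open>Offsets are literals plus one, so this is the token of the negative literal
    \<open>Suc (2 * j)\<close>: if that literal is pushed, the variable is true.\<close>
  define v where "v j \<longleftrightarrow> m (j * ?b + (2 * n + 1)) = j * ?b + Suc (Suc (2 * j))" for j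
  have nN: "n \<le> ?N" by (simp add: block_count_def)
  have var: "pushed l j" if "j < n" "m (j * ?b + (2 * n + 1)) = j * ?b + Suc l" "l < 2 * n" for j l
  proof (rule ccontr)
    have p: "j * ?b + Suc l < ?N * ?b" "j * ?b + (2 * n + 1) < ?N * ?b"
      using that nN by (intro pair_index_less; simp)+
    assume "\<not> pushed l j"
    then have "m (j * ?b + Suc l) = j * ?b + Suc l"
      using adj[OF p(1)] that(3) by (simp only: adjacent_literal pushed_def) blast
    then have "m (j * ?b + (2 * n + 1)) = m (j * ?b + Suc l)"
      using that(2) by (simp only:)
    then show False
      using far[of "j * ?b + Suc l" "m (j * ?b + Suc l)" "j * ?b + (2 * n + 1)"] m[OF p(1)] m[OF p(2)] that(3)
      by simp
  qed
  have false_pushed: "pushed l (l div 2)" if "l < 2 * n" "\<not> lit_true v l" for l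
  proof -
    define j where "j = l div 2"
    have j: "j < n" using that by (auto simp: j_def)
    have p: "j * ?b + (2 * n + 1) < ?N * ?b"
      using j nN by (intro pair_index_less; simp)
    have "m (j * ?b + (2 * n + 1)) = j * ?b + Suc (2 * j) \<or> m (j * ?b + (2 * n + 1)) = j * ?b + Suc (Suc (2 * j))"
      using adj[OF p] j by (simp only: adjacent_variable if_True)
    moreover have "even l \<Longrightarrow> l = 2 * j" "odd l \<Longrightarrow> l = Suc (2 * j)" by (auto simp: j_def)
    ultimately have "m (j * ?b + (2 * n + 1)) = j * ?b + Suc l"
      using that(2) unfolding lit_true_def v_def by (cases "even l") (auto simp flip: j_def)
    from var[OF j this that(1)] show ?thesis by (simp only: j_def)
  qed
  show ?thesis
    unfolding satisfiable_def
  proof (intro exI[of _ v] allI impI)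
    fix a b c d assume L: "a < 2 * n" "b < 2 * n" "c < 2 * n" "d < 2 * n" and cl: "cl a b c d"
    \<comment> \<open>The digits of \<open>i\<close> are the four literals from the lowest place on,
      so the clause node of block \<open>n + i\<close> represents this clause.\<close>
    define i where "i = ((d * (2 * n) + c) * (2 * n) + b) * (2 * n) + a"
    have dig: "digit n 0 i = a" "digit n 1 i = b" "digit n 2 i = c" "digit n 3 i = d"
    proof -
      have "i div (2 * n) = (d * (2 * n) + c) * (2 * n) + b" unfolding i_def using L by (intro block_div)
      moreover have "((d * (2 * n) + c) * (2 * n) + b) div (2 * n) = d * (2 * n) + c" using L by (intro block_div)
      moreover have "(d * (2 * n) + c) div (2 * n) = d" using L by (intro block_div)
      ultimately show "digit n 0 i = a" "digit n 1 i = b" "digit n 2 i = c" "digit n 3 i = d"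
        using L unfolding digit_def
        by (simp_all only: power_0 power_one_right power2_eq_square power3_eq_cube div_mult2_eq div_by_1)
          (simp_all add: i_def block_mod)
    qed
    have "i < 2 * n * (2 * n) * (2 * n) * (2 * n)"
      unfolding i_def using L by (intro pair_index_less)
    then have i: "n + i < ?N" by (simp add: block_count_def power4_eq_xxxx)
    have act: "active n cl (n + i)" using cl dig by (simp add: active_def)
    have p: "(n + i) * ?b < ?N * ?b" using pair_index_less[OF i, of 0 ?b] by simp
    obtain j where j: "j < 4" "m ((n + i) * ?b) = Suc (n + i) * ?b + Suc (digit n j i)"
      using adj[OF p] act unfolding adjacent_clause by auto
    define l where "l = digit n j i"
    have l: "l < 2 * n" using digit_less[OF n] by (simp add: l_def)
    have "lit_true v l"
    proof (rule ccontr)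
      assume "\<not> lit_true v l"
      then have "pushed l (l div 2)" using false_pushed l by blast
      then have "pushed l (n + i)" using pushed_mono[of l "l div 2" "n + i"] l i by auto
      then have eq: "m ((n + i) * ?b) = m ((n + i) * ?b + Suc l)" using j(2) by (simp only: pushed_def l_def)
      have p': "(n + i) * ?b + Suc l < ?N * ?b" using i l by (intro pair_index_less) auto
      \<comment> \<open>The clause node precedes the literal node of its own block by only
        \<open>Suc l\<close> places.\<close>
      show False
        using far[of "(n + i) * ?b" "m ((n + i) * ?b)" "(n + i) * ?b + Suc l"] m[OF p] m[OF p'] eq l by simp
    qed
    moreover have "l = a \<or> l = b \<or> l = c \<or> l = d"
      using j(1) dig unfolding l_def by (auto simp: less_Suc_eq numeral_eq_Suc)
    ultimately show "lit_true v a \<or> lit_true v b \<or> lit_true v c \<or> lit_true v d" by blast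
  qed
qed

text \<open>If \<open>v\<close> satisfies all clauses, the literal nodes of the false literals push everywhere.\<close>

lemma satisfiable_imp_matching:
  assumes n: "0 < n" and sat: "satisfiable n cl"
  shows "\<exists>M. perfect_distance_matching (matching_instance n cl) M"
proof -
  let ?b = "2 * n + 2" and ?N = "block_count n"
  obtain v where v: "\<And>a b c d. a < 2 * n \<Longrightarrow> b < 2 * n \<Longrightarrow> c < 2 * n \<Longrightarrow> d < 2 * n \<Longrightarrow> cl a b c d \<Longrightarrow>
      lit_true v a \<or> lit_true v b \<or> lit_true v c \<or> lit_true v d"
    using sat unfolding satisfiable_def by blast
  \<comment> \<open>The node at offset \<open>r\<close> of block \<open>k\<close> takes the token at
    offset \<open>r'\<close> of block \<open>k'\<close>. Idle nodes keep their own token, clause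
    nodes take a true literal of the next block, variable nodes a false one of their own block; true
    literals stay and false ones push.\<close>
  define good where "good k r k' r' \<longleftrightarrow>
      r = 0 \<and> r' = 0 \<and> k' = k \<or>
      r = 0 \<and> r' \<noteq> 0 \<and> r' < 2 * n + 1 \<and> lit_true v (r' - 1) \<and> k' = Suc k \<or>
      r = 2 * n + 1 \<and> r' = 2 * n + 1 \<and> k' = k \<or>
      r = 2 * n + 1 \<and> r' \<noteq> 0 \<and> r' < 2 * n + 1 \<and> \<not> lit_true v (r' - 1) \<and> k' = k \<or>
      r \<noteq> 0 \<and> r < 2 * n + 1 \<and> r' = r \<and> lit_true v (r' - 1) \<and> k' = k \<or>
      r \<noteq> 0 \<and> r < 2 * n + 1 \<and> r' = r \<and> \<not> lit_true v (r' - 1) \<and> k' = Suc k" for k r k' r'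
  have ex: "\<exists>k r k' r'. p = k * ?b + r \<and> r < ?b \<and> r' < ?b \<and> adjacent n cl p (k' * ?b + r') \<and> good k r k' r'" for p
  proof (cases p rule: block_cases[of _ n])
    case (clause k)
    show ?thesis
    proof (cases "active n cl k")
      case True
      have "\<exists>j<4. lit_true v (digit n j (k - n))"
        using v[OF digit_less digit_less digit_less digit_less] n True unfolding active_def ex_less_4 by blast
      then obtain j where "j < 4" "lit_true v (digit n j (k - n))" by blast
      then have "adjacent n cl p (Suc k * ?b + Suc (digit n j (k - n)))" "good k 0 (Suc k) (Suc (digit n j (k - n)))"
        using True digit_less[OF n, of j "k - n"] unfolding clause adjacent_clause by (auto simp: good_def)
      then show ?thesis
        using clause digit_less[OF n, of j "k - n"]
        by (intro exI[of _ k] exI[of _ 0] exI[of _ "Suc k"] exI[of _ "Suc (digit n j (k - n))"]) simp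
    next
      case False
      then show ?thesis unfolding clause adjacent_clause
        by (intro exI[of _ k] exI[of _ 0]) (simp add: good_def)
    qed
  next
    case (literal k l)
    show ?thesis unfolding literal(2) adjacent_literal[OF literal(1)] using literal(1)
      by (intro exI[of _ k] exI[of _ "Suc l"] exI[of _ "if lit_true v l then k else Suc k"]) (simp add: good_def)
  next
    case (var_node k)
    show ?thesis
    proof (cases "k < n")
      case True
      let ?l = "if v k then Suc (2 * k) else 2 * k"
      have "\<not> lit_true v ?l" "?l < 2 * n" using True by (auto simp: lit_true_def)
      then show ?thesis unfolding var_node adjacent_variable using True
        by (intro exI[of _ k] exI[of _ "2 * n + 1"] exI[of _ "Suc ?l"]) (simp add: good_def)
    next
      case False
      then show ?thesis unfolding var_node adjacent_variable
        by (intro exI[of _ k] exI[of _ "2 * n + 1"]) (simp add: good_def)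
    qed
  qed
  then obtain K R K' R' where KR: "\<And>p. p = K p * ?b + R p" "\<And>p. R p < ?b" "\<And>p. R' p < ?b"
    "\<And>p. adjacent n cl p (K' p * ?b + R' p)" "\<And>p. good (K p) (R p) (K' p) (R' p)"
    by metis
  define M where "M = {(p, q). p < ?N * ?b \<and> q = K' p * ?b + R' p}"
  have sub: "M \<subseteq> edges (matching_instance n cl)"
  proof
    fix e assume "e \<in> M"
    then obtain p where e: "e = (p, K' p * ?b + R' p)" "p < ?N * ?b" by (auto simp: M_def)
    have "K p * ?b \<le> p" using KR(1)[of p] by linarith
    then have "K p * ?b < ?N * ?b" using e(2) by linarith
    then have "K p < ?N" by (rule mult_less_cancel2[THEN iffD1, THEN conjunct2])
    moreover have "K' p \<le> Suc (K p)" using KR(5)[of p] by (auto simp: good_def)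
    ultimately have "K' p * ?b + R' p < (?N + 1) * ?b" using KR(3)[of p] by (intro pair_index_less) auto
    then show "e \<in> edges (matching_instance n cl)"
      unfolding e(1) edges_matching_instance using e(2) KR(4) by blast
  qed
  \<comment> \<open>Users of one token turn out to lie in consecutive blocks, the later one at the
    greater offset. They are therefore at least one block length plus one apart.\<close>
  have far: "p + 2 * n + 3 \<le> p'"
    if "K' p * ?b + R' p = K' p' * ?b + R' p'" "p < p'" for p p'
  proof -
    have eq: "K' p = K' p'" "R' p = R' p'"
      using arg_cong[OF that(1), of "\<lambda>q. q div ?b"] arg_cong[OF that(1), of "\<lambda>q. q mod ?b"]
      by (simp_all only: block_div[OF KR(3)] block_mod[OF KR(3)])
    have "K p < K p' \<or> K p = K p' \<and> R p < R p'"
    proof (rule ccontr)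
      assume "\<not> ?thesis"
      then consider "K p' < K p" | "K p = K p'" "R p' \<le> R p" by linarith
      then have "p' \<le> p"
      proof cases
        case 1
        then have "Suc (K p') * ?b \<le> K p * ?b" by (intro mult_le_mono1) simp
        then show ?thesis using KR(1)[of p] KR(1)[of p'] KR(2)[of p'] by (simp only: mult_Suc)
      next
        case 2
        then show ?thesis using KR(1)[of p] KR(1)[of p'] by simp
      qed
      then show False using that(2) by simp
    qed
    \<comment> \<open>The token of a true literal is taken by its own literal node and possibly by
      the clause node of the block before, at offset 0. The token of a false literal is taken by the
      literal node of the block before and possibly by the variable node at the last offset.\<close>
    then have cases: "K p' = Suc (K p) \<and> R p < R p'"
      using KR(5)[of p] KR(5)[of p'] unfolding eq good_def by (elim disjE conjE) auto
    then have "p' = K p * ?b + ?b + R p'" using KR(1)[of p'] by (simp only: mult_Suc)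
    then show ?thesis using KR(1)[of p] cases by linarith
  qed
  have "perfect_distance_matching (matching_instance n cl) M"
    unfolding perfect_distance_matching_def distance_matching_def
  proof (intro conjI allI impI ballI sub)
    fix i t t' assume "(i, t) \<in> M \<and> (i, t') \<in> M" then show "t = t'" by (simp add: M_def)
  next
    fix i j t assume A: "(i, t) \<in> M \<and> (j, t) \<in> M \<and> i \<noteq> j"
    then have "K' i * ?b + R' i = K' j * ?b + R' j" by (auto simp only: M_def mem_Collect_eq prod.case)
    then have "i < j \<Longrightarrow> i + 2 * n + 3 \<le> j" "j < i \<Longrightarrow> j + 2 * n + 3 \<le> i" using far[of i j] far[of j i] by auto
    moreover have "min_dist (matching_instance n cl) = 2 * n + 3" by (simp add: matching_instance_def)
    ultimately show "\<bar>int j - int i\<bar> \<ge> int (min_dist (matching_instance n cl))" using A by linarith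
  next
    fix i assume "i \<in> {0..<nS (matching_instance n cl)}"
    then show "\<exists>!t. (i, t) \<in> M" by (simp add: M_def matching_instance_def)
  qed
  then show ?thesis by blast
qed

text \<open>Membership only provides some instance with this code; injectivity of the encoding on
  valid instances identifies it with the constructed one.\<close>

lemma matching_language_iff:
  assumes "0 < n"
  shows "encode (matching_instance n cl) \<in> matching_language c \<longleftrightarrow> satisfiable n cl"
proof
  assume "encode (matching_instance n cl) \<in> matching_language c"
  then obtain I M where I: "encode (matching_instance n cl) = encode I" "valid_instance I" "perfect_distance_matching I M"
    unfolding matching_language_def by blast
  then have "I = matching_instance n cl"
    using encode_inject[OF matching_instance_valid I(2,1)] by simp
  with I(3) show "satisfiable n cl" using matching_imp_satisfiable[OF assms] by blast
next
  assume "satisfiable n cl"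
  then show "encode (matching_instance n cl) \<in> matching_language c"
    unfolding matching_language_def
    using satisfiable_imp_matching[OF assms] matching_instance_valid matching_instance_degree[OF assms] by blast
qed

section \<open>Computing the reduction in polynomial time\<close>

lemma pcomp_power [pcomp_intros]: "pcomp f \<Longrightarrow> pcomp (\<lambda>x e. f x e ^ c)"
  by (induction c) (simp_all add: pcomp_const pcomp_mult)

text \<open>The hypothesis on \<open>cl\<close> is stated for arbitrary computable arguments because
  the digits of a block number are substituted for the literals.\<close>

lemma poly_time_encode_matching:
  assumes n: "pcomp (\<lambda>x e. n x)"
    and cl: "\<And>f g h k. pcomp f \<Longrightarrow> pcomp g \<Longrightarrow> pcomp h \<Longrightarrow> pcomp k \<Longrightarrow>
      pdec (\<lambda>x e. cl x (f x e) (g x e) (h x e) (k x e))"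
  shows "poly_time (\<lambda>x. encode (matching_instance (n x) (cl x)))"
proof -
  let ?I = "\<lambda>x. matching_instance (n x) (cl x)"
  have "poly_time (\<lambda>x. map (encode_bit (nS (?I x)) (nT (?I x)) (\<lambda>i t. (i, t) \<in> edges (?I x)) (min_dist (?I x)))
      [0..<nS (?I x) + nT (?I x) + 2 + nS (?I x) * nT (?I x) + (\<Sum>j<min_dist (?I x). of_bool (min_dist (?I x) div 2 ^ j \<noteq> 0))])"
    by (intro poly_time_map; (unfold encode_bit_def edges_matching_instance)?;
       unfold matching_instance_def dm_instance.simps
       block_count_def adjacent_def active_def digit_def) (intro pcomp_intros n cl)+
  moreover have "encode J = map (encode_bit (nS J) (nT J) (\<lambda>i t. (i, t) \<in> edges J) (min_dist J))
      [0..<nS J + nT J + 2 + nS J * nT J + (\<Sum>j<min_dist J. of_bool (min_dist J div 2 ^ j \<noteq> 0))]" for J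
    unfolding length_binary[symmetric] length_encode[symmetric] by (rule nth_equalityI) (simp_all add: nth_encode)
  ultimately show ?thesis by (simp only:)
qed

lemma NP_hard_matching_language:
  assumes "\<And>A. A \<in> class_NP \<Longrightarrow> \<exists>n cl. pcomp (\<lambda>x e. n x) \<and> (\<forall>x. 0 < n x) \<and>
      (\<forall>f g h k. pcomp f \<longrightarrow> pcomp g \<longrightarrow> pcomp h \<longrightarrow> pcomp k \<longrightarrow>
        pdec (\<lambda>x e. cl x (f x e) (g x e) (h x e) (k x e))) \<and>
      (\<forall>x. x \<in> A \<longleftrightarrow> satisfiable (n x) (cl x))"
  shows "NP_hard (matching_language c)"
  unfolding NP_hard_def poly_reducible_def
proof
  fix A assume "A \<in> class_NP"
  then obtain n cl where *: "pcomp (\<lambda>x e. n x)" "\<And>x. 0 < n x"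
    "\<And>f g h k. pcomp f \<Longrightarrow> pcomp g \<Longrightarrow> pcomp h \<Longrightarrow> pcomp k \<Longrightarrow> pdec (\<lambda>x e. cl x (f x e) (g x e) (h x e) (k x e))"
    "\<And>x. x \<in> A \<longleftrightarrow> satisfiable (n x) (cl x)"
    using assms by blast
  show "\<exists>f. poly_time f \<and> (\<forall>x. x \<in> A \<longleftrightarrow> f x \<in> matching_language c)"
    using poly_time_encode_matching[OF *(1,3)] *(2,4) matching_language_iff
    by (intro exI[of _ "\<lambda>x. encode (matching_instance (n x) (cl x))"]) simp
qed

section \<open>Computations as sets of clauses\<close>

text \<open>A halted machine idles, so that every computation can be extended to the full time bound.\<close>

definition tm_trans :: "tm \<Rightarrow> nat \<Rightarrow> nat list \<Rightarrow> nat \<times> (nat \<times> move) list" where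
  "tm_trans M q rs = (if q < states M then delta M q rs else (q, map (\<lambda>a. (a, Stay)) rs))"

definition state_at :: "tm \<Rightarrow> bool list \<Rightarrow> nat \<Rightarrow> nat" where
  "state_at M z t = fst ((step M ^^ t) (initial M z))"

definition tape_at :: "tm \<Rightarrow> bool list \<Rightarrow> nat \<Rightarrow> nat \<Rightarrow> tape" where
  "tape_at M z t j = snd ((step M ^^ t) (initial M z)) ! j"

definition reads_at :: "tm \<Rightarrow> bool list \<Rightarrow> nat \<Rightarrow> nat list" where
  "reads_at M z t = map (\<lambda>j. read (tape_at M z t j)) [0..<tapes M]"

definition act_at :: "tm \<Rightarrow> bool list \<Rightarrow> nat \<Rightarrow> nat \<Rightarrow> nat \<times> move" where
  "act_at M z t j = snd (tm_trans M (state_at M z t) (reads_at M z t)) ! j"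

lemma tm_trans_wf:
  assumes "wf_tm M" "q \<le> states M" "length rs = tapes M" "\<forall>r\<in>set rs. r < symbols M"
  shows "fst (tm_trans M q rs) \<le> states M" "length (snd (tm_trans M q rs)) = tapes M"
    "j < tapes M \<Longrightarrow> fst (snd (tm_trans M q rs) ! j) < symbols M"
proof -
  have "fst (tm_trans M q rs) \<le> states M \<and> length (snd (tm_trans M q rs)) = tapes M \<and>
      (\<forall>(r, mv)\<in>set (snd (tm_trans M q rs)). r < symbols M)"
  proof (cases "q < states M")
    case True
    obtain q' as where d: "delta M q rs = (q', as)" by fastforce
    then have "q' \<le> states M \<and> length as = tapes M \<and> (\<forall>(r, mv)\<in>set as. r < symbols M)"
      using assms True unfolding wf_tm_def by blast
    then show ?thesis using True by (simp add: tm_trans_def d)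
  next
    case False
    then show ?thesis using assms by (auto simp: tm_trans_def)
  qed
  then show "fst (tm_trans M q rs) \<le> states M" "length (snd (tm_trans M q rs)) = tapes M"
    "j < tapes M \<Longrightarrow> fst (snd (tm_trans M q rs) ! j) < symbols M"
    by (auto simp: case_prod_beta)
qed

lemma step_trans:
  "step M (q, ts) = (fst (tm_trans M q (map read ts)), map2 act (snd (tm_trans M q (map read ts))) ts)"
  using map2_act_Stay[of ts] by (auto simp: tm_trans_def split: prod.split)

text \<open>The transition function is controlled only on legal states and symbols, so all these
  properties have to be carried along together. A head moves by at most one cell per step, whence
  \<open>2 * T + 1\<close> positions suffice for \<open>T\<close> steps.\<close>

lemma config_invariant:
  assumes wf: "wf_tm M"
  shows "length (snd ((step M ^^ t) (initial M z))) = tapes M" (is ?len)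
    and "state_at M z t \<le> states M"
    and "j < tapes M \<Longrightarrow> fst (tape_at M z t j) c < symbols M"
    and "j < tapes M \<Longrightarrow> \<bar>snd (tape_at M z t j)\<bar> \<le> int t"
    and "state_at M z (Suc t) = fst (tm_trans M (state_at M z t) (reads_at M z t))"
    and "j < tapes M \<Longrightarrow> tape_at M z (Suc t) j = act (act_at M z t j) (tape_at M z t j)"
proof -
  have k: "1 \<le> tapes M" "3 \<le> symbols M" using wf by (auto simp: wf_tm_def)
  define inv where "inv t \<longleftrightarrow> length (snd ((step M ^^ t) (initial M z))) = tapes M \<and> state_at M z t \<le> states M \<and>
    (\<forall>j<tapes M. (\<forall>c. fst (tape_at M z t j) c < symbols M) \<and> \<bar>snd (tape_at M z t j)\<bar> \<le> int t)" for t
  have reads: "map read (snd ((step M ^^ t) (initial M z))) = reads_at M z t" if "inv t" for t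
    using that by (auto simp: inv_def reads_at_def tape_at_def intro: nth_equalityI)
  have reads_ok: "length (reads_at M z t) = tapes M" "\<forall>r\<in>set (reads_at M z t). r < symbols M" if "inv t" for t
    using that by (auto simp: inv_def reads_at_def read_def)
  have step: "step M ((step M ^^ t) (initial M z)) = (fst (tm_trans M (state_at M z t) (reads_at M z t)),
      map2 act (snd (tm_trans M (state_at M z t) (reads_at M z t))) (snd ((step M ^^ t) (initial M z))))" if "inv t" for t
    using step_trans[of M "state_at M z t" "snd ((step M ^^ t) (initial M z))"] reads[OF that]
    by (simp add: state_at_def)
  have state: "state_at M z (Suc t) = fst (tm_trans M (state_at M z t) (reads_at M z t))" if "inv t" for t
    using step[OF that] by (simp add: state_at_def)
  have tape: "tape_at M z (Suc t) j = act (act_at M z t j) (tape_at M z t j)" if "inv t" "j < tapes M" for t j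
  proof -
    have "length (snd (tm_trans M (state_at M z t) (reads_at M z t))) = tapes M"
      using tm_trans_wf(2)[OF wf _ reads_ok[OF that(1)]] that by (simp add: inv_def)
    then show ?thesis
      using step[OF that(1)] that by (simp add: tape_at_def act_at_def inv_def)
  qed
  have inv: "inv t" for t
  proof (induction t)
    case 0
    have "snd (initial M z) ! j = input_tape z \<or> snd (initial M z) ! j = input_tape []" if "j < tapes M" for j
      using that by (cases j) (auto simp: initial_def)
    moreover have "fst (input_tape y) c < symbols M" for y c
      using k by (cases "y ! nat c") (auto simp: input_tape_def)
    moreover have "snd (input_tape y) = 0" for y by (simp add: input_tape_def)
    ultimately have "(\<forall>c. fst (snd (initial M z) ! j) c < symbols M) \<and> snd (snd (initial M z) ! j) = 0"
      if "j < tapes M" for j using that by metis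
    then show ?case
      using k by (auto simp: inv_def state_at_def tape_at_def) (auto simp: initial_def)
  next
    case (Suc t)
    have tr: "fst (tm_trans M (state_at M z t) (reads_at M z t)) \<le> states M"
      "length (snd (tm_trans M (state_at M z t) (reads_at M z t))) = tapes M"
      "\<And>j. j < tapes M \<Longrightarrow> fst (act_at M z t j) < symbols M"
      using tm_trans_wf[OF wf _ reads_ok[OF Suc]] Suc by (auto simp: inv_def act_at_def)
    have "(\<forall>c. fst (tape_at M z (Suc t) j) c < symbols M) \<and> \<bar>snd (tape_at M z (Suc t) j)\<bar> \<le> int (Suc t)"
      if j: "j < tapes M" for j
    proof -
      obtain r mv where a: "act_at M z t j = (r, mv)" by fastforce
      obtain f p where f: "tape_at M z t j = (f, p)" by fastforce
      have "\<forall>c. f c < symbols M" "\<bar>p\<bar> \<le> int t" using Suc j f by (auto simp: inv_def)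
      moreover have "r < symbols M" using tr(3)[OF j] a by simp
      moreover have "\<bar>shift mv\<bar> \<le> 1" by (cases mv) auto
      ultimately show ?thesis by (auto simp: tape[OF Suc j] a f)
    qed
    moreover have "length (snd ((step M ^^ Suc t) (initial M z))) = tapes M"
      using step[OF Suc] tr(2) Suc by (simp add: inv_def)
    ultimately show ?case using tr(1) state[OF Suc] by (auto simp: inv_def simp del: funpow.simps)
  qed
  show ?len "state_at M z t \<le> states M" "j < tapes M \<Longrightarrow> fst (tape_at M z t j) c < symbols M"
    "j < tapes M \<Longrightarrow> \<bar>snd (tape_at M z t j)\<bar> \<le> int t"
    using inv[of t] by (auto simp: inv_def)
  show "state_at M z (Suc t) = fst (tm_trans M (state_at M z t) (reads_at M z t))" using state inv by blast
  show "j < tapes M \<Longrightarrow> tape_at M z (Suc t) j = act (act_at M z t j) (tape_at M z t j)" using tape inv by blast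
qed

lemma tape_at_0:
  assumes "j < tapes M"
  shows "tape_at M z 0 j = input_tape (if j = 0 then z else [])" "state_at M z 0 = 0"
  using assms by (cases j; simp add: tape_at_def state_at_def initial_def)+

text \<open>Positions in the formula are cells shifted by \<open>T\<close>, so that the cells from
  \<open>-T\<close> to \<open>T\<close> become natural numbers.\<close>

lemma input_tape_cell: "fst (input_tape x) (int i - int T) = (if T \<le> i then sym x (i - T) else 0)"
  by (auto simp: input_tape_def sym_def nat_diff_distrib of_nat_diff)

text \<open>A halted configuration does not change, so the verdict can be read at the fixed time
  \<open>T\<close> instead of the unknown halting time.\<close>

lemma halted_config:
  assumes wf: "wf_tm M" and c: "computes_within M z y T'" and T: "T' \<le> T"
  shows "fst (tape_at M z T (tapes M - 1)) 0 = (if y = [] then 0 else bit_symbol (hd y))"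
proof -
  obtain t ts where t: "t \<le> T'" "(step M ^^ t) (initial M z) = (states M, ts)" "tape_holds (last ts) y"
    using c unfolding computes_within_def by blast
  have "(step M ^^ d) (states M, ts) = (states M, ts)" for d by (induction d) auto
  from funpow_add_apply[OF t(2) this, of "T - t"]
  have "(step M ^^ T) (initial M z) = (states M, ts)" using t(1) T by simp
  moreover from this have "length ts = tapes M" using config_invariant(1)[OF wf, of T z] by simp
  moreover have "1 \<le> tapes M" using wf by (simp add: wf_tm_def)
  ultimately have "tape_at M z T (tapes M - 1) = last ts"
    by (subst last_conv_nth) (auto simp: tape_at_def)
  moreover have "fst (last ts) 0 = (if y = [] then 0 else bit_symbol (hd y))"
    using t(3) by (cases y) (auto simp: tape_holds_def)
  ultimately show ?thesis by simp
qed

text \<open>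
  The atoms of the formula are triples of a tag, a time and a position. The tag \<open>TState q rs\<close> (at
  position 0) says that the machine is in state \<open>q\<close> and that \<open>rs\<close> are the symbols read on the
  first \<open>length rs\<close> tapes: collecting the symbols one by one keeps the clauses short. All
  clauses that describe the computation are Horn, hence every satisfying assignment contains
  the actual computation.
\<close>

datatype tag = TState nat "nat list" | THead nat | TCell nat nat

instance tag :: countable
  by countable_datatype

text \<open>The conditions on tags are kept apart from times and positions: for fixed tags they are
  constants, and only arithmetic remains when \<open>clause\<close> is shown to be
  decidable.\<close>

definition read_tags :: "tm \<Rightarrow> tag \<Rightarrow> tag \<Rightarrow> tag \<Rightarrow> tag \<Rightarrow> bool" where
  "read_tags M k1 k2 k3 k4 \<longleftrightarrow> (\<exists>q rs a. length rs < tapes M \<and> k1 = TState q rs \<and>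
     k2 = THead (length rs) \<and> k3 = TCell (length rs) a \<and> k4 = TState q (rs @ [a]))"

definition write_tags :: "tm \<Rightarrow> tag \<Rightarrow> tag \<Rightarrow> tag \<Rightarrow> bool" where
  "write_tags M k1 k2 k4 \<longleftrightarrow> (\<exists>q rs j. length rs = tapes M \<and> j < tapes M \<and> k1 = TState q rs \<and>
     k2 = THead j \<and> k4 = TCell j (fst (snd (tm_trans M q rs) ! j)))"

definition move_tags :: "tm \<Rightarrow> move \<Rightarrow> tag \<Rightarrow> tag \<Rightarrow> tag \<Rightarrow> bool" where
  "move_tags M mv k1 k2 k4 \<longleftrightarrow> (\<exists>q rs j. length rs = tapes M \<and> j < tapes M \<and> k1 = TState q rs \<and>
     k2 = THead j \<and> k4 = THead j \<and> snd (snd (tm_trans M q rs) ! j) = mv)"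

definition next_tags :: "tm \<Rightarrow> tag \<Rightarrow> tag \<Rightarrow> bool" where
  "next_tags M k1 k4 \<longleftrightarrow> (\<exists>q rs. length rs = tapes M \<and> k1 = TState q rs \<and> k4 = TState (fst (tm_trans M q rs)) [])"

definition keep_tags :: "tm \<Rightarrow> tag \<Rightarrow> tag \<Rightarrow> bool" where
  "keep_tags M k1 k2 \<longleftrightarrow> (\<exists>j a. j < tapes M \<and> k1 = THead j \<and> k2 = TCell j a)"

definition head_tag :: "tm \<Rightarrow> tag \<Rightarrow> bool" where
  "head_tag M k \<longleftrightarrow> (\<exists>j<tapes M. k = THead j)"

definition blank_tag :: "tm \<Rightarrow> tag \<Rightarrow> bool" where
  "blank_tag M k \<longleftrightarrow> (\<exists>j<tapes M. 0 < j \<and> k = TCell j 0)"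

text \<open>Position \<open>T\<close> is cell 0 of a tape, and \<open>N\<close> bounds the length of the pair of input and witness.\<close>

definition init_atom :: "tm \<Rightarrow> bool list \<Rightarrow> nat \<Rightarrow> nat \<Rightarrow> tag \<Rightarrow> nat \<Rightarrow> bool" where
  "init_atom M x T N k i \<longleftrightarrow>
     k = TState 0 [] \<and> i = 0 \<or>
     head_tag M k \<and> i = T \<or>
     blank_tag M k \<or>
     k = TCell 0 0 \<and> (i < T \<or> T + N \<le> i) \<or>
     k = TCell 0 2 \<and> (\<exists>m<length x. i = T + 2 * m \<or> i = T + (2 * m + 1) \<and> bitat x m) \<or>
     k = TCell 0 1 \<and> (i = T + 2 * length x \<or> (\<exists>m<length x. i = T + (2 * m + 1) \<and> \<not> bitat x m))"

text \<open>The four literals are given by their signs \<open>s\<close> (true for a negated atom), tags, times and positions.\<close>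

definition clause :: "tm \<Rightarrow> bool list \<Rightarrow> nat \<Rightarrow> nat \<Rightarrow> bool \<Rightarrow> tag \<Rightarrow> nat \<Rightarrow> nat \<Rightarrow> bool \<Rightarrow> tag \<Rightarrow> nat \<Rightarrow> nat \<Rightarrow>
    bool \<Rightarrow> tag \<Rightarrow> nat \<Rightarrow> nat \<Rightarrow> bool \<Rightarrow> tag \<Rightarrow> nat \<Rightarrow> nat \<Rightarrow> bool" where
  "clause M x T N s1 k1 t1 i1 s2 k2 t2 i2 s3 k3 t3 i3 s4 k4 t4 i4 \<longleftrightarrow>
     (s1 \<and> s2 \<and> s3 \<and> \<not> s4 \<and>
       (read_tags M k1 k2 k3 k4 \<and> t2 = t1 \<and> t3 = t1 \<and> t4 = t1 \<and> i1 = 0 \<and> i3 = i2 \<and> i4 = 0 \<or>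
        k3 = k1 \<and> t3 = t1 \<and> i3 = i1 \<and> t2 = t1 \<and> t4 = Suc t1 \<and>
          (i1 = 0 \<and> write_tags M k1 k2 k4 \<and> i4 = i2 \<or>
           i1 = 0 \<and> move_tags M MoveLeft k1 k2 k4 \<and> Suc i4 = i2 \<or>
           i1 = 0 \<and> move_tags M Stay k1 k2 k4 \<and> i4 = i2 \<or>
           i1 = 0 \<and> move_tags M MoveRight k1 k2 k4 \<and> i4 = Suc i2 \<or>
           i1 = 0 \<and> k2 = k1 \<and> i2 = 0 \<and> next_tags M k1 k4 \<and> i4 = 0 \<or>
           keep_tags M k1 k2 \<and> k4 = k2 \<and> i4 = i2 \<and> i1 \<noteq> i2) \<or>
        k1 = TCell 0 0 \<and> k2 = k1 \<and> k3 = k1 \<and> k4 = k1 \<and> t1 = 0 \<and> t2 = 0 \<and> t3 = 0 \<and> t4 = 0 \<and>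
          i2 = i1 \<and> i3 = i1 \<and> i4 = Suc i1 \<and> T + (2 * length x + 1) \<le> i1)) \<or>
     (\<not> s1 \<and> \<not> s2 \<and> \<not> s3 \<and> \<not> s4 \<and> t1 = 0 \<and> t2 = 0 \<and> t3 = 0 \<and> t4 = 0 \<and> i2 = i1 \<and> i3 = i1 \<and> i4 = i1 \<and>
       (k2 = k1 \<and> k3 = k1 \<and> k4 = k1 \<and> init_atom M x T N k1 i1 \<or>
        k1 = TCell 0 0 \<and> k2 = TCell 0 1 \<and> k3 = TCell 0 2 \<and> k4 = TCell 0 2 \<and>
          T + (2 * length x + 1) \<le> i1 \<and> i1 < T + N)) \<or>
     (s1 \<and> s2 \<and> s3 \<and> s4 \<and> k1 = TCell (tapes M - 1) 1 \<and> k2 = k1 \<and> k3 = k1 \<and> k4 = k1 \<and>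
       t1 = T \<and> t2 = T \<and> t3 = T \<and> t4 = T \<and> i1 = T \<and> i2 = T \<and> i3 = T \<and> i4 = T)"

text \<open>The intended assignment. A state atom holds for every prefix of the symbols read,
  because they are collected tape by tape.\<close>

fun holds :: "tm \<Rightarrow> bool list \<Rightarrow> nat \<Rightarrow> tag \<Rightarrow> nat \<Rightarrow> nat \<Rightarrow> bool" where
  "holds M z T (TState q rs) t i \<longleftrightarrow> i = 0 \<and> q = state_at M z t \<and> length rs \<le> tapes M \<and>
     rs = take (length rs) (reads_at M z t)"
| "holds M z T (THead j) t i \<longleftrightarrow> j < tapes M \<and> int i - int T = snd (tape_at M z t j)"
| "holds M z T (TCell j a) t i \<longleftrightarrow> j < tapes M \<and> fst (tape_at M z t j) (int i - int T) = a"

lemma sym_pair_code: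
  shows "i < length x \<Longrightarrow> sym (pair_code x u) (2 * i) = 2"
    and "i < length x \<Longrightarrow> sym (pair_code x u) (2 * i + 1) = (if bitat x i then 2 else 1)"
    and "sym (pair_code x u) (2 * length x) = 1"
    and "sym (pair_code x u) (2 * length x + 1 + j) = sym u j"
  using nth_pair_code(1,2)[of i x u] nth_pair_code(3)[of x u] nth_pair_code(4)[of x u j]
  by (simp_all add: sym_def length_pair_code bitat_def)

text \<open>Each kind of clause is a local fact about the computation. Since \<open>s\<close> marks
  negation, a literal is true if the value of its atom differs from \<open>s\<close>.\<close>

lemma computation_satisfies_clause:
  assumes wf: "wf_tm M" and z: "z = pair_code x u" "length z \<le> N"
    and acc: "fst (tape_at M z T (tapes M - 1)) 0 \<noteq> 1"
    and cl: "clause M x T N s1 k1 t1 i1 s2 k2 t2 i2 s3 k3 t3 i3 s4 k4 t4 i4"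
  shows "holds M z T k1 t1 i1 \<noteq> s1 \<or> holds M z T k2 t2 i2 \<noteq> s2 \<or> holds M z T k3 t3 i3 \<noteq> s3 \<or> holds M z T k4 t4 i4 \<noteq> s4"
proof -
  have len: "length (reads_at M z t) = tapes M" for t by (simp add: reads_at_def)
  have k: "1 \<le> tapes M" using wf by (simp add: wf_tm_def)
  have full: "q = state_at M z t" "rs = reads_at M z t"
    if "holds M z T (TState q rs) t i" "length rs = tapes M" for q rs t i
    using that len[of t] by simp_all
  have rd: "holds M z T k4 t1 0" if "read_tags M k1 k2 k3 k4" "holds M z T k1 t1 0" "holds M z T k2 t1 i2" "holds M z T k3 t1 i2"
  proof -
    from that(1) obtain q rs a where *: "length rs < tapes M" "k1 = TState q rs" "k2 = THead (length rs)"
      "k3 = TCell (length rs) a" "k4 = TState q (rs @ [a])"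
      unfolding read_tags_def by blast
    have "a = read (tape_at M z t1 (length rs))" using that(3,4) * by (simp add: read_def)
    then have "a = reads_at M z t1 ! length rs" using * by (simp add: reads_at_def)
    then show ?thesis using that(2) * len by (simp add: take_Suc_conv_app_nth)
  qed
  have act: "act (act_at M z t j) (tape_at M z t j) =
      ((fst (tape_at M z t j))(snd (tape_at M z t j) := fst (act_at M z t j)), snd (tape_at M z t j) + shift (snd (act_at M z t j)))" for t j
    by (cases "act_at M z t j"; cases "tape_at M z t j") simp
  have wr: "holds M z T k4 (Suc t1) i2" if "write_tags M k1 k2 k4" "holds M z T k1 t1 0" "holds M z T k2 t1 i2"
  proof -
    from that(1) obtain q rs j where *: "length rs = tapes M" "j < tapes M" "k1 = TState q rs" "k2 = THead j"
      "k4 = TCell j (fst (snd (tm_trans M q rs) ! j))"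
      unfolding write_tags_def by blast
    have "q = state_at M z t1" "rs = reads_at M z t1" using full[OF that(2)[unfolded *(3)] *(1)] by blast+
    then have "k4 = TCell j (fst (act_at M z t1 j))" using * by (simp add: act_at_def)
    then show ?thesis using that(3) *(2,4) by (simp add: config_invariant(6)[OF wf] act)
  qed
  have mv: "holds M z T k4 (Suc t1) i" if "move_tags M mv k1 k2 k4" "holds M z T k1 t1 0" "holds M z T k2 t1 i2"
    "int i = int i2 + shift mv" for mv i
  proof -
    from that(1) obtain q rs j where *: "length rs = tapes M" "j < tapes M" "k1 = TState q rs" "k2 = THead j"
      "k4 = THead j" "snd (snd (tm_trans M q rs) ! j) = mv"
      unfolding move_tags_def by blast
    have "q = state_at M z t1" "rs = reads_at M z t1" using full[OF that(2)[unfolded *(3)] *(1)] by blast+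
    then have "snd (act_at M z t1 j) = mv" using * by (simp add: act_at_def)
    then show ?thesis using that(3,4) * by (simp add: config_invariant(6)[OF wf] act)
  qed
  have nx: "holds M z T k4 (Suc t1) 0" if "next_tags M k1 k4" "holds M z T k1 t1 0"
  proof -
    from that(1) obtain q rs where *: "length rs = tapes M" "k1 = TState q rs" "k4 = TState (fst (tm_trans M q rs)) []"
      unfolding next_tags_def by blast
    have "q = state_at M z t1" "rs = reads_at M z t1" using full[OF that(2)[unfolded *(2)] *(1)] by blast+
    then show ?thesis using * by (simp add: config_invariant(5)[OF wf])
  qed
  have kp: "holds M z T k2 (Suc t1) i2" if "keep_tags M k1 k2" "holds M z T k1 t1 i1" "holds M z T k2 t1 i2" "i1 \<noteq> i2"
  proof -
    from that(1) obtain j a where *: "j < tapes M" "k1 = THead j" "k2 = TCell j a"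
      unfolding keep_tags_def by blast
    then have "int i2 - int T \<noteq> snd (tape_at M z t1 j)" using that by auto
    then show ?thesis using that(3) * by (simp add: config_invariant(6)[OF wf] act)
  qed
  have cell0: "holds M z T (TCell 0 a) 0 i \<longleftrightarrow> a = (if T \<le> i then sym z (i - T) else 0)" for a i
    using k tape_at_0(1)[of 0 M z] by (auto simp: input_tape_cell)
  have long: "sym z i = 0 \<longleftrightarrow> length z \<le> i" for i
    by (cases "z ! i") (auto simp: sym_def)
  have blank: "holds M z T (TCell 0 0) 0 (Suc i1)" if "holds M z T (TCell 0 0) 0 i1" "T + (2 * length x + 1) \<le> i1"
    using that unfolding cell0 by (auto simp: long Suc_diff_le)
  have init: "holds M z T k1 0 i1" if "init_atom M x T N k1 i1"
  proof -
    from that consider "k1 = TState 0 []" "i1 = 0" | "head_tag M k1" "i1 = T" | "blank_tag M k1"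
      | "k1 = TCell 0 0" "i1 < T \<or> T + N \<le> i1"
      | m where "k1 = TCell 0 2" "m < length x" "i1 = T + 2 * m"
      | m where "k1 = TCell 0 2" "m < length x" "i1 = T + (2 * m + 1)" "bitat x m"
      | "k1 = TCell 0 1" "i1 = T + 2 * length x"
      | m where "k1 = TCell 0 1" "m < length x" "i1 = T + (2 * m + 1)" "\<not> bitat x m"
      unfolding init_atom_def by blast
    then show ?thesis
    proof cases
      case 1
      then show ?thesis using tape_at_0(2)[of 0 M z] k by simp
    next
      case 2
      then show ?thesis using tape_at_0(1)[of _ M z] by (auto simp: head_tag_def input_tape_def)
    next
      case 3
      then show ?thesis using tape_at_0(1)[of _ M z] by (auto simp: blank_tag_def input_tape_def)
    next
      case 4
      then show ?thesis unfolding 4 cell0 using z(2) long[of "i1 - T"] by auto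
    next
      case (5 m)
      then show ?thesis unfolding 5 cell0 using sym_pair_code(1)[of m x u] z(1) by simp
    next
      case (6 m)
      then show ?thesis unfolding 6 cell0 using sym_pair_code(2)[of m x u] z(1) by simp
    next
      case 7
      then show ?thesis unfolding 7 cell0 using sym_pair_code(3)[of x u] z(1) by simp
    next
      case (8 m)
      then show ?thesis unfolding 8 cell0 using sym_pair_code(2)[of m x u] z(1) by simp
    qed
  qed
  have choice: "holds M z T (TCell 0 0) 0 i \<or> holds M z T (TCell 0 1) 0 i \<or> holds M z T (TCell 0 2) 0 i" for i
    unfolding cell0 by (cases "z ! (i - T)") (auto simp: sym_def)
  have fin: "\<not> holds M z T (TCell (tapes M - 1) 1) T T" using acc by simp
  show ?thesis
    using cl unfolding clause_def
    using rd wr mv[of MoveLeft i4] mv[of Stay i4] mv[of MoveRight i4] nx kp blank init choice[of i1] fin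
    by (elim disjE conjE) simp_all
qed

section \<open>Numbering the atoms\<close>

definition tags :: "tm \<Rightarrow> tag set" where
  "tags M = (\<lambda>(q, rs). TState q rs) ` ({..states M} \<times> {rs. set rs \<subseteq> {..<symbols M} \<and> length rs \<le> tapes M}) \<union>
     THead ` {..<tapes M} \<union> (\<lambda>(j, a). TCell j a) ` ({..<tapes M} \<times> {..<symbols M})"

lemma finite_tags: "finite (tags M)"
  by (auto simp: tags_def intro!: finite_imageI finite_cartesian_product finite_lists_length_le)

lemma tags_iff:
  "TState q rs \<in> tags M \<longleftrightarrow> q \<le> states M \<and> set rs \<subseteq> {..<symbols M} \<and> length rs \<le> tapes M"
  "THead j \<in> tags M \<longleftrightarrow> j < tapes M"
  "TCell j a \<in> tags M \<longleftrightarrow> j < tapes M \<and> a < symbols M"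
  by (auto simp: tags_def)

lemma tag_bound: "\<exists>K>0. \<forall>k\<in>tags M. to_nat k < K"
proof -
  obtain m where "\<forall>y\<in>to_nat ` tags M. y \<le> m"
    using finite_nat_set_iff_bounded_le finite_imageI[OF finite_tags] by metis
  then show ?thesis by (intro exI[of _ "Suc m"]) auto
qed

text \<open>A literal is coded as \<open>2 * ((t * (2 * T + 1) + i) * K + to_nat k)\<close>, plus 1
  if it is negated; the quotients and remainders decode it.\<close>

definition computation_clause :: "tm \<Rightarrow> nat \<Rightarrow> nat \<Rightarrow> nat \<Rightarrow> bool list \<Rightarrow> nat \<Rightarrow> nat \<Rightarrow> nat \<Rightarrow> nat \<Rightarrow> bool" where
  "computation_clause M K T N x a b c d \<longleftrightarrow>
     clause M x T N
       (odd a) (from_nat (a div 2 mod K)) (a div 2 div K div (2 * T + 1)) (a div 2 div K mod (2 * T + 1))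
       (odd b) (from_nat (b div 2 mod K)) (b div 2 div K div (2 * T + 1)) (b div 2 div K mod (2 * T + 1))
       (odd c) (from_nat (c div 2 mod K)) (c div 2 div K div (2 * T + 1)) (c div 2 div K mod (2 * T + 1))
       (odd d) (from_nat (d div 2 mod K)) (d div 2 div K div (2 * T + 1)) (d div 2 div K mod (2 * T + 1))"

text \<open>The assignment decodes numbers exactly as the clauses do, and the computation satisfies
  the clauses for arbitrary tags. Hence numbers that code no legal tag are covered as well.\<close>

lemma computation_satisfiable:
  assumes "wf_tm M" "length (pair_code x u) \<le> N" "fst (tape_at M (pair_code x u) T (tapes M - 1)) 0 \<noteq> 1"
  shows "satisfiable n (computation_clause M K T N x)"
proof -
  let ?v = "\<lambda>a. holds M (pair_code x u) T (from_nat (a mod K)) (a div K div (2 * T + 1)) (a div K mod (2 * T + 1))"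
  have lit: "lit_true ?v l \<longleftrightarrow> holds M (pair_code x u) T (from_nat (l div 2 mod K)) (l div 2 div K div (2 * T + 1))
      (l div 2 div K mod (2 * T + 1)) \<noteq> odd l" for l
    by (auto simp: lit_true_def)
  show ?thesis
    unfolding satisfiable_def computation_clause_def
    by (intro exI[of _ ?v] allI impI)
      (unfold lit, erule computation_satisfies_clause[OF assms(1) refl assms(2,3)])
qed

text \<open>A witness is read off the assignment at time 0. From then on the Horn clauses force
  every atom of the actual computation on it, and the denial clause rules out rejection.\<close>

lemma satisfiable_computation:
  assumes wf: "wf_tm M" and K: "\<forall>k\<in>tags M. to_nat k < K"
    and N: "N = 2 * length x + 1 + P" "N \<le> T"
    and sat: "satisfiable ((T + 1) * (2 * T + 1) * K) (computation_clause M K T N x)"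
  shows "\<exists>u. length u \<le> P \<and> fst (tape_at M (pair_code x u) T (tapes M - 1)) 0 \<noteq> 1"
proof -
  define W where "W = 2 * T + 1"
  have k: "1 \<le> tapes M" "3 \<le> symbols M" using wf by (auto simp: wf_tm_def)
  obtain v where v: "\<And>a b c d. a < 2 * ((T + 1) * W * K) \<Longrightarrow> b < 2 * ((T + 1) * W * K) \<Longrightarrow>
      c < 2 * ((T + 1) * W * K) \<Longrightarrow> d < 2 * ((T + 1) * W * K) \<Longrightarrow> computation_clause M K T N x a b c d \<Longrightarrow>
      lit_true v a \<or> lit_true v b \<or> lit_true v c \<or> lit_true v d"
    using sat unfolding satisfiable_def W_def by blast
  define V where "V k t i \<longleftrightarrow> v ((t * W + i) * K + to_nat k)" for k :: tag and t i
  \<comment> \<open>Exactly the atoms whose literals are known to have numbers in the range over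
    which satisfiability quantifies.\<close>
  define ok where "ok k t i \<longleftrightarrow> k \<in> tags M \<and> t \<le> T \<and> i < W" for k t i
  have satD: "V k1 t1 i1 \<noteq> s1 \<or> V k2 t2 i2 \<noteq> s2 \<or> V k3 t3 i3 \<noteq> s3 \<or> V k4 t4 i4 \<noteq> s4"
    if ok: "ok k1 t1 i1" "ok k2 t2 i2" "ok k3 t3 i3" "ok k4 t4 i4"
      and cl: "clause M x T N s1 k1 t1 i1 s2 k2 t2 i2 s3 k3 t3 i3 s4 k4 t4 i4"
    for k1 t1 i1 s1 k2 t2 i2 s2 k3 t3 i3 s3 k4 t4 i4 s4
  proof -
    define lit where "lit s k t i = 2 * ((t * W + i) * K + to_nat k) + of_bool s" for s and k :: tag and t i
    have half: "lit s k t i div 2 = (t * W + i) * K + to_nat k" for s k t i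
      by (simp add: lit_def)
    have odd: "odd (lit s k t i) \<longleftrightarrow> s" for s k t i by (simp add: lit_def)
    have dec: "from_nat (lit s k t i div 2 mod K) = k" "lit s k t i div 2 div K div W = t"
      "lit s k t i div 2 div K mod W = i" "lit s k t i < 2 * ((T + 1) * W * K)" if "ok k t i" for s k t i
    proof -
      have *: "to_nat k < K" "i < W" "t < T + 1" using that K by (auto simp: ok_def)
      show "from_nat (lit s k t i div 2 mod K) = k" using *(1) unfolding half by (simp only: block_mod from_nat_to_nat)
      show "lit s k t i div 2 div K div W = t" "lit s k t i div 2 div K mod W = i"
        unfolding half block_div[OF *(1)] using *(2) by (simp_all only: block_div block_mod)
      have "(t * W + i) * K + to_nat k < (T + 1) * W * K" using * by (intro pair_index_less)
      then show "lit s k t i < 2 * ((T + 1) * W * K)" by (auto simp: lit_def)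
    qed
    have lt: "lit_true v (lit s k t i) \<longleftrightarrow> V k t i \<noteq> s" for s k t i
    proof -
      have "even (lit s k t i) \<longleftrightarrow> \<not> s" by (simp add: lit_def)
      then show ?thesis unfolding lit_true_def half V_def by (simp only: if_distrib) auto
    qed
    have "computation_clause M K T N x (lit s1 k1 t1 i1) (lit s2 k2 t2 i2) (lit s3 k3 t3 i3) (lit s4 k4 t4 i4)"
      unfolding computation_clause_def W_def[symmetric] odd dec[OF ok(1)] dec[OF ok(2)] dec[OF ok(3)] dec[OF ok(4)] by (rule cl)
    from v[OF dec(4)[OF ok(1)] dec(4)[OF ok(2)] dec(4)[OF ok(3)] dec(4)[OF ok(4)] this]
    show ?thesis unfolding lt .
  qed
  have init: "V k 0 i" if "init_atom M x T N k i" "k \<in> tags M" "i < W" for k i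
    using satD[of k 0 i k 0 i k 0 i k 0 i False False False False] that by (auto simp: clause_def ok_def)
  \<comment> \<open>The witness starts \<open>2 * length x + 1\<close> cells after cell 0, behind
    the doubled input and the announcing bit. Because of \<open>N \<le> T\<close> it fits below
    \<open>W\<close>.\<close>
  define w where "w i = T + (2 * length x + 1) + i" for i
  have w: "w i < W" if "i < P" for i using that N by (simp add: w_def W_def)
  have cell_tag: "TCell 0 a \<in> tags M" if "a < 3" for a using k that by (simp add: tags_iff)
  have choice: "V (TCell 0 0) 0 (w i) \<or> V (TCell 0 1) 0 (w i) \<or> V (TCell 0 2) 0 (w i)" if "i < P" for i
  proof -
    have "clause M x T N False (TCell 0 0) 0 (w i) False (TCell 0 1) 0 (w i) False (TCell 0 2) 0 (w i) False (TCell 0 2) 0 (w i)"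
      using that N by (simp add: clause_def w_def)
    from satD[OF _ _ _ _ this] show ?thesis using w[OF that] cell_tag by (auto simp: ok_def)
  qed
  have blank: "V (TCell 0 0) 0 (w (Suc i))" if "V (TCell 0 0) 0 (w i)" "Suc i < P" for i
  proof -
    have "clause M x T N True (TCell 0 0) 0 (w i) True (TCell 0 0) 0 (w i) True (TCell 0 0) 0 (w i) False (TCell 0 0) 0 (w (Suc i))"
      by (simp add: clause_def w_def)
    from satD[OF _ _ _ _ this] show ?thesis using w[of i] w[of "Suc i"] that cell_tag by (auto simp: ok_def)
  qed
  define isbit where "isbit i \<longleftrightarrow> V (TCell 0 1) 0 (w i) \<or> V (TCell 0 2) 0 (w i)" for i
  \<comment> \<open>The witness ends at the first place without a bit atom. There the choice clause
    yields a blank, and the blank clauses spread it up to the bound \<open>P\<close>.\<close>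
  define m where "m = (LEAST i. i = P \<or> \<not> isbit i)"
  have m: "m = P \<or> \<not> isbit m" unfolding m_def by (rule LeastI[of _ P]) simp
  have mP: "m \<le> P" unfolding m_def by (rule Least_le) simp
  have before_m: "isbit i" if "i < m" for i using not_less_Least[OF that[unfolded m_def]] by blast
  have after_m: "V (TCell 0 0) 0 (w i)" if "m \<le> i" "i < P" for i
    using that
  proof (induction i rule: dec_induct)
    case base
    then show ?case using m choice[of m] by (auto simp: isbit_def)
  next
    case (step i)
    then show ?case using blank[of i] by simp
  qed
  \<comment> \<open>Where both bit atoms hold, True is taken; at each of these places the atom of
    the chosen bit holds under \<open>V\<close>.\<close>
  define u where "u = map (\<lambda>i. V (TCell 0 2) 0 (w i)) [0..<m]"
  define z where "z = pair_code x u"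
  note inv = config_invariant[OF wf, where z = z]
  have cells0: "V (TCell 0 (if T \<le> i then sym z (i - T) else 0)) 0 i" if i: "i < W" for i
  proof -
    consider "i < T \<or> T + N \<le> i" | r where "r < length x" "i = T + 2 * r" | r where "r < length x" "i = T + (2 * r + 1)"
      | "i = T + 2 * length x" | r where "r < P" "i = w r"
    proof (cases "i < T \<or> T + N \<le> i")
      case False
      define c where "c = i - T"
      have c: "i = T + c" "c < N" using False by (auto simp: c_def)
      show thesis
      proof (cases "c < 2 * length x")
        case True
        then have "c div 2 < length x" "c = 2 * (c div 2) \<or> c = 2 * (c div 2) + 1" by linarith+
        then show thesis using that(2,3) c by metis
      next
        case False
        then show thesis using that(4) that(5)[of "c - (2 * length x + 1)"] c N by (cases "c = 2 * length x") (auto simp: w_def)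
      qed
    qed (rule that(1))
    then show ?thesis
    proof cases
      case 1
      have "sym z (i - T) = 0" if "T \<le> i"
        using 1 that mP N by (auto simp: sym_def z_def length_pair_code u_def)
      then show ?thesis using init[of "TCell 0 0" i] 1 i cell_tag by (auto simp: init_atom_def)
    next
      case (2 r)
      then show ?thesis using init[of "TCell 0 2" i] i cell_tag sym_pair_code(1)[of r x u] by (auto simp: init_atom_def z_def)
    next
      case (3 r)
      then have "init_atom M x T N (TCell 0 (if bitat x r then 2 else 1)) i" by (auto simp: init_atom_def)
      then have "V (TCell 0 (if bitat x r then 2 else 1)) 0 i" using init i cell_tag by auto
      then show ?thesis using 3 sym_pair_code(2)[of r x u] by (simp add: z_def)
    next
      case 4
      then show ?thesis using init[of "TCell 0 1" i] i cell_tag sym_pair_code(3)[of x u] by (auto simp: init_atom_def z_def)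
    next
      case (5 r)
      have s: "sym z (i - T) = sym u r" "T \<le> i" using sym_pair_code(4)[of x u r] 5 by (auto simp: w_def z_def)
      show ?thesis
      proof (cases "r < m")
        case True
        then have "sym z (i - T) = (if V (TCell 0 2) 0 (w r) then 2 else 1)"
          unfolding s(1) by (simp add: sym_def u_def)
        then show ?thesis using before_m[OF True] 5 s(2) by (auto simp: isbit_def)
      next
        case False
        then show ?thesis using after_m[of r] 5 s by (simp add: sym_def u_def)
      qed
    qed
  qed
  \<comment> \<open>Within \<open>T\<close> steps a head stays within \<open>T\<close> cells of cell
    0, so no truncation occurs in \<open>nat\<close> at these times.\<close>
  define hp where "hp t j = nat (snd (tape_at M z t j) + int T)" for t j
  have hp: "int (hp t j) = snd (tape_at M z t j) + int T" "hp t j < W" if "t \<le> T" "j < tapes M" for t j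
    using inv(4)[OF that(2), of t] that(1) by (auto simp: hp_def W_def)
  define cell where "cell t j i = fst (tape_at M z t j) (int i - int T)" for t j i
  have cell: "cell t j i < symbols M" if "j < tapes M" for t j i using inv(3)[OF that] by (simp add: cell_def)
  have len: "length (reads_at M z t) = tapes M" for t by (simp add: reads_at_def)
  have cell_hp: "cell t j (hp t j) = reads_at M z t ! j" if "t \<le> T" "j < tapes M" for t j
    using hp(1)[OF that] that by (simp add: cell_def reads_at_def read_def)
  have reads_ok: "set (reads_at M z t) \<subseteq> {..<symbols M}" for t
    using inv(3)[of _ t] by (auto simp: reads_at_def read_def)
  have st_tag: "TState (state_at M z t) (take r (reads_at M z t)) \<in> tags M" for t r
    using inv(2)[of t] reads_ok[of t] len[of t] by (auto simp: tags_iff dest: in_set_takeD)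
  \<comment> \<open>Only inclusion of the computation in \<open>V\<close> is claimed; Horn clauses
    do not exclude further true atoms.\<close>
  define correct where "correct t \<longleftrightarrow> V (TState (state_at M z t) []) t 0 \<and>
    (\<forall>j<tapes M. V (THead j) t (hp t j)) \<and> (\<forall>j<tapes M. \<forall>i<W. V (TCell j (cell t j i)) t i)" for t
  have chain: "V (TState (state_at M z t) (take r (reads_at M z t))) t 0"
    if c: "correct t" "t \<le> T" "r \<le> tapes M" for t r
    using c(3)
  proof (induction r)
    case 0
    then show ?case using c(1) by (simp add: correct_def)
  next
    case (Suc r)
    let ?rs = "take r (reads_at M z t)"
    have r: "r < tapes M" "length ?rs = r" using Suc.prems len[of t] by auto
    have app: "take (Suc r) (reads_at M z t) = ?rs @ [cell t r (hp t r)]"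
      using r len[of t] cell_hp[OF c(2) r(1)] by (simp add: take_Suc_conv_app_nth)
    have "read_tags M (TState (state_at M z t) ?rs) (THead r) (TCell r (cell t r (hp t r)))
        (TState (state_at M z t) (take (Suc r) (reads_at M z t)))"
      unfolding app read_tags_def
      by (intro exI[of _ "state_at M z t"] exI[of _ ?rs] exI[of _ "cell t r (hp t r)"]) (simp only: r simp_thms)
    then have "clause M x T N True (TState (state_at M z t) ?rs) t 0 True (THead r) t (hp t r)
        True (TCell r (cell t r (hp t r))) t (hp t r) False (TState (state_at M z t) (take (Suc r) (reads_at M z t))) t 0"
      by (simp add: clause_def)
    from satD[OF _ _ _ _ this] show ?case
      using Suc.IH r c(1,2) hp(2)[OF c(2) r(1)] st_tag cell[OF r(1)] by (auto simp: ok_def correct_def tags_iff(2,3) W_def)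
  qed
  have step: "correct (Suc t)" if c: "correct t" "Suc t \<le> T" for t
  proof -
    have t: "t \<le> T" using c by simp
    let ?q = "TState (state_at M z t) (reads_at M z t)"
    have full: "V ?q t 0" "?q \<in> tags M"
      using chain[OF c(1) t order_refl] st_tag[of t "tapes M"] len[of t] by simp_all
    have qok: "ok ?q t 0" using full t by (simp add: ok_def W_def)
    have hok: "ok (THead j) t' (hp t' j)" if "j < tapes M" "t' \<le> T" for j t'
      using that hp(2) by (simp add: ok_def tags_iff)
    have cok: "ok (TCell j (cell t' j i)) t'' i" if "j < tapes M" "t'' \<le> T" "i < W" for j t' t'' i
      using that cell by (simp add: ok_def tags_iff)
    have head: "V (THead j) t (hp t j)" if "j < tapes M" for j using c(1) that by (simp add: correct_def)
    have act: "act (act_at M z t j) (tape_at M z t j) =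
        ((fst (tape_at M z t j))(snd (tape_at M z t j) := fst (act_at M z t j)), snd (tape_at M z t j) + shift (snd (act_at M z t j)))" for j
      by (cases "act_at M z t j"; cases "tape_at M z t j") simp
    have "V (TState (state_at M z (Suc t)) []) (Suc t) 0"
    proof -
      have "next_tags M ?q (TState (state_at M z (Suc t)) [])"
        unfolding next_tags_def inv(5) using len[of t] by blast
      then have "clause M x T N True ?q t 0 True ?q t 0 True ?q t 0 False (TState (state_at M z (Suc t)) []) (Suc t) 0"
        by (simp add: clause_def)
      from satD[OF qok qok qok _ this] show ?thesis
        using full(1) c(2) inv(2)[of "Suc t"] by (auto simp: ok_def W_def tags_iff)
    qed
    moreover have "V (THead j) (Suc t) (hp (Suc t) j)" if j: "j < tapes M" for j
    proof -
      define mv where "mv = snd (act_at M z t j)"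
      have mt: "move_tags M mv ?q (THead j) (THead j)"
        unfolding move_tags_def mv_def act_at_def using len[of t] j by blast
      have "int (hp (Suc t) j) = int (hp t j) + shift mv"
        using hp(1)[OF t j] hp(1)[OF c(2) j] by (simp add: inv(6)[OF j] act mv_def)
      then have "clause M x T N True ?q t 0 True (THead j) t (hp t j) True ?q t 0 False (THead j) (Suc t) (hp (Suc t) j)"
        using mt by (cases mv) (auto simp: clause_def)
      from satD[OF qok hok[OF j t] qok hok[OF j c(2)] this] show ?thesis
        using full(1) head[OF j] by simp
    qed
    moreover have "V (TCell j (cell (Suc t) j i)) (Suc t) i" if j: "j < tapes M" and i: "i < W" for j i
    proof (cases "i = hp t j")
      case True
      have "cell (Suc t) j i = fst (act_at M z t j)"
        using hp(1)[OF t j] by (simp add: cell_def inv(6)[OF j] act True)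
      then have "write_tags M ?q (THead j) (TCell j (cell (Suc t) j i))"
        unfolding write_tags_def act_at_def using len[of t] j by auto
      then have "clause M x T N True ?q t 0 True (THead j) t (hp t j) True ?q t 0 False (TCell j (cell (Suc t) j i)) (Suc t) i"
        using True by (simp add: clause_def)
      from satD[OF qok hok[OF j t] qok cok[OF j c(2) i] this] show ?thesis
        using full(1) head[OF j] by simp
    next
      case False
      have "int i - int T \<noteq> snd (tape_at M z t j)" using hp(1)[OF t j] False by auto
      then have eq: "cell (Suc t) j i = cell t j i" by (simp add: cell_def inv(6)[OF j] act)
      have "keep_tags M (THead j) (TCell j (cell t j i))" unfolding keep_tags_def using j by blast
      then have "clause M x T N True (THead j) t (hp t j) True (TCell j (cell t j i)) t i True (THead j) t (hp t j)
          False (TCell j (cell t j i)) (Suc t) i"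
        using False by (simp add: clause_def)
      from satD[OF hok[OF j t] cok[OF j t i] hok[OF j t] cok[OF j c(2) i] this] show ?thesis
        using head[OF j] c(1) j i eq by (auto simp: correct_def)
    qed
    ultimately show ?thesis by (simp add: correct_def)
  qed
  have base: "correct 0"
  proof -
    have tape0: "tape_at M z 0 j = input_tape (if j = 0 then z else [])" "state_at M z 0 = 0" if "j < tapes M" for j
      using tape_at_0[OF that] by auto
    have "V (TState 0 []) 0 0"
      by (rule init) (auto simp: init_atom_def tags_iff W_def)
    moreover have "V (THead j) 0 (hp 0 j)" if "j < tapes M" for j
    proof -
      have "hp 0 j = T" using tape0(1)[OF that] by (simp add: hp_def input_tape_def)
      then show ?thesis using init[of "THead j" T] that by (auto simp: init_atom_def head_tag_def tags_iff W_def)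
    qed
    moreover have "V (TCell j (cell 0 j i)) 0 i" if "j < tapes M" "i < W" for j i
    proof (cases "j = 0")
      case True
      then show ?thesis using cells0[OF that(2)] tape0(1)[OF that(1)] by (simp add: cell_def input_tape_cell)
    next
      case False
      then have "cell 0 j i = 0" using tape0(1)[OF that(1)] by (simp add: cell_def input_tape_def)
      then show ?thesis using init[of "TCell j 0" i] that False k by (auto simp: init_atom_def blank_tag_def tags_iff)
    qed
    ultimately show ?thesis using tape0(2)[of 0] k by (simp add: correct_def)
  qed
  have "correct t" if "t \<le> T" for t
    using that by (induction t) (use base step in auto)
  then have "V (TCell (tapes M - 1) (cell T (tapes M - 1) T)) T T"
    using k by (simp add: correct_def W_def)
  \<comment> \<open>The one clause without positive literals: it makes the atom of the rejecting
    symbol false, while the atom of the symbol actually present is true.\<close>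
  moreover have "\<not> V (TCell (tapes M - 1) 1) T T"
  proof -
    have "clause M x T N True (TCell (tapes M - 1) 1) T T True (TCell (tapes M - 1) 1) T T
        True (TCell (tapes M - 1) 1) T T True (TCell (tapes M - 1) 1) T T"
      by (simp add: clause_def)
    from satD[OF _ _ _ _ this] show ?thesis using k by (auto simp: ok_def tags_iff W_def)
  qed
  ultimately have "cell T (tapes M - 1) T \<noteq> 1" by metis
  then show ?thesis using mP by (intro exI[of _ u]) (simp add: cell_def z_def u_def)
qed

text \<open>For four fixed tags the clause is plain arithmetic in times and positions. Tag codes are
  below the constant \<open>K\<close>, so the case distinction can be made for one literal after the
  other.\<close>

lemma pdec_computation_clause:
  assumes K: "0 < K" and T: "pcomp (\<lambda>x e. T x)" and N: "pcomp (\<lambda>x e. N x)"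
    and fs: "pcomp f" "pcomp g" "pcomp h" "pcomp k"
  shows "pdec (\<lambda>x e. computation_clause M K (T x) (N x) x (f x e) (g x e) (h x e) (k x e))"
proof -
  have code: "pcomp (\<lambda>x e. f x e div 2 mod K)" if "pcomp f" for f by (intro pcomp_intros that)
  have less: "f x e div 2 mod K < K" for f :: "bool list \<Rightarrow> (nat \<Rightarrow> nat) \<Rightarrow> nat" and x e using K by simp
  have cl: "pdec (\<lambda>x e. clause M x (T x) (N x)
       (odd (f x e)) k1 (f x e div 2 div K div (2 * T x + 1)) (f x e div 2 div K mod (2 * T x + 1))
       (odd (g x e)) k2 (g x e div 2 div K div (2 * T x + 1)) (g x e div 2 div K mod (2 * T x + 1))
       (odd (h x e)) k3 (h x e div 2 div K div (2 * T x + 1)) (h x e div 2 div K mod (2 * T x + 1))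
       (odd (k x e)) k4 (k x e div 2 div K div (2 * T x + 1)) (k x e div 2 div K mod (2 * T x + 1)))" for k1 k2 k3 k4
    unfolding clause_def init_atom_def by (intro pcomp_intros T N fs fs[THEN pcomp_shift])
  let ?c = "\<lambda>k1 k2 k3 k4 x e. clause M x (T x) (N x)
       (odd (f x e)) (from_nat k1) (f x e div 2 div K div (2 * T x + 1)) (f x e div 2 div K mod (2 * T x + 1))
       (odd (g x e)) (from_nat k2) (g x e div 2 div K div (2 * T x + 1)) (g x e div 2 div K mod (2 * T x + 1))
       (odd (h x e)) (from_nat k3) (h x e div 2 div K div (2 * T x + 1)) (h x e div 2 div K mod (2 * T x + 1))
       (odd (k x e)) (from_nat k4) (k x e div 2 div K div (2 * T x + 1)) (k x e div 2 div K mod (2 * T x + 1))"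
  have "pdec (\<lambda>x e. ?c a b c (k x e div 2 mod K) x e)" for a b c
    by (rule pdec_cases[where P = "?c a b c" and f = "\<lambda>x e. k x e div 2 mod K"]) (rule code fs less cl)+
  then have "pdec (\<lambda>x e. ?c a b (h x e div 2 mod K) (k x e div 2 mod K) x e)" for a b
    by (intro pdec_cases[where P = "\<lambda>c x e. ?c a b c (k x e div 2 mod K) x e" and f = "\<lambda>x e. h x e div 2 mod K"])
      (rule code fs less)+
  then have "pdec (\<lambda>x e. ?c a (g x e div 2 mod K) (h x e div 2 mod K) (k x e div 2 mod K) x e)" for a
    by (intro pdec_cases[where P = "\<lambda>b x e. ?c a b (h x e div 2 mod K) (k x e div 2 mod K) x e" and f = "\<lambda>x e. g x e div 2 mod K"])
      (rule code fs less)+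
  then have "pdec (\<lambda>x e. ?c (f x e div 2 mod K) (g x e div 2 mod K) (h x e div 2 mod K) (k x e div 2 mod K) x e)"
    by (intro pdec_cases[where P = "\<lambda>a x e. ?c a (g x e div 2 mod K) (h x e div 2 mod K) (k x e div 2 mod K) x e" and f = "\<lambda>x e. f x e div 2 mod K"])
      (rule code fs less)+
  then show ?thesis unfolding computation_clause_def .
qed

lemma matching_language_NP_hard: "NP_hard (matching_language c)"
proof (rule NP_hard_matching_language)
  fix A assume "A \<in> class_NP"
  then obtain B and p :: "nat poly" where B: "B \<in> class_P"
    "\<And>x. x \<in> A \<longleftrightarrow> (\<exists>u. length u \<le> poly p (length x) \<and> pair_code x u \<in> B)"
    unfolding class_NP_def by blast
  obtain M and q :: "nat poly" where M: "wf_tm M" "\<And>z. computes_within M z [z \<in> B] (poly q (length z))"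
    using B(1) unfolding class_P_def poly_time_def by blast
  obtain K where K: "0 < K" "\<forall>k\<in>tags M. to_nat k < K" using tag_bound by blast
  define P where "P x = poly p (length x)" for x :: "bool list"
  define N where "N x = 2 * length x + 1 + P x" for x
  \<comment> \<open>The first summand lets the verifier halt on every pair of length at most
    \<open>N x\<close>; the second makes room for such a pair to the right of cell 0.\<close>
  define T where "T x = poly q (N x) + N x" for x
  have pN: "pcomp (\<lambda>x e. N x)" unfolding N_def P_def by (intro pcomp_intros)
  have pT: "pcomp (\<lambda>x e. T x)" unfolding T_def by (intro pcomp_intros pN)
  have accept: "fst (tape_at M (pair_code x u) (T x) (tapes M - 1)) 0 \<noteq> 1 \<longleftrightarrow> pair_code x u \<in> B"
    if "length u \<le> P x" for x u
  proof -
    have "length (pair_code x u) \<le> N x" using that by (simp add: N_def length_pair_code)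
    then have "poly q (length (pair_code x u)) \<le> T x"
      unfolding T_def by (intro trans_le_add1 poly_nat_mono)
    from halted_config[OF M(1) M(2) this] show ?thesis by (cases "pair_code x u \<in> B") simp_all
  qed
  have iff: "x \<in> A \<longleftrightarrow> satisfiable ((T x + 1) * (2 * T x + 1) * K) (computation_clause M K (T x) (N x) x)" for x
  proof
    assume "x \<in> A"
    then obtain u where u: "length u \<le> P x" "pair_code x u \<in> B" unfolding B(2) P_def by blast
    then have "length (pair_code x u) \<le> N x" by (simp add: N_def length_pair_code)
    then show "satisfiable ((T x + 1) * (2 * T x + 1) * K) (computation_clause M K (T x) (N x) x)"
      using computation_satisfiable[OF M(1)] accept[OF u(1)] u(2) by blast
  next
    assume "satisfiable ((T x + 1) * (2 * T x + 1) * K) (computation_clause M K (T x) (N x) x)"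
    from satisfiable_computation[OF M(1) K(2) N_def _ this]
    obtain u where "length u \<le> P x" "fst (tape_at M (pair_code x u) (T x) (tapes M - 1)) 0 \<noteq> 1"
      by (auto simp: T_def)
    then show "x \<in> A" unfolding B(2) using accept P_def by auto
  qed
  show "\<exists>n cl. pcomp (\<lambda>x e. n x) \<and> (\<forall>x. 0 < n x) \<and>
      (\<forall>f g h k. pcomp f \<longrightarrow> pcomp g \<longrightarrow> pcomp h \<longrightarrow> pcomp k \<longrightarrow>
        pdec (\<lambda>x e. cl x (f x e) (g x e) (h x e) (k x e))) \<and>
      (\<forall>x. x \<in> A \<longleftrightarrow> satisfiable (n x) (cl x))"
  proof (intro exI[of _ "\<lambda>x. (T x + 1) * (2 * T x + 1) * K"] exI[of _ "\<lambda>x. computation_clause M K (T x) (N x) x"]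
      conjI allI impI iff pdec_computation_clause K(1) pT pN)
    show "pcomp (\<lambda>x e. (T x + 1) * (2 * T x + 1) * K)" by (intro pcomp_intros pT)
    show "0 < (T x + 1) * (2 * T x + 1) * K" for x using K(1) by simp
  qed
qed

theorem theorem1:
  "NP_complete PERFECT_DISTANCE_MATCHING \<and>
   NP_complete (PERFECT_DISTANCE_MATCHING_max_degree 4)"
proof -
  have *: "PERFECT_DISTANCE_MATCHING = matching_language False"
    "PERFECT_DISTANCE_MATCHING_max_degree 4 = matching_language True"
    by (simp_all add: PERFECT_DISTANCE_MATCHING_def PERFECT_DISTANCE_MATCHING_max_degree_def matching_language_def)
  show ?thesis
    unfolding * NP_complete_def using matching_language_NP matching_language_NP_hard by blast
qed

end
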